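(* Let $p=n^{-1/4}$ and $G\in\mathcal{G}(n,p)$. Then there are absolute constants $c,C>0$ such that with probability tending to $1$, $c\log^* n\le D(G)\le C\log^* n$; i.e. $D(G)=\Theta(\log^* n)$ with high probability.
   Context: Graphs are finite and simple. First order sentences about graphs use variables over vertices, relations $=$ and $\sim$ (adjacency), quantifiers $\forall,\exists$ and Boolean connectives; quantifier depth is the maximum number of nested quantifiers. A sentence $A$ defines $G$ if $G\models A$ and $H\not\models A$ for all $H\not\cong G$; $D(G)$ is the minimum depth of a sentence defining $G$. $\log^* n=\min\{i\in\mathbb{N}: \log_2^{(i)} n<1\}$, where $\log_2^{(i)}$ is the $i$-fold iterated binary logarithm. $\mathcal{G}(n,p)$ is the random graph on $\{1,\dots,n\}$ with each edge present independently with probability $p$. *)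

theory Defs
  imports
    "HOL-Probability.Probability"
    "Graph_Theory.Pair_Digraph"
    "Graph_Theory.Digraph_Isomorphism"
begin

text \<open>
  A finite simple graph is a \<open>pair_graph\<close>: a finite vertex set with a symmetric irreflexive set of
  arcs, the edge between \<open>u\<close> and \<open>v\<close> being the two arcs \<open>(u, v)\<close> and \<open>(v, u)\<close>.
  All graphs have vertices in the natural numbers; this covers every finite graph up to isomorphism.
\<close>

datatype fo =
    Eq nat nat
  | Adj nat nat
  | Neg fo
  | Conj fo fo
  | Disj fo fo
  | Impl fo fo
  | Forall nat fo
  | Exists nat fo

primrec fvars :: "fo \<Rightarrow> nat set" where
  "fvars (Eq x y) = {x, y}"
| "fvars (Adj x y) = {x, y}"
| "fvars (Neg a) = fvars a"
| "fvars (Conj a b) = fvars a \<union> fvars b"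
| "fvars (Disj a b) = fvars a \<union> fvars b"
| "fvars (Impl a b) = fvars a \<union> fvars b"
| "fvars (Forall x a) = fvars a - {x}"
| "fvars (Exists x a) = fvars a - {x}"

definition is_sentence :: "fo \<Rightarrow> bool" where
  "is_sentence a \<longleftrightarrow> fvars a = {}"

primrec qdepth :: "fo \<Rightarrow> nat" where
  "qdepth (Eq x y) = 0"
| "qdepth (Adj x y) = 0"
| "qdepth (Neg a) = qdepth a"
| "qdepth (Conj a b) = max (qdepth a) (qdepth b)"
| "qdepth (Disj a b) = max (qdepth a) (qdepth b)"
| "qdepth (Impl a b) = max (qdepth a) (qdepth b)"
| "qdepth (Forall x a) = Suc (qdepth a)"
| "qdepth (Exists x a) = Suc (qdepth a)"

primrec sat :: "nat pair_pre_digraph \<Rightarrow> (nat \<Rightarrow> nat) \<Rightarrow> fo \<Rightarrow> bool" where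
  "sat G s (Eq x y) \<longleftrightarrow> s x = s y"
| "sat G s (Adj x y) \<longleftrightarrow> (s x, s y) \<in> parcs G"
| "sat G s (Neg a) \<longleftrightarrow> \<not> sat G s a"
| "sat G s (Conj a b) \<longleftrightarrow> sat G s a \<and> sat G s b"
| "sat G s (Disj a b) \<longleftrightarrow> sat G s a \<or> sat G s b"
| "sat G s (Impl a b) \<longleftrightarrow> (sat G s a \<longrightarrow> sat G s b)"
| "sat G s (Forall x a) \<longleftrightarrow> (\<forall>v \<in> pverts G. sat G (s(x := v)) a)"
| "sat G s (Exists x a) \<longleftrightarrow> (\<exists>v \<in> pverts G. sat G (s(x := v)) a)"

lemma sat_cong: "(\<And>x. x \<in> fvars a \<Longrightarrow> s x = t x) \<Longrightarrow> sat G s a = sat G t a"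
proof (induction a arbitrary: s t)
  case (Forall x a)
  have "sat G (s(x := v)) a = sat G (t(x := v)) a" for v
    by (rule Forall.IH) (use Forall.prems in auto)
  then show ?case by simp
next
  case (Exists x a)
  have "sat G (s(x := v)) a = sat G (t(x := v)) a" for v
    by (rule Exists.IH) (use Exists.prems in auto)
  then show ?case by simp
next
  case (Conj a b) show ?case using Conj.IH[of s t] Conj.prems by simp
next
  case (Disj a b) show ?case using Disj.IH[of s t] Disj.prems by simp
next
  case (Impl a b) show ?case using Impl.IH[of s t] Impl.prems by simp
next
  case (Neg a) show ?case using Neg.IH[of s t] Neg.prems by simp
qed simp_all

text \<open>
  Only used for sentences, whose truth value does not depend on the assignment.
\<close>
definition models :: "nat pair_pre_digraph \<Rightarrow> fo \<Rightarrow> bool" where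
  "models G a \<longleftrightarrow> (\<forall>s. sat G s a)"

lemma models_sentence:
  "is_sentence a \<Longrightarrow> models G a \<longleftrightarrow> sat G s a"
proof -
  assume "is_sentence a"
  then have "sat G t a = sat G s a" for t
    by (intro sat_cong) (simp add: is_sentence_def)
  then show "models G a \<longleftrightarrow> sat G s a" unfolding models_def by blast
qed

definition fo_defines :: "fo \<Rightarrow> nat pair_pre_digraph \<Rightarrow> bool" where
  "fo_defines a G \<longleftrightarrow> is_sentence a \<and> models G a \<and>
     (\<forall>H :: nat pair_pre_digraph. pair_graph H \<and> \<not> digraph_iso (with_proj H) (with_proj G)
        \<longrightarrow> \<not> models H a)"

text \<open>
  The minimum is over a nonempty set whenever \<open>G\<close> is a finite graph.
\<close>
definition fo_depth :: "nat pair_pre_digraph \<Rightarrow> nat" where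
  "fo_depth G = (LEAST d. \<exists>a. fo_defines a G \<and> qdepth a = d)"

text \<open>
  The library's \<open>log 2\<close> is total, but the iteration stops at the first value below 1, so only
  logarithms of numbers at least 1 are taken.
\<close>
definition log_star :: "real \<Rightarrow> nat" where
  "log_star x = (LEAST i. (log 2 ^^ i) x < 1)"

definition vertex_pairs :: "nat \<Rightarrow> nat set set" where
  "vertex_pairs n = {e. e \<subseteq> {1..n} \<and> card e = 2}"

definition graph_of_edges :: "nat \<Rightarrow> (nat set \<Rightarrow> bool) \<Rightarrow> nat pair_pre_digraph" where
  "graph_of_edges n f =
     \<lparr> pverts = {1..n}, parcs = {(u, v). {u, v} \<in> vertex_pairs n \<and> f {u, v}} \<rparr>"

text \<open>
  The product distribution below picks independently for each vertex pair whether it is an edge;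
  \<open>False\<close> is only the default value of \<open>Pi_pmf\<close> outside the index set.
\<close>
definition random_graph :: "nat \<Rightarrow> real \<Rightarrow> nat pair_pre_digraph pmf" where
  "random_graph n p =
     map_pmf (graph_of_edges n) (Pi_pmf (vertex_pairs n) False (\<lambda>_. bernoulli_pmf p))"

lemma pair_graph_graph_of_edges: "pair_graph (graph_of_edges n f)"
proof -
  have ne: "u \<noteq> v \<and> u \<in> {1..n} \<and> v \<in> {1..n}" if "{u, v} \<in> vertex_pairs n" for u v
    using that by (cases "u = v") (simp_all add: vertex_pairs_def)
  have fin: "finite {(u, v). {u, v} \<in> vertex_pairs n \<and> f {u, v}}"
    by (rule finite_subset[of _ "{1..n} \<times> {1..n}"]) (use ne in blast, simp)
  have sy: "sym {(u, v). {u, v} \<in> vertex_pairs n \<and> f {u, v}}"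
    by (rule symI) (simp add: doubleton_eq_iff insert_commute)
  show ?thesis
  proof unfold_locales
    fix e assume "e \<in> parcs (graph_of_edges n f)"
    then have *: "{fst e, snd e} \<in> vertex_pairs n" by (simp add: graph_of_edges_def split_beta)
    show "fst e \<in> pverts (graph_of_edges n f)" "snd e \<in> pverts (graph_of_edges n f)"
      "fst e \<noteq> snd e"
      using ne[OF *] by (simp_all add: graph_of_edges_def)
  next
    show "finite (pverts (graph_of_edges n f))" by (simp add: graph_of_edges_def)
  next
    show "finite (parcs (graph_of_edges n f))" using fin by (simp add: graph_of_edges_def)
  next
    show "symmetric (with_proj (graph_of_edges n f))"
      using sy by (simp add: graph_of_edges_def symmetric_def)
  qed
qed

end

theory Submission
  imports Defs "HOL-Library.Nat_Bijection" "HOL-Real_Asymp.Real_Asymp"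
begin

text \<open>
  Lower bound: the number of types of rank \<open>k\<close> is at most a tower of height \<open>2 k + O(1)\<close>, and a type
  containing a sentence that defines a graph belongs to a single isomorphism class. Such a class
  has probability at most \<open>n ^ n * (1 - p) ^ (n choose 2)\<close>, so the union of the classes is negligible.

  Upper bound: if every vertex is definable by a formula with boundedly many parameters and depth
  \<open>d\<close>, then a sentence of depth \<open>d + O(1)\<close> lists all vertices and adjacencies. As \<open>n * p ^ 4 = 1\<close>,
  the common neighbourhood \<open>A\<close> of four vertices is a Poisson-like random set, and for further
  vertices \<open>y, z\<close> the relation "\<open>a\<close>, \<open>b\<close>, \<open>y\<close>, \<open>z\<close> have a common neighbour" is a random graph on \<open>A\<close>
  of constant density. With many independent trials for the parameters, some \<open>A\<close> has size about
  \<open>(ln n) powr (2 / 5)\<close> and carries a prescribed graph, namely one in which level \<open>k + 1\<close> consists of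
  the nonempty subsets of level \<open>k\<close>; its vertices are definable with depth \<open>log_star n + O(1)\<close>.
  Every other vertex \<open>v\<close> is then recognised by the triples in \<open>A\<close> that have a common neighbour
  with \<open>v\<close>: there are far more than \<open>ln n\<close> triples, so no two vertices agree on all of them.
  The few vertices reserved for the trials are told apart by their neighbourhoods.
\<close>

section \<open>Isomorphism and definability\<close>

text \<open>The exponent 1/4 balances two counts at once. A pair of core vertices is the exact trace
  of about \<open>n * p ^ 2\<close> outside vertices, each joined to two further parameters with
  probability \<open>p ^ 2\<close>; a triple is the exact trace of about \<open>n * p ^ 3\<close>,
  each joined to a given vertex with probability \<open>p\<close>. Both products are 1, so a witness
  exists with probability bounded away from 0 and 1. Exact traces make the witness sets of different
  pairs or triples disjoint, hence the events independent. A core of size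
  \<open>(ln n) powr b\<close> needs \<open>2 * b < 1\<close>, so that a prescribed graph on it
  turns up among polynomially many trials, and \<open>3 * b > 1\<close>, so that its triples survive
  a union bound over \<open>n ^ 2\<close> pairs of vertices; \<open>2 / 5\<close> lies between. The
  trials must be so few that the pool spans no edge: \<open>m ^ 2 * p\<close> tends to 0 for
  \<open>m\<close> about \<open>n powr (1 / 10)\<close>. The obstacle is that the core is itself
  random. Conditioning is done by resampling: the edges that select the core are frozen, after which
  the core is a constant set and all other edges are fresh.\<close>

lemma digraph_iso_with_projI:
  assumes "pair_graph H" "bij_betw f (pverts H) (pverts G)"
    and "pair_graph G"
    and "\<And>x y. x \<in> pverts H \<Longrightarrow> y \<in> pverts H \<Longrightarrow> (x, y) \<in> parcs H \<longleftrightarrow> (f x, f y) \<in> parcs G"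
  shows "digraph_iso (with_proj H) (with_proj G)"
proof -
  interpret H: pair_graph H by fact
  interpret G: pair_graph G by fact
  define h where "h = \<lparr>iso_verts = f, iso_arcs = map_prod f f, iso_head = snd, iso_tail = fst\<rparr>"
  have inj: "inj_on f (pverts H)" and im: "f ` pverts H = pverts G"
    using assms(2) by (auto simp: bij_betw_def)
  have "inj_on (map_prod f f) (parcs H)"
    by (rule inj_on_subset[OF map_prod_inj_on[OF inj inj]]) (auto dest: H.wellformed')
  then have "pre_digraph.digraph_isomorphism (with_proj H) h"
    unfolding pre_digraph.digraph_isomorphism_def h_def
    using inj H.wf_digraph_axioms by auto
  moreover have "map_prod f f ` parcs H = parcs G"
  proof (intro equalityI subsetI)
    fix e assume "e \<in> map_prod f f ` parcs H"
    then show "e \<in> parcs G" using assms(4) by (auto dest: H.wellformed')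
  next
    fix e assume e: "e \<in> parcs G"
    then obtain a b where ab: "e = (a, b)" "a \<in> pverts G" "b \<in> pverts G"
      by (cases e) (auto dest: G.wellformed')
    then obtain x y where "x \<in> pverts H" "y \<in> pverts H" "a = f x" "b = f y"
      using im by blast
    then show "e \<in> map_prod f f ` parcs H"
      using assms(4) e ab by (intro image_eqI[of _ _ "(x, y)"]) auto
  qed
  then have "with_proj G = app_iso h (with_proj H)"
    using im by (simp add: app_iso_def h_def with_proj_def)
  ultimately show ?thesis unfolding digraph_iso_def by blast
qed

text \<open>Heads and tails of arcs are the two projections in both graphs, so the arc map of a
  library isomorphism is forced by its vertex map and only the latter needs to be kept.\<close>

lemma digraph_iso_with_projD:
  assumes "digraph_iso (with_proj H) (with_proj G)"
  obtains f where "bij_betw f (pverts H) (pverts G)"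
    "\<And>x y. x \<in> pverts H \<Longrightarrow> y \<in> pverts H \<Longrightarrow> (x, y) \<in> parcs H \<longleftrightarrow> (f x, f y) \<in> parcs G"
proof -
  obtain h where h: "pre_digraph.digraph_isomorphism (with_proj H) h"
    and G: "with_proj G = app_iso h (with_proj H)"
    using assms unfolding digraph_iso_def by blast
  let ?f = "iso_verts h"
  note h' = h[unfolded pre_digraph.digraph_isomorphism_def, simplified]
  have V: "pverts G = ?f ` pverts H" and E: "parcs G = iso_arcs h ` parcs H"
    and t: "iso_tail h = fst" and hd: "iso_head h = snd"
    using G unfolding with_proj_def app_iso_def by simp_all
  have arcs: "iso_arcs h (x, y) = (?f x, ?f y)" if "(x, y) \<in> parcs H" for x y
    using h' that t hd by (metis fst_conv snd_conv prod.collapse)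
  have wf: "x \<in> pverts H \<and> y \<in> pverts H" if "(x, y) \<in> parcs H" for x y
    using h' that by (auto simp: wf_digraph_wp_iff dest: pair_wf_digraph.wellformed')
  show ?thesis
  proof (rule that[of ?f])
    show "bij_betw ?f (pverts H) (pverts G)" using h' V by (simp add: bij_betw_def)
    fix x y assume xy: "x \<in> pverts H" "y \<in> pverts H"
    show "(x, y) \<in> parcs H \<longleftrightarrow> (?f x, ?f y) \<in> parcs G"
    proof
      assume "(x, y) \<in> parcs H"
      then show "(?f x, ?f y) \<in> parcs G" unfolding E using arcs by (metis image_eqI)
    next
      assume "(?f x, ?f y) \<in> parcs G"
      then obtain a b where ab: "(a, b) \<in> parcs H" "(?f x, ?f y) = (?f a, ?f b)"
        unfolding E using arcs by auto
      then show "(x, y) \<in> parcs H"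
        using wf[OF ab(1)] xy h' by (metis inj_onD prod.inject)
    qed
  qed
qed

section \<open>Finite conjunctions, disjunctions and blocks of quantifiers\<close>

definition big_conj :: "fo list \<Rightarrow> fo" where
  "big_conj as = foldr Conj as (Eq 0 0)"

definition big_disj :: "fo list \<Rightarrow> fo" where
  "big_disj as = foldr Disj as (Neg (Eq 0 0))"

lemma sat_big_conj [simp]: "sat G s (big_conj as) \<longleftrightarrow> (\<forall>a\<in>set as. sat G s a)"
  by (induction as) (simp_all add: big_conj_def)

lemma sat_big_disj [simp]: "sat G s (big_disj as) \<longleftrightarrow> (\<exists>a\<in>set as. sat G s a)"
  by (induction as) (simp_all add: big_disj_def)

text \<open>The variable 0 enters through the units \<open>Eq 0 0\<close> and its negation. This
  costs nothing, as 0 is one of the parameter variables.\<close>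

lemma fvars_big [simp]: "fvars (big_conj as) = insert 0 (\<Union> (fvars ` set as))"
  "fvars (big_disj as) = insert 0 (\<Union> (fvars ` set as))"
  by (induction as) (auto simp: big_conj_def big_disj_def)

lemma qdepth_big: "(\<And>a. a \<in> set as \<Longrightarrow> qdepth a \<le> d) \<Longrightarrow> qdepth (big_conj as) \<le> d"
  "(\<And>a. a \<in> set as \<Longrightarrow> qdepth a \<le> d) \<Longrightarrow> qdepth (big_disj as) \<le> d"
  by (induction as) (auto simp: big_conj_def big_disj_def)

lemma sat_Exists_list:
  "distinct xs \<Longrightarrow> sat G s (foldr Exists xs a) \<longleftrightarrow>
    (\<exists>t. (\<forall>i\<in>set xs. t i \<in> pverts G) \<and> (\<forall>i. i \<notin> set xs \<longrightarrow> t i = s i) \<and> sat G t a)"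
proof (induction xs arbitrary: s)
  case Nil
  have "t = s" if "\<forall>i. t i = s i" for t using that by auto
  then show ?case by auto
next
  case (Cons x xs)
  have "sat G s (foldr Exists (x # xs) a) \<longleftrightarrow> (\<exists>v\<in>pverts G. \<exists>t. (\<forall>i\<in>set xs. t i \<in> pverts G) \<and>
      (\<forall>i. i \<notin> set xs \<longrightarrow> t i = (s(x := v)) i) \<and> sat G t a)"
    using Cons by simp
  also have "\<dots> \<longleftrightarrow> (\<exists>t. (\<forall>i\<in>set (x # xs). t i \<in> pverts G) \<and>
      (\<forall>i. i \<notin> set (x # xs) \<longrightarrow> t i = s i) \<and> sat G t a)"
  proof safe
    fix v t assume *: "v \<in> pverts G" "\<forall>i\<in>set xs. t i \<in> pverts G"
      "\<forall>i. i \<notin> set xs \<longrightarrow> t i = (s(x := v)) i" "sat G t a"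
    then show "\<exists>t. (\<forall>i\<in>set (x # xs). t i \<in> pverts G) \<and>
      (\<forall>i. i \<notin> set (x # xs) \<longrightarrow> t i = s i) \<and> sat G t a"
      using Cons.prems by (intro exI[of _ t]) auto
  next
    fix t assume *: "\<forall>i\<in>set (x # xs). t i \<in> pverts G" 
      "\<forall>i. i \<notin> set (x # xs) \<longrightarrow> t i = s i" "sat G t a"
    then show "\<exists>v\<in>pverts G. \<exists>t. (\<forall>i\<in>set xs. t i \<in> pverts G) \<and>
      (\<forall>i. i \<notin> set xs \<longrightarrow> t i = (s(x := v)) i) \<and> sat G t a"
      by (intro bexI[of _ "t x"] exI[of _ t]) auto
  qed
  finally show ?case .
qed

lemma fvars_Exists_list: "fvars (foldr Exists xs a) = fvars a - set xs"
  by (induction xs) auto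

lemma qdepth_Exists_list: "qdepth (foldr Exists xs a) = qdepth a + length xs"
  by (induction xs) auto

text \<open>
  The variables below 8 are reserved for the parameters, so a definition of a set of vertices is a
  formula with one further free variable. Asking for one formula per choice of this variable avoids
  a substitution operation on formulas.
\<close>

locale graph_params = pair_graph G for G :: "nat pair_pre_digraph" +
  fixes par :: "nat \<Rightarrow> nat"
  assumes par: "i < 8 \<Longrightarrow> par i \<in> pverts G"
begin

abbreviation "V \<equiv> pverts G"

definition admissible :: "(nat \<Rightarrow> nat) \<Rightarrow> bool" where
  "admissible s \<longleftrightarrow> (\<forall>i<8. s i = par i)"

definition definable :: "nat \<Rightarrow> nat set \<Rightarrow> bool" where
  "definable d R \<longleftrightarrow> (\<forall>x\<ge>8. \<exists>a. qdepth a \<le> d \<and> fvars a \<subseteq> insert x {..<8} \<and>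
     (\<forall>s. admissible s \<and> s x \<in> V \<longrightarrow> (sat G s a \<longleftrightarrow> s x \<in> R)))"

definition definable2 :: "nat \<Rightarrow> (nat \<Rightarrow> nat \<Rightarrow> bool) \<Rightarrow> bool" where
  "definable2 d S \<longleftrightarrow> (\<forall>x\<ge>8. \<forall>y\<ge>8. x \<noteq> y \<longrightarrow> (\<exists>a. qdepth a \<le> d \<and> fvars a \<subseteq> {x, y} \<union> {..<8} \<and>
     (\<forall>s. admissible s \<and> s x \<in> V \<and> s y \<in> V \<longrightarrow> (sat G s a \<longleftrightarrow> S (s x) (s y)))))"

lemma definable_mono: "definable d R \<Longrightarrow> d \<le> d' \<Longrightarrow> definable d' R"
  unfolding definable_def by (meson le_trans)

lemma definable2_mono: "definable2 d R \<Longrightarrow> d \<le> d' \<Longrightarrow> definable2 d' R"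
  unfolding definable2_def by (meson le_trans)

lemma definable_cong: "definable d R \<Longrightarrow> (\<And>v. v \<in> V \<Longrightarrow> v \<in> R \<longleftrightarrow> v \<in> R') \<Longrightarrow> definable d R'"
  unfolding definable_def by simp

lemma definable_empty: "definable d {}"
  unfolding definable_def by (auto intro!: exI[of _ "Neg (Eq 0 0)"])

lemma definable_par:
  assumes "i < 8" shows "definable d {par i}"
  unfolding definable_def admissible_def
proof (intro allI impI)
  fix x :: nat
  show "\<exists>a. qdepth a \<le> d \<and> fvars a \<subseteq> insert x {..<8} \<and>
     (\<forall>s. (\<forall>i<8. s i = par i) \<and> s x \<in> V \<longrightarrow> (sat G s a \<longleftrightarrow> s x \<in> {par i}))"
    using assms by (intro exI[of _ "Eq x i"]) auto
qed

lemma definable_compl: 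
  assumes "definable d R" shows "definable d (V - R)"
  unfolding definable_def
proof (intro allI impI)
  fix x :: nat assume "8 \<le> x"
  then obtain a where "qdepth a \<le> d" "fvars a \<subseteq> insert x {..<8}"
     "\<forall>s. admissible s \<and> s x \<in> V \<longrightarrow> (sat G s a \<longleftrightarrow> s x \<in> R)"
    using assms unfolding definable_def by blast
  then show "\<exists>a. qdepth a \<le> d \<and> fvars a \<subseteq> insert x {..<8} \<and>
     (\<forall>s. admissible s \<and> s x \<in> V \<longrightarrow> (sat G s a \<longleftrightarrow> s x \<in> V - R))"
    by (intro exI[of _ "Neg a"]) auto
qed

lemma definable_Un: 
  assumes "definable d R" "definable d R'" shows "definable d (R \<union> R')"
  unfolding definable_def
proof (intro allI impI)
  fix x :: nat assume x: "8 \<le> x"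
  obtain a where a: "qdepth a \<le> d" "fvars a \<subseteq> insert x {..<8}"
     "\<forall>s. admissible s \<and> s x \<in> V \<longrightarrow> (sat G s a \<longleftrightarrow> s x \<in> R)"
    using assms(1) x unfolding definable_def by blast
  obtain b where "qdepth b \<le> d" "fvars b \<subseteq> insert x {..<8}"
     "\<forall>s. admissible s \<and> s x \<in> V \<longrightarrow> (sat G s b \<longleftrightarrow> s x \<in> R')"
    using assms(2) x unfolding definable_def by blast
  with a show "\<exists>a. qdepth a \<le> d \<and> fvars a \<subseteq> insert x {..<8} \<and>
     (\<forall>s. admissible s \<and> s x \<in> V \<longrightarrow> (sat G s a \<longleftrightarrow> s x \<in> R \<union> R'))"
    by (intro exI[of _ "Disj a b"]) auto
qed

lemma definable_UN:
  "finite I \<Longrightarrow> (\<And>i. i \<in> I \<Longrightarrow> definable d (R i)) \<Longrightarrow> definable d (\<Union>i\<in>I. R i)"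
  by (induction rule: finite_induct) (auto intro: definable_empty definable_Un)

lemma definable_Diff:
  assumes "definable d R" "definable d R'" shows "definable d (R - R')"
  by (rule definable_cong[OF definable_compl[OF definable_Un[OF definable_compl[OF assms(1)] assms(2)]]]) auto

lemma definable_Int:
  assumes "definable d R" "definable d R'" shows "definable d (R \<inter> R')"
  by (rule definable_cong[OF definable_Diff[OF assms(1) definable_compl[OF assms(2)]]]) auto

lemma definable_finite:
  assumes "R \<subseteq> V" "\<And>v. v \<in> R \<Longrightarrow> definable d {v}" shows "definable d R"
proof -
  have "definable d (\<Union>v\<in>R. {v})"
    using assms pair_finite_verts by (intro definable_UN) (auto dest: finite_subset)
  then show ?thesis by simp
qed

text \<open>The step that spends a quantifier. The bound variable may be any that differs from
  \<open>x\<close> and from the parameters, because definability supplies a formula in each such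
  variable; \<open>Suc x\<close> is taken.\<close>

lemma definable_image:
  assumes "definable d R" "definable2 d S"
  shows "definable (Suc d) {v. \<exists>w\<in>V. w \<in> R \<and> S v w}"
  unfolding definable_def
proof (intro allI impI)
  fix x :: nat assume x: "8 \<le> x"
  define y where "y = Suc x"
  have y: "8 \<le> y" "x \<noteq> y" using x by (auto simp: y_def)
  obtain a where a: "qdepth a \<le> d" "fvars a \<subseteq> insert y {..<8}"
     "\<forall>s. admissible s \<and> s y \<in> V \<longrightarrow> (sat G s a \<longleftrightarrow> s y \<in> R)"
    using assms(1) y unfolding definable_def by blast
  obtain b where b: "qdepth b \<le> d" "fvars b \<subseteq> {x, y} \<union> {..<8}"
     "\<forall>s. admissible s \<and> s x \<in> V \<and> s y \<in> V \<longrightarrow> (sat G s b \<longleftrightarrow> S (s x) (s y))"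
    using assms(2) x y unfolding definable2_def by blast
  have adm: "admissible (s(y := v))" if "admissible s" for s v
    using that y by (auto simp: admissible_def)
  show "\<exists>a. qdepth a \<le> Suc d \<and> fvars a \<subseteq> insert x {..<8} \<and>
     (\<forall>s. admissible s \<and> s x \<in> V \<longrightarrow> (sat G s a \<longleftrightarrow> s x \<in> {v. \<exists>w\<in>V. w \<in> R \<and> S v w}))"
    using a b y adm by (intro exI[of _ "Exists y (Conj a b)"]) (auto; blast)
qed

lemma definable2_adj: "definable2 d (\<lambda>v w. (v, w) \<in> parcs G)"
  unfolding definable2_def
proof (intro allI impI)
  fix x y :: nat assume "8 \<le> x" "8 \<le> y"
  then show "\<exists>a. qdepth a \<le> d \<and> fvars a \<subseteq> {x, y} \<union> {..<8} \<and>
     (\<forall>s. admissible s \<and> s x \<in> V \<and> s y \<in> V \<longrightarrow> (sat G s a \<longleftrightarrow> (s x, s y) \<in> parcs G))"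
    by (intro exI[of _ "Adj x y"]) auto
qed

lemma definable2_compl:
  assumes "definable2 d S" shows "definable2 d (\<lambda>v w. \<not> S v w)"
  unfolding definable2_def
proof (intro allI impI)
  fix x y :: nat assume "8 \<le> x" "8 \<le> y" "x \<noteq> y"
  then obtain a where "qdepth a \<le> d" "fvars a \<subseteq> {x, y} \<union> {..<8}"
     "\<forall>s. admissible s \<and> s x \<in> V \<and> s y \<in> V \<longrightarrow> (sat G s a \<longleftrightarrow> S (s x) (s y))"
    using assms unfolding definable2_def by blast
  then show "\<exists>a. qdepth a \<le> d \<and> fvars a \<subseteq> {x, y} \<union> {..<8} \<and>
     (\<forall>s. admissible s \<and> s x \<in> V \<and> s y \<in> V \<longrightarrow> (sat G s a \<longleftrightarrow> \<not> S (s x) (s y)))"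
    by (intro exI[of _ "Neg a"]) auto
qed

text \<open>
  One quantifier suffices since the elements of \<open>L\<close> are definable.
\<close>
lemma definable_trace:
  assumes L: "L \<subseteq> V" "\<And>v. v \<in> L \<Longrightarrow> definable d {v}" and S: "definable2 d S"
  shows "definable (Suc d) {v. \<forall>w\<in>L. S v w \<longleftrightarrow> w \<in> T}"
proof -
  have 1: "definable (Suc d) {v. \<exists>w\<in>V. w \<in> L - T \<and> S v w}"
    by (rule definable_image[OF definable_finite S]) (use L in auto)
  have 2: "definable (Suc d) {v. \<exists>w\<in>V. w \<in> L \<inter> T \<and> \<not> S v w}"
    by (rule definable_image[OF definable_finite definable2_compl[OF S]]) (use L in auto)
  show ?thesis
    by (rule definable_cong[OF definable_compl[OF definable_Un[OF 1 2]]]) (use L in auto)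
qed

text \<open>
  In another graph the formulas chosen for \<open>x = 8\<close> and for \<open>x = 9\<close> may differ, but the third
  conjunct below, applied to equal values of the two variables, forces them to agree.
\<close>
lemma fo_defines_of_definable:
  assumes def: "\<And>v. v \<in> V \<Longrightarrow> definable d {v}"
  shows "\<exists>a. fo_defines a G \<and> qdepth a \<le> d + 10"
proof -
  obtain vs where vs: "set vs = V" using finite_list[OF pair_finite_verts] by blast
  define defs where "defs x v a \<longleftrightarrow> qdepth a \<le> d \<and> fvars a \<subseteq> insert x {..<8} \<and>
     (\<forall>s. admissible s \<and> s x \<in> V \<longrightarrow> (sat G s a \<longleftrightarrow> s x \<in> {v}))" for x v a
  have "\<exists>a. defs x v a" if "x \<ge> 8" "v \<in> V" for x v
    using def[OF that(2)] that(1) unfolding definable_def defs_def by blast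
  then obtain F where "\<And>x v. x \<ge> 8 \<Longrightarrow> v \<in> V \<Longrightarrow> defs x v (F x v)" by metis
  note F = this[unfolded defs_def]
  define lit where "lit b a = (if b then a else Neg a)" for b a
  have sat_lit [simp]: "sat K s (lit b a) \<longleftrightarrow> (sat K s a \<longleftrightarrow> b)" for K s b a by (auto simp: lit_def)
  have fv_lit [simp]: "fvars (lit b a) = fvars a" "qdepth (lit b a) = qdepth a" for b a by (auto simp: lit_def)
  \<comment> \<open>Nothing is required of the parameters themselves: in another graph any eight
    values will do, provided that the definitions read with them are realised, exhaust the vertices,
    and determine equality and adjacency as in \<open>G\<close>.\<close>
  define body where "body = Conj (Conj
    (big_conj (map (\<lambda>v. Exists 8 (F 8 v)) vs))
    (Conj (Forall 8 (big_disj (map (F 8) vs))) (Forall 9 (big_disj (map (F 9) vs)))))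
    (Forall 8 (Forall 9 (big_conj (map (\<lambda>u. big_conj (map (\<lambda>v. Impl (Conj (F 8 u) (F 9 v))
       (Conj (lit (u = v) (Eq 8 9)) (lit ((u, v) \<in> parcs G) (Adj 8 9)))) vs)) vs))))"
  define a where "a = foldr Exists [0..<8] body"
  have F8: "qdepth (F 8 v) \<le> d" "fvars (F 8 v) \<subseteq> insert 8 {..<8}"
    and F9: "qdepth (F 9 v) \<le> d" "fvars (F 9 v) \<subseteq> insert 9 {..<8}" if "v \<in> V" for v
    using F[of 8 v] F[of 9 v] that by simp_all
  have fv8: "x < 8 \<or> x = 8" if "v \<in> V" "x \<in> fvars (F 8 v)" for v x using F8 that by blast
  have fv9: "x < 8 \<or> x = 9" if "v \<in> V" "x \<in> fvars (F 9 v)" for v x using F9 that by blast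
  have "fvars body \<subseteq> {..<8}"
    unfolding body_def by (auto simp: vs split_beta dest: fv8 fv9)
  then have sent: "is_sentence a" unfolding a_def is_sentence_def fvars_Exists_list by auto
  have "qdepth body \<le> d + 2"
    unfolding body_def
    by (simp, intro conjI qdepth_big) (auto simp: vs le_SucI F8 F9 intro!: qdepth_big)
  \<comment> \<open>Eight quantifiers bind the parameters, two bind the variables 8 and 9.\<close>
  then have depth: "qdepth a \<le> d + 10" unfolding a_def qdepth_Exists_list by simp
  have upd: "admissible (s(x := v))" if "admissible s" "x \<ge> 8" for s x v
    using that by (auto simp: admissible_def)
  have body: "sat G s body" if s: "admissible s" for s
  proof -
    have 8: "sat G (s(8 := v)) (F 8 u) \<longleftrightarrow> v = u" "sat G (s(8 := v, 9 := w)) (F 8 u) \<longleftrightarrow> v = u"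
      if "u \<in> V" "v \<in> V" for u v w
      using F[of 8 u] upd[OF s] upd[OF upd[OF s]] that by simp_all
    have 9: "sat G (s(9 := w)) (F 9 u) \<longleftrightarrow> w = u" "sat G (s(8 := v, 9 := w)) (F 9 u) \<longleftrightarrow> w = u"
      if "u \<in> V" "w \<in> V" for u v w
      using F[of 9 u] upd[OF s] upd[OF upd[OF s]] that by simp_all
    show ?thesis unfolding body_def by (simp add: vs 8 9)
  qed
  have "sat G par a" unfolding a_def
    using body[of par] par by (subst sat_Exists_list) (auto simp: admissible_def intro!: exI[of _ par])
  then have "models G a" by (simp add: models_sentence[OF sent, of G par])
  moreover have "digraph_iso (with_proj H) (with_proj G)" if H: "pair_graph H" "models H a" for H
  proof -
    interpret H: pair_graph H by fact
    have "sat H par a" using H(2) unfolding models_def by blast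
    then obtain t where "sat H t body"
      unfolding a_def using sat_Exists_list[OF distinct_upt] by blast
    then have B: "(\<forall>v\<in>V. \<exists>z\<in>pverts H. sat H (t(8 := z)) (F 8 v)) \<and>
      (\<forall>z\<in>pverts H. \<exists>v\<in>V. sat H (t(8 := z)) (F 8 v)) \<and>
      (\<forall>z\<in>pverts H. \<exists>v\<in>V. sat H (t(9 := z)) (F 9 v)) \<and>
      (\<forall>y\<in>pverts H. \<forall>z\<in>pverts H. \<forall>u\<in>V. \<forall>v\<in>V.
        sat H (t(8 := y, 9 := z)) (F 8 u) \<and> sat H (t(8 := y, 9 := z)) (F 9 v) \<longrightarrow>
        (y = z \<longleftrightarrow> u = v) \<and> ((y, z) \<in> parcs H \<longleftrightarrow> (u, v) \<in> parcs G))"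
      unfolding body_def by (simp add: vs)
    note 1 = B[THEN conjunct1, rule_format]
      and 2 = B[THEN conjunct2, THEN conjunct1, rule_format]
      and 3 = B[THEN conjunct2, THEN conjunct2, THEN conjunct1, rule_format]
      and 4 = B[THEN conjunct2, THEN conjunct2, THEN conjunct2, rule_format, OF _ _ _ _ conjI]
    have c8: "sat H (t(8 := y, 9 := z)) (F 8 u) = sat H (t(8 := y)) (F 8 u)" if "u \<in> V" for y z u
      using F[of 8 u] that by (intro sat_cong) auto
    have c9: "sat H (t(8 := y, 9 := z)) (F 9 u) = sat H (t(9 := z)) (F 9 u)" if "u \<in> V" for y z u
      using F[of 9 u] that by (intro sat_cong) auto
    obtain f where f: "\<And>z. z \<in> pverts H \<Longrightarrow> f z \<in> V \<and> sat H (t(8 := z)) (F 8 (f z))"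
      using 2 by metis
    obtain g where g: "\<And>z. z \<in> pverts H \<Longrightarrow> g z \<in> V \<and> sat H (t(9 := z)) (F 9 (g z))"
      using 3 by metis
    have 5: "(y = z \<longleftrightarrow> u = g z) \<and> ((y, z) \<in> parcs H \<longleftrightarrow> (u, g z) \<in> parcs G)"
      if "y \<in> pverts H" "z \<in> pverts H" "u \<in> V" "sat H (t(8 := y)) (F 8 u)" for y z u
      using 4[of y z u "g z"] that f g c8 c9 by auto
    have fg: "u = g z" if "z \<in> pverts H" "u \<in> V" "sat H (t(8 := z)) (F 8 u)" for z u
      using 5[of z z u] that by auto
    have fg': "f z = g z" if "z \<in> pverts H" for z
      using fg f that by auto
    show ?thesis
    proof (rule digraph_iso_with_projI[OF H(1) _ pair_graph])
      show "bij_betw f (pverts H) V"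
        unfolding bij_betw_def
      proof safe
        show "inj_on f (pverts H)"
        proof (rule inj_onI)
          fix x y assume "x \<in> pverts H" "y \<in> pverts H" "f x = f y"
          then show "x = y" using 5[of x y "f x"] f[of x] fg'[of y] by simp
        qed
        fix z assume "z \<in> pverts H" then show "f z \<in> V" using f by auto
      next
        fix v assume "v \<in> V"
        with 1 obtain z where "z \<in> pverts H" "sat H (t(8 := z)) (F 8 v)" by blast
        then show "v \<in> f ` pverts H" using fg fg' \<open>v \<in> V\<close> by auto
      qed
      fix y z assume "y \<in> pverts H" "z \<in> pverts H"
      then show "(y, z) \<in> parcs H \<longleftrightarrow> (f y, f z) \<in> parcs G"
        using 5[of y z "f y"] f fg' by auto
    qed
  qed
  ultimately show ?thesis using sent depth unfolding fo_defines_def by blast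
qed

end

section \<open>A graph with short definitions\<close>

primrec tower :: "nat \<Rightarrow> nat" where
  "tower 0 = 1"
| "tower (Suc k) = 2 ^ tower k"

text \<open>Level 0 has two vertices because a level of width \<open>w\<close> is followed by one of
  width \<open>2 ^ w - 1\<close>: this would stay at 1 forever, but from 2 it grows like a tower.
  Two base vertices can still be named by parameters.\<close>

fun level_start :: "nat \<Rightarrow> nat" where
  "level_start 0 = 0"
| "level_start (Suc 0) = 2"
| "level_start (Suc (Suc k)) = level_start (Suc k) + (2 ^ (level_start (Suc k) - level_start k) - 1)"

definition level :: "nat \<Rightarrow> nat set" where
  "level k = {level_start k..<level_start (Suc k)}"

text \<open>
  The vertices of level \<open>k + 1\<close> correspond to the nonempty subsets of level \<open>k\<close>.
\<close>
definition parent :: "nat \<Rightarrow> nat \<Rightarrow> bool" where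
  "parent i j \<longleftrightarrow> (\<exists>k. i \<in> level k \<and> j \<in> level (Suc k) \<and>
     i - level_start k \<in> set_decode (Suc (j - level_start (Suc k))))"

definition level_graph :: "nat \<Rightarrow> nat \<Rightarrow> bool" where
  "level_graph i j \<longleftrightarrow> parent i j \<or> parent j i"

lemma level_width: "level_start k + 2 \<le> level_start (Suc k)"
proof (induction k)
  case (Suc k)
  have "(2::nat) ^ 2 \<le> 2 ^ (level_start (Suc k) - level_start k)"
    using Suc by (intro power_increasing) auto
  then show ?case by simp
qed simp

lemma level_start_less: "j < k \<Longrightarrow> level_start j < level_start k"
proof (rule lift_Suc_mono_less[of level_start])
  show "level_start n < level_start (Suc n)" for n using level_width[of n] by linarith
qed

lemma level_start_mono: "j \<le> k \<Longrightarrow> level_start j \<le> level_start k"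
  using level_start_less by (cases "j = k") (auto intro: less_imp_le)

lemma level_disjoint: "i \<in> level j \<Longrightarrow> i \<in> level k \<Longrightarrow> j = k"
proof (rule ccontr)
  assume *: "i \<in> level j" "i \<in> level k" "j \<noteq> k"
  then consider "Suc j \<le> k" | "Suc k \<le> j" by linarith
  then show False
    using * level_start_mono[of "Suc j" k] level_start_mono[of "Suc k" j] by cases (auto simp: level_def)
qed

lemma ex_level: "i < level_start (Suc n) \<Longrightarrow> \<exists>k\<le>n. i \<in> level k"
proof (induction n)
  case (Suc n)
  show ?case
  proof (cases "i < level_start (Suc n)")
    case False
    then show ?thesis using Suc.prems by (intro exI[of _ "Suc n"]) (simp add: level_def)
  qed (use Suc.IH in \<open>auto intro: le_SucI\<close>)
qed (simp add: level_def)

lemma tower_less_level_start: "tower k < level_start (Suc k)"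
proof -
  \<comment> \<open>The summand 1 pays for the missing empty set: \<open>w >= t + 1\<close> gives
    \<open>2 ^ w - 1 >= 2 * 2 ^ t - 1 >= 2 ^ t + 1\<close>, as \<open>2 ^ t >= 2\<close>.\<close>
  have "tower k + 1 \<le> level_start (Suc k) - level_start k"
  proof (induction k)
    case (Suc k)
    have "2 ^ (tower k + 1) \<le> (2::nat) ^ (level_start (Suc k) - level_start k)"
      using Suc by (intro power_increasing) auto
    moreover have "(2::nat) ^ 1 \<le> 2 ^ tower k"
      by (intro power_increasing) (cases k, auto simp: Suc_le_eq)
    ultimately show ?case by simp
  qed simp
  then show ?thesis by linarith
qed

lemma parent_level: "parent i j \<Longrightarrow> i \<in> level k \<Longrightarrow> j \<in> level (Suc k)"
  unfolding parent_def using level_disjoint by blast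

lemma level_graph_levels:
  "level_graph i j \<Longrightarrow> i \<in> level k \<Longrightarrow> j \<in> level l \<Longrightarrow> k = Suc l \<or> l = Suc k"
  unfolding level_graph_def using parent_level level_disjoint by blast

lemma level_code_subset:
  assumes "j \<in> level (Suc k)"
  shows "set_decode (Suc (j - level_start (Suc k))) \<subseteq> {..<level_start (Suc k) - level_start k}"
proof
  fix x assume "x \<in> set_decode (Suc (j - level_start (Suc k)))"
  then have "odd (Suc (j - level_start (Suc k)) div 2 ^ x)" by (simp add: set_decode_def)
  then have "2 ^ x \<le> Suc (j - level_start (Suc k))"
    using div_less[of "Suc (j - level_start (Suc k))" "2 ^ x"] by (metis even_zero not_less)
  also have "\<dots> < 2 ^ (level_start (Suc k) - level_start k)"
    using assms by (auto simp: level_def)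
  finally show "x \<in> {..<level_start (Suc k) - level_start k}"
    by (simp add: power_less_imp_less_exp)
qed

text \<open>Codes start at 1, so the coded set is nonempty. This is why the empty set is left out:
  the trace of a vertex without parents on the level below would not differ from that of a vertex in
  a remote level.\<close>

lemma ex_parent:
  assumes "j \<in> level (Suc k)" shows "\<exists>i\<in>level k. parent i j"
proof -
  have "set_decode (Suc (j - level_start (Suc k))) \<noteq> {}"
    by (metis set_decode_inverse set_encode_empty nat.distinct(1))
  then obtain x where x: "x \<in> set_decode (Suc (j - level_start (Suc k)))" by blast
  with level_code_subset[OF assms] have "level_start k + x \<in> level k"
    by (auto simp: level_def)
  with x assms show ?thesis unfolding parent_def by force
qed

lemma parent_extensional:
  assumes j: "j \<in> level (Suc k)" "j' \<in> level (Suc k)"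
    and eq: "\<And>i. i \<in> level k \<Longrightarrow> parent i j \<longleftrightarrow> parent i j'"
  shows "j = j'"
proof -
  let ?c = "\<lambda>j. Suc (j - level_start (Suc k))"
  have *: "x \<in> set_decode (?c j) \<longleftrightarrow> level_start k + x \<in> level k \<and> parent (level_start k + x) j"
    if "j \<in> level (Suc k)" for x j
  proof
    assume x: "x \<in> set_decode (?c j)"
    with level_code_subset[OF that] have "level_start k + x \<in> level k"
      by (auto simp: level_def)
    with x that show "level_start k + x \<in> level k \<and> parent (level_start k + x) j"
      unfolding parent_def by force
  next
    assume **: "level_start k + x \<in> level k \<and> parent (level_start k + x) j"
    then obtain l where "level_start k + x \<in> level l"
      "level_start k + x - level_start l \<in> set_decode (Suc (j - level_start (Suc l)))"
      unfolding parent_def by blast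
    moreover from this have "l = k" using ** level_disjoint by blast
    ultimately show "x \<in> set_decode (?c j)" by simp
  qed
  have "set_decode (?c j) = set_decode (?c j')" using *[OF j(1)] *[OF j(2)] eq by blast
  then have "?c j = ?c j'" by (metis set_decode_inverse)
  with j show ?thesis by (auto simp: level_def)
qed

section \<open>Definability from a core that carries the level graph\<close>

context graph_params
begin

text \<open>Each level costs one quantifier: \<open>v\<close> is determined within \<open>A\<close>
  by its trace on the level below, which is already definable. A nonempty trace forces an equal or
  neighbouring level, and extensionality does the rest. The case \<open>j = k\<close> is tolerated
  in \<open>lev\<close> because the prescribed graph does not control the diagonal of
  \<open>core_rel\<close>.\<close>

lemma definable_levels:
  assumes S: "definable2 e S" and A: "definable e A" "A \<subseteq> V" "A = (\<Union>k. L k)"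
    and L0: "\<And>v. v \<in> L 0 \<Longrightarrow> definable e {v}"
    and disj: "\<And>j k v. v \<in> L j \<Longrightarrow> v \<in> L k \<Longrightarrow> j = k"
    and par: "\<And>k v. v \<in> L (Suc k) \<Longrightarrow> \<exists>w\<in>L k. S v w"
    and ext: "\<And>k v v'. v \<in> L (Suc k) \<Longrightarrow> v' \<in> L (Suc k) \<Longrightarrow> (\<And>w. w \<in> L k \<Longrightarrow> S v w \<longleftrightarrow> S v' w) \<Longrightarrow> v = v'"
    and lev: "\<And>j k v w. v \<in> L j \<Longrightarrow> w \<in> L k \<Longrightarrow> S v w \<Longrightarrow> j = k \<or> j = Suc k \<or> k = Suc j"
  shows "v \<in> L k \<Longrightarrow> definable (e + k) {v}"
proof (induction k arbitrary: v rule: less_induct)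
  case (less k)
  show ?case
  proof (cases k)
    case 0
    then show ?thesis using L0 less.prems by simp
  next
    case (Suc l)
    have def: "definable (e + l) {w}" if "w \<in> L j" "j \<le> l" for w j
      using less.IH[of j w] that Suc by (auto intro: definable_mono)
    have sub: "L j \<subseteq> V" for j using A by auto
    have defL: "definable (e + l) (L j)" if "j \<le> l" for j
      by (rule definable_finite[OF sub]) (use def that in blast)
    define T where "T = {w \<in> L l. S v w}"
    \<comment> \<open>Vertices of level \<open>l - 1\<close> may have the same neighbours in level \<open>l\<close> as \<open>v\<close>.\<close>
    define M where "M = {x. \<forall>w\<in>L l. S x w \<longleftrightarrow> w \<in> T} \<inter> A - (\<Union>j\<in>{l - 1..l}. L j)"
    have "definable (Suc (e + l)) {x. \<forall>w\<in>L l. S x w \<longleftrightarrow> w \<in> T}"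
      by (rule definable_trace[OF sub]) (auto intro: def definable2_mono[OF S])
    then have "definable (e + k) M"
      unfolding M_def Suc
      by (intro definable_Diff definable_Int definable_UN)
        (auto intro: definable_mono[OF A(1)] definable_mono[OF defL])
    moreover have "M = {v}"
    proof (intro equalityI subsetI)
      fix x assume x: "x \<in> M"
      then obtain j where j: "x \<in> L j" unfolding M_def A(3) by blast
      obtain w where w: "w \<in> L l" "S v w" using par less.prems Suc by blast
      then have "S x w" using x unfolding M_def T_def by blast
      from lev[OF j w(1) this] x j have "j = Suc l"
        unfolding M_def by (cases l) auto
      with j x less.prems Suc show "x \<in> {v}"
        unfolding M_def T_def using ext[of x l v] by auto
    next
      fix x assume x: "x \<in> {v}"
      have "v \<notin> L j" if "j \<in> {l - 1..l}" for j
        using disj[of v j k] that less.prems Suc by auto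
      then show "x \<in> M" using x less.prems unfolding M_def T_def A(3) by blast
    qed
    ultimately show ?thesis by simp
  qed
qed

definition core :: "nat set" where
  "core = {v \<in> V. \<forall>i<4. (v, par i) \<in> parcs G}"

definition core_nbrs :: "nat \<Rightarrow> nat set" where
  "core_nbrs w = {a \<in> core. (w, a) \<in> parcs G}"

text \<open>The witness must see nothing of the core besides \<open>a\<close> and \<open>b\<close>.
  A vertex then serves one pair only, so once the traces on the core are known, the relations of
  different pairs depend on disjoint sets of edges.\<close>

definition core_rel :: "nat \<Rightarrow> nat \<Rightarrow> bool" where
  "core_rel a b \<longleftrightarrow> (\<exists>w\<in>V - core. (w, par 4) \<in> parcs G \<and> (w, par 5) \<in> parcs G \<and> core_nbrs w = {a, b})"

definition core_type :: "nat \<Rightarrow> nat set set" where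
  "core_type v = {T. T \<subseteq> core \<and> card T = 3 \<and> (\<exists>w\<in>V - core. core_nbrs w = T \<and> (v, w) \<in> parcs G)}"

definition fo_core :: "nat \<Rightarrow> fo" where
  "fo_core x = Conj (Conj (Adj x 0) (Adj x 1)) (Conj (Adj x 2) (Adj x 3))"

lemma fo_core: "qdepth (fo_core x) = 0" "fvars (fo_core x) = {x, 0, 1, 2, 3}"
  by (auto simp: fo_core_def)

lemma sat_fo_core: "admissible s \<Longrightarrow> s x \<in> V \<Longrightarrow> sat G s (fo_core x) \<longleftrightarrow> s x \<in> core"
  by (auto simp: fo_core_def core_def admissible_def eval_nat_numeral All_less_Suc)

lemma definable_core: "definable d core"
  unfolding definable_def
proof (intro allI impI)
  fix x :: nat assume "8 \<le> x"
  then show "\<exists>a. qdepth a \<le> d \<and> fvars a \<subseteq> insert x {..<8} \<and>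
     (\<forall>s. admissible s \<and> s x \<in> V \<longrightarrow> (sat G s a \<longleftrightarrow> s x \<in> core))"
    by (intro exI[of _ "fo_core x"]) (auto simp: fo_core sat_fo_core)
qed

text \<open>Membership in the core is quantifier-free. One quantifier is for the witness, the other
  says that the witness has no third core neighbour.\<close>

lemma definable2_core_rel: "definable2 2 core_rel"
  unfolding definable2_def
proof (intro allI impI)
  fix x y :: nat assume xy: "8 \<le> x" "8 \<le> y" "x \<noteq> y"
  define w z where "w = Suc (x + y)" and "z = Suc w"
  have neq: "w \<noteq> x" "w \<noteq> y" "z \<noteq> x" "z \<noteq> y" "z \<noteq> w" "w \<ge> 8" "z \<ge> 8"
    using xy by (auto simp: w_def z_def)
  define a where "a = Exists w (Conj (Conj (Conj (Neg (fo_core w)) (Conj (Adj w 4) (Adj w 5)))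
    (Conj (Conj (fo_core x) (fo_core y)) (Conj (Adj w x) (Adj w y))))
    (Forall z (Impl (Conj (fo_core z) (Adj w z)) (Disj (Eq z x) (Eq z y)))))"
  have "sat G s a \<longleftrightarrow> core_rel (s x) (s y)"
    if s: "admissible s" "s x \<in> V" "s y \<in> V" for s
  proof -
    have s': "admissible (s(w := v))" "admissible (s(w := v, z := u))" for u v
      using s neq by (auto simp: admissible_def)
    have p: "s 4 = par 4" "s 5 = par 5" using s by (auto simp: admissible_def)
    have 1: "sat G (s(w := v)) (fo_core w) \<longleftrightarrow> v \<in> core" if "v \<in> V" for v
      using sat_fo_core[OF s'(1)[of v], of w] that by simp
    have 2: "sat G (s(w := v)) (fo_core x) \<longleftrightarrow> s x \<in> core" for v
      using sat_fo_core[OF s'(1)[of v], of x] s neq by simp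
    have 3: "sat G (s(w := v)) (fo_core y) \<longleftrightarrow> s y \<in> core" for v
      using sat_fo_core[OF s'(1)[of v], of y] s neq by simp
    have 4: "sat G (s(w := v, z := u)) (fo_core z) \<longleftrightarrow> u \<in> core" if "u \<in> V" for v u
      using sat_fo_core[OF s'(2)[of v u], of z] that by simp
    have "sat G s a \<longleftrightarrow> (\<exists>v\<in>V. v \<notin> core \<and> (v, par 4) \<in> parcs G \<and> (v, par 5) \<in> parcs G \<and>
       s x \<in> core \<and> s y \<in> core \<and> (v, s x) \<in> parcs G \<and> (v, s y) \<in> parcs G \<and>
       (\<forall>u\<in>V. u \<in> core \<and> (v, u) \<in> parcs G \<longrightarrow> u = s x \<or> u = s y))"
      unfolding a_def using neq xy
      by (simp add: p fun_upd_def [symmetric] cong: conj_cong) (auto simp: 1 2 3 4)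
    also have "\<dots> \<longleftrightarrow> core_rel (s x) (s y)"
    proof -
      have "core_nbrs v = {s x, s y} \<longleftrightarrow> s x \<in> core \<and> s y \<in> core \<and> (v, s x) \<in> parcs G \<and>
        (v, s y) \<in> parcs G \<and> (\<forall>u\<in>V. u \<in> core \<and> (v, u) \<in> parcs G \<longrightarrow> u = s x \<or> u = s y)" for v
        unfolding core_nbrs_def by (auto simp: core_def)
      then show ?thesis unfolding core_rel_def by (auto simp: Bex_def)
    qed
    finally show ?thesis .
  qed
  moreover have "fvars a \<subseteq> {x, y} \<union> {..<8}" by (auto simp: a_def fo_core)
  moreover have "qdepth a \<le> 2" by (simp add: a_def fo_core)
  ultimately show "\<exists>a. qdepth a \<le> 2 \<and> fvars a \<subseteq> {x, y} \<union> {..<8} \<and>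
     (\<forall>s. admissible s \<and> s x \<in> V \<and> s y \<in> V \<longrightarrow> (sat G s a \<longleftrightarrow> core_rel (s x) (s y)))"
    by blast
qed

lemma core_sub: "core \<subseteq> V" by (auto simp: core_def)

text \<open>The depth is 2 for \<open>core_rel\<close> plus one for each level above level 0, whose
  two elements are the parameters 6 and 7.\<close>

lemma definable_core_elements:
  assumes bij: "bij_betw \<iota> {..<s} core" and s: "2 \<le> s" "s \<le> level_start (Suc K)"
    and par67: "par 6 = \<iota> 0" "par 7 = \<iota> 1"
    and rel: "\<And>i j. i < s \<Longrightarrow> j < s \<Longrightarrow> i \<noteq> j \<Longrightarrow> core_rel (\<iota> i) (\<iota> j) \<longleftrightarrow> level_graph i j"
    and v: "v \<in> core"
  shows "definable (K + 2) {v}"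
proof -
  define L where "L k = \<iota> ` (level k \<inter> {..<s})" for k
  have inj: "\<iota> i = \<iota> j \<longleftrightarrow> i = j" if "i < s" "j < s" for i j
    using bij that by (auto simp: bij_betw_def dest: inj_onD)
  have core: "core = \<iota> ` {..<s}" using bij by (auto simp: bij_betw_def)
  have lev: "\<exists>k\<le>K. i \<in> level k" if "i < s" for i using ex_level[of i K] that s by simp
  \<comment> \<open>The bound \<open>s\<close> may cut the last level short, but a level with a
    vertex present in the next one is complete.\<close>
  have low: "i < s" if "i \<in> level k" "j \<in> level (Suc k)" "j < s" for i j k
    using that by (auto simp: level_def)
  have rel': "core_rel (\<iota> j) (\<iota> i) \<longleftrightarrow> parent i j"
    if "i \<in> level k" "j \<in> level (Suc k)" "j < s" for i j k
  proof -
    have "i \<noteq> j" using that(1,2) level_disjoint[of i k "Suc k"] by auto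
    moreover have "\<not> parent j i" using parent_level[of j i "Suc k"] level_disjoint[of i k "Suc (Suc k)"] that by auto
    ultimately show ?thesis using rel[of j i] low[OF that] that by (auto simp: level_graph_def)
  qed
  have def: "definable (2 + k) {u}" if "u \<in> L k" for u k
  proof (rule definable_levels[where A = core and L = L and S = core_rel])
    show "definable2 2 core_rel" by (rule definable2_core_rel)
    show "definable 2 core" by (rule definable_core)
    show "core \<subseteq> V" by (rule core_sub)
    show "core = (\<Union>k. L k)" unfolding L_def core using lev by blast
    show "u \<in> L k" by fact
  next
    fix v assume "v \<in> L 0"
    then obtain i where i: "v = \<iota> i" "i < 2" by (auto simp: L_def level_def)
    then have "i = 0 \<or> i = 1" by auto
    then have "v = par 6 \<or> v = par 7" using par67 i by auto
    then show "definable 2 {v}" using definable_par[of 6] definable_par[of 7] by auto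
  next
    fix j k v assume "v \<in> L j" "v \<in> L k"
    then show "j = k" unfolding L_def using inj level_disjoint by blast
  next
    fix k v assume "v \<in> L (Suc k)"
    then obtain j where j: "v = \<iota> j" "j \<in> level (Suc k)" "j < s" by (auto simp: L_def)
    then obtain i where "i \<in> level k" "parent i j" using ex_parent by blast
    with j show "\<exists>w\<in>L k. core_rel v w" using rel' low by (force simp: L_def)
  next
    fix k v v' assume v: "v \<in> L (Suc k)" "v' \<in> L (Suc k)"
      and eq: "\<And>w. w \<in> L k \<Longrightarrow> core_rel v w \<longleftrightarrow> core_rel v' w"
    obtain j j' where j: "v = \<iota> j" "j \<in> level (Suc k)" "j < s"
      "v' = \<iota> j'" "j' \<in> level (Suc k)" "j' < s" using v by (auto simp: L_def)
    have "parent i j \<longleftrightarrow> parent i j'" if "i \<in> level k" for i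
      using rel'[OF that j(2,3)] rel'[OF that j(5,6)] eq[of "\<iota> i"] low[OF that j(2,3)] that j
      by (auto simp: L_def)
    then have "j = j'" using parent_extensional j by blast
    then show "v = v'" using j by simp
  next
    fix j k v w assume "v \<in> L j" "w \<in> L k" "core_rel v w"
    then obtain a b where ab: "a \<in> level j" "a < s" "b \<in> level k" "b < s" "v = \<iota> a" "w = \<iota> b"
      by (auto simp: L_def)
    show "j = k \<or> j = Suc k \<or> k = Suc j"
    proof (cases "a = b")
      case True
      then show ?thesis using ab level_disjoint by blast
    next
      case False
      then have "level_graph a b" using rel ab \<open>core_rel v w\<close> by blast
      then show ?thesis using level_graph_levels ab by blast
    qed
  qed
  obtain i where "v = \<iota> i" "i < s" using v core by auto
  moreover from this lev obtain k where "k \<le> K" "i \<in> level k" by blast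
  ultimately have "k \<le> K" "v \<in> L k" by (auto simp: L_def)
  then show ?thesis using def[of v k] by (auto intro: definable_mono)
qed

lemma core_type_iff:
  "T \<in> core_type v \<longleftrightarrow> T \<subseteq> core \<and> card T = 3 \<and> (\<exists>w\<in>V. w \<in> {w. \<forall>a\<in>core. (w, a) \<in> parcs G \<longleftrightarrow> a \<in> T} - core \<and> (v, w) \<in> parcs G)"
  unfolding core_type_def core_nbrs_def by blast

text \<open>The depths add up: the vertices with a given trace on the core cost one quantifier,
  their neighbours a second, the trace of an element of \<open>P\<close> on \<open>V - P\<close> a
  third, and the enclosing sentence ten. In \<open>sep\<close> the vertex \<open>v'\<close> may lie
  in \<open>P\<close>, so elements of \<open>V - P\<close> are also told from those of
  \<open>P\<close>. Then \<open>P\<close> is definable as a complement, and its elements need only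
  be told apart from each other.\<close>

lemma fo_defines_of_core:
  assumes core: "\<And>v. v \<in> core \<Longrightarrow> definable d {v}"
    and sep: "\<And>v v'. v \<in> V - P - core \<Longrightarrow> v' \<in> V - core \<Longrightarrow> core_type v = core_type v' \<Longrightarrow> v = v'"
    and P: "P \<subseteq> V"
    and sepP: "\<And>v v'. v \<in> P \<Longrightarrow> v' \<in> P \<Longrightarrow>
      (\<And>w. w \<in> V - P \<Longrightarrow> (v, w) \<in> parcs G \<longleftrightarrow> (v', w) \<in> parcs G) \<Longrightarrow> v = v'"
  shows "\<exists>a. fo_defines a G \<and> qdepth a \<le> d + 13"
proof -
  have fin: "finite core" using core_sub pair_finite_verts finite_subset by blast
  define I where "I = {T. T \<subseteq> core \<and> card T = 3}"
  have "finite I" unfolding I_def using fin by simp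
  define W where "W T = {w. \<forall>a\<in>core. (w, a) \<in> parcs G \<longleftrightarrow> a \<in> T} - core" for T
  define Hit where "Hit T = {v. \<exists>w\<in>V. w \<in> W T \<and> (v, w) \<in> parcs G}" for T
  have "definable (Suc d) (W T)" for T
    unfolding W_def
    by (rule definable_Diff[OF definable_trace[OF core_sub core definable2_adj] definable_core])
  then have hit: "definable (Suc (Suc d)) (Hit T)" for T
    unfolding Hit_def by (rule definable_image[OF _ definable2_adj])
  have Q: "definable (Suc (Suc d)) {v}" if v: "v \<in> V - P" for v
  proof (cases "v \<in> core")
    case True
    then show ?thesis by (auto intro: definable_mono core)
  next
    case False
    \<comment> \<open>Fixing the truth value of every \<open>Hit T\<close> is a finite Boolean
      combination and costs no further quantifier.\<close>
    define M where "M = V - core - (\<Union>T\<in>I \<inter> core_type v. V - Hit T) - (\<Union>T\<in>I - core_type v. Hit T)"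
    have V: "definable (Suc (Suc d)) V"
      by (rule definable_cong[OF definable_compl[OF definable_empty]]) auto
    have "definable (Suc (Suc d)) M"
      unfolding M_def using \<open>finite I\<close>
      by (intro definable_Diff definable_UN definable_compl definable_core hit V) auto
    moreover have "M = {v}"
    proof -
      have *: "x \<in> M \<longleftrightarrow> x \<in> V - core \<and> core_type x = core_type v" if "x \<in> V" for x
      proof -
        have sub: "core_type u \<subseteq> I" for u unfolding core_type_def I_def by blast
        have hit: "u \<in> Hit T \<longleftrightarrow> T \<in> core_type u" if "T \<in> I" for T u
          using that unfolding core_type_iff I_def Hit_def W_def by simp
        have "x \<in> M \<longleftrightarrow> x \<in> V - core \<and> (\<forall>T\<in>I. x \<in> Hit T \<longleftrightarrow> T \<in> core_type v)"
          unfolding M_def using that by auto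
        also have "(\<forall>T\<in>I. x \<in> Hit T \<longleftrightarrow> T \<in> core_type v) \<longleftrightarrow> core_type x = core_type v"
          using sub[of x] sub[of v] by (auto simp: hit)
        finally show ?thesis .
      qed
      moreover have "M \<subseteq> V" unfolding M_def by blast
      ultimately show ?thesis using sep[of v] v False by blast
    qed
    ultimately show ?thesis by simp
  qed
  have "definable (Suc (Suc d)) (V - P)" by (rule definable_finite) (use Q in auto)
  then have Pd: "definable (Suc (Suc d)) P"
    by (rule definable_cong[OF definable_compl]) (use P in auto)
  have R: "definable (d + 3) {v}" if v: "v \<in> P" for v
  proof -
    have "definable (Suc (Suc (Suc d))) {x. \<forall>w\<in>V - P. (x, w) \<in> parcs G \<longleftrightarrow> w \<in> {w. (v, w) \<in> parcs G}}"
      by (intro definable_trace definable2_adj Q) auto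
    then have "definable (d + 3) ({x. \<forall>w\<in>V - P. (x, w) \<in> parcs G \<longleftrightarrow> w \<in> {w. (v, w) \<in> parcs G}} \<inter> P)"
      by (intro definable_Int definable_mono[OF Pd]) (simp_all add: eval_nat_numeral)
    moreover have "{x. \<forall>w\<in>V - P. (x, w) \<in> parcs G \<longleftrightarrow> w \<in> {w. (v, w) \<in> parcs G}} \<inter> P = {v}"
      using sepP v by blast
    ultimately show ?thesis by simp
  qed
  have "definable (d + 3) {v}" if "v \<in> V" for v
    using that definable_mono[OF Q[of v]] R by (cases "v \<in> P") auto
  from fo_defines_of_definable[OF this] show ?thesis by (simp add: add.assoc)
qed

end

section \<open>The lower bound\<close>

lemma log_iterate_mono:
  fixes x y :: real
  assumes "tower k \<le> x" "x \<le> y"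
  shows "1 \<le> (log 2 ^^ k) x \<and> (log 2 ^^ k) x \<le> (log 2 ^^ k) y"
  using assms
proof (induction k arbitrary: x y)
  case (Suc k)
  have pos: "0 < x" using Suc.prems(1) by (auto intro: less_le_trans[of 0 "2 ^ tower k"])
  have "real (tower k) = log 2 (tower (Suc k))" by simp
  also have "\<dots> \<le> log 2 x" using Suc.prems(1) pos by (subst log_le_cancel_iff) auto
  finally have "tower k \<le> log 2 x" .
  moreover have "log 2 x \<le> log 2 y" using Suc.prems pos by simp
  ultimately show ?case using Suc.IH unfolding funpow_Suc_right by simp
qed simp

lemma less_tower: "n < tower n"
proof (induction n)
  case (Suc n)
  have "Suc n \<le> tower n" using Suc by simp
  also have "tower n < 2 ^ tower n" by simp
  finally show ?case by simp
qed simp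

lemma tower_mono: "j \<le> k \<Longrightarrow> tower j \<le> tower k"
proof (rule lift_Suc_mono_le[of tower])
  show "tower n \<le> tower (Suc n)" for n
    using less_exp[of "tower n"] by (simp only: tower.simps less_imp_le)
qed

text \<open>Iterates after the first value below 1 may take logarithms of nonpositive numbers, so
  nothing is claimed about the \<open>k\<close>-th one itself.\<close>

lemma log_iterate_less_1: "(x::real) < tower k \<Longrightarrow> \<exists>i\<le>k. (log 2 ^^ i) x < 1"
proof (induction k arbitrary: x)
  case (Suc k)
  show ?case
  proof (cases "x < 1")
    case False
    have "log 2 x < log 2 (tower (Suc k))" using Suc.prems False by (subst log_less_cancel_iff) auto
    then have "log 2 x < tower k" by simp
    from Suc.IH[OF this] obtain i where "i \<le> k" "(log 2 ^^ i) (log 2 x) < 1" by (elim exE conjE)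
    then have "Suc i \<le> Suc k \<and> (log 2 ^^ Suc i) x < 1" unfolding funpow_Suc_right by simp
    then show ?thesis by blast
  qed (auto intro: exI[of _ 0])
qed (auto intro: exI[of _ 0])

text \<open>With the next lemma and monotonicity, \<open>tower k <= n\<close> holds exactly for
  \<open>k < log_star n\<close>. The real iteration is thus replaced by a function on natural
  numbers.\<close>

lemma less_tower_log_star: "real n < tower (log_star (real n))"
proof (rule ccontr)
  assume "\<not> ?thesis"
  then have "1 \<le> (log 2 ^^ log_star (real n)) (real n)"
    using log_iterate_mono[of "log_star (real n)" "real n" "real n"] by simp
  moreover have "\<exists>i. (log 2 ^^ i) (real n) < 1"
    using log_iterate_less_1[of "real n" n] less_tower[of n] by auto
  then have "(log 2 ^^ log_star (real n)) (real n) < 1"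
    unfolding log_star_def by (rule LeastI_ex)
  ultimately show False by simp
qed

lemma tower_le_of_less_log_star:
  assumes "k < log_star (real n)" shows "tower k \<le> n"
proof (rule ccontr)
  assume "\<not> tower k \<le> n"
  then obtain i where "i \<le> k" "(log 2 ^^ i) (real n) < 1" using log_iterate_less_1[of "real n" k] by auto
  then have "log_star (real n) \<le> k" unfolding log_star_def by (meson Least_le le_trans)
  then show False using assms by simp
qed

text \<open>
  Coding Ehrenfeucht-Fraisse types by natural numbers turns a bound on the codes into a bound on the
  number of types of a given rank.
\<close>
primrec ef_type :: "nat \<Rightarrow> nat pair_pre_digraph \<Rightarrow> nat list \<Rightarrow> nat" where
  "ef_type 0 G vs = set_encode
     ({i * length vs + j | i j. i < length vs \<and> j < length vs \<and> vs ! i = vs ! j} \<union>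
      {length vs * length vs + (i * length vs + j) | i j. i < length vs \<and> j < length vs \<and> (vs ! i, vs ! j) \<in> parcs G})"
| "ef_type (Suc k) G vs = set_encode ((\<lambda>v. ef_type k G (vs @ [v])) ` pverts G)"

text \<open>At rank 0 a tuple of length \<open>r\<close> has \<open>r * r\<close> bits for equality
  and as many for adjacency.\<close>

primrec ef_bound :: "nat \<Rightarrow> nat \<Rightarrow> nat" where
  "ef_bound 0 r = 2 ^ (2 * (r * r))"
| "ef_bound (Suc k) r = 2 ^ ef_bound k (Suc r)"

lemma pair_code_less: "i < r \<Longrightarrow> j < r \<Longrightarrow> i * r + j < r * (r::nat)"
  by (metis add.commute add_less_cancel_left less_le_trans mult_Suc mult_le_mono1 Suc_leI)

lemma pair_code_inj:
  assumes "i * r + j = i' * r + j'" "j < r" "j' < (r::nat)" shows "i = i' \<and> j = j'"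
  using assms by (metis add.commute div_mult_self3 mod_mult_self3 div_less mod_less add_0_right not_less0 add.right_neutral add_cancel_right_left)

lemma set_encode_less:
  assumes "A \<subseteq> {..<n}" shows "set_encode A < 2 ^ n"
proof -
  have "set_encode A \<le> set_encode {..<n}"
    unfolding set_encode_def using assms by (intro sum_mono2) auto
  also have "\<dots> < 2 ^ n"
    unfolding set_encode_def lessThan_atLeast0 by (simp add: sum_power2)
  finally show ?thesis .
qed

lemma ef_type_less: "ef_type k G vs < ef_bound k (length vs)"
proof (induction k arbitrary: vs)
  case 0
  have "i * length vs + j < 2 * (length vs * length vs)"
    "length vs * length vs + (i * length vs + j) < 2 * (length vs * length vs)"
    if "i < length vs" "j < length vs" for i j
    using pair_code_less[OF that] by auto
  then show ?case unfolding ef_type.simps ef_bound.simps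
    by (intro set_encode_less) auto
next
  case (Suc k)
  show ?case unfolding ef_type.simps ef_bound.simps
    by (rule set_encode_less) (use Suc.IH[of "vs @ [_]"] in auto)
qed

lemma ef_type_0D:
  assumes eq: "ef_type 0 G vs = ef_type 0 H ws" and len: "length vs = r" "length ws = r"
    and ij: "i < r" "j < r"
  shows "(vs ! i = vs ! j \<longleftrightarrow> ws ! i = ws ! j) \<and> ((vs ! i, vs ! j) \<in> parcs G \<longleftrightarrow> (ws ! i, ws ! j) \<in> parcs H)"
proof -
  define X where "X K us = {i * r + j | i j. i < r \<and> j < r \<and> us ! i = us ! j} \<union>
      {r * r + (i * r + j) | i j. i < r \<and> j < r \<and> (us ! i, us ! j) \<in> parcs K}"
    for K :: "nat pair_pre_digraph" and us :: "nat list"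
  have fin: "finite (X K us)" for K us
  proof (rule finite_subset)
    show "X K us \<subseteq> {..<2 * (r * r)}"
      unfolding X_def using pair_code_less[of _ r] by fastforce
  qed simp
  have "X G vs = X H ws"
    using eq set_encode_eq[OF fin fin] unfolding ef_type.simps len X_def by blast
  moreover have "i * r + j \<in> X K us \<longleftrightarrow> us ! i = us ! j" for K us
    using pair_code_less[OF ij] ij pair_code_inj[of i r j] by (auto simp: X_def)
  moreover have "r * r + (i * r + j) \<in> X K us \<longleftrightarrow> (us ! i, us ! j) \<in> parcs K" for K us
  proof
    assume "r * r + (i * r + j) \<in> X K us"
    moreover have "r * r + (i * r + j) \<noteq> i' * r + j'" if "i' < r" "j' < r" for i' j'
      using pair_code_less[OF that] by linarith
    ultimately obtain i' j' where "i' < r" "j' < r" "(us ! i', us ! j') \<in> parcs K" "i * r + j = i' * r + j'"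
      by (auto simp: X_def)
    then show "(us ! i, us ! j) \<in> parcs K" using pair_code_inj[of i r j i' j'] ij by auto
  qed (use ij in \<open>auto simp: X_def\<close>)
  ultimately show ?thesis by blast
qed

lemma ef_type_extend:
  assumes "ef_type (Suc k) G vs = ef_type (Suc k) H ws" "finite (pverts G)" "finite (pverts H)" "v \<in> pverts G"
  obtains w where "w \<in> pverts H" "ef_type k G (vs @ [v]) = ef_type k H (ws @ [w])"
proof -
  have "(\<lambda>v. ef_type k G (vs @ [v])) ` pverts G = (\<lambda>v. ef_type k H (ws @ [v])) ` pverts H"
    using assms(1-3) set_encode_eq by simp
  then show ?thesis using that assms(4) by (metis (mono_tags, lifting) image_iff)
qed

text \<open>Only rank 0 records atomic facts. A type of higher rank reaches them by extending the
  tuple with a repeated entry: the rank drops, while the first \<open>r\<close> positions stay in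
  place.\<close>

lemma ef_type_atomic:
  assumes "finite (pverts G)" "finite (pverts H)"
  shows "ef_type k G vs = ef_type k H ws \<Longrightarrow> length vs = r \<Longrightarrow> length ws = r \<Longrightarrow> set vs \<subseteq> pverts G \<Longrightarrow>
    set ws \<subseteq> pverts H \<Longrightarrow> i < r \<Longrightarrow> j < r \<Longrightarrow>
    (vs ! i = vs ! j \<longleftrightarrow> ws ! i = ws ! j) \<and> ((vs ! i, vs ! j) \<in> parcs G \<longleftrightarrow> (ws ! i, ws ! j) \<in> parcs H)"
proof (induction k arbitrary: vs ws r)
  case 0
  then show ?case by (intro ef_type_0D) auto
next
  case (Suc k)
  have v: "vs ! i \<in> pverts G" using Suc.prems by auto
  obtain w where w: "w \<in> pverts H" "ef_type k G (vs @ [vs ! i]) = ef_type k H (ws @ [w])"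
    by (rule ef_type_extend[OF Suc.prems(1) assms v])
  show ?case using Suc.IH[OF w(2), of "Suc r"] Suc.prems v w(1) by (auto simp: nth_append)
qed

text \<open>Tuples only grow, whereas a quantifier may rebind a variable that is in use. The map
  \<open>\<pi>\<close> sends each variable to its current position, and rebinding redirects it to
  the new last entry.\<close>

lemma sat_of_ef_type:
  assumes fin: "finite (pverts G)" "finite (pverts H)"
  shows "ef_type k G vs = ef_type k H ws \<Longrightarrow> length vs = r \<Longrightarrow> length ws = r \<Longrightarrow> set vs \<subseteq> pverts G \<Longrightarrow>
    set ws \<subseteq> pverts H \<Longrightarrow> qdepth a \<le> k \<Longrightarrow>
    (\<And>x. x \<in> fvars a \<Longrightarrow> \<pi> x < r \<and> s x = vs ! \<pi> x \<and> t x = ws ! \<pi> x) \<Longrightarrow> sat G s a \<longleftrightarrow> sat H t a"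
proof (induction a arbitrary: k vs ws r \<pi> s t)
  case (Eq x y)
  show ?case using ef_type_atomic[OF fin Eq.prems(1-5), of "\<pi> x" "\<pi> y"] Eq.prems(7) by simp
next
  case (Adj x y)
  show ?case using ef_type_atomic[OF fin Adj.prems(1-5), of "\<pi> x" "\<pi> y"] Adj.prems(7) by simp
next
  case (Neg a)
  show ?case using Neg.IH[OF Neg.prems(1-5), of \<pi> s t] Neg.prems(6,7) by simp
next
  case (Conj a b)
  show ?case using Conj.IH(1)[OF Conj.prems(1-5), of \<pi> s t] Conj.IH(2)[OF Conj.prems(1-5), of \<pi> s t] Conj.prems(6,7) by simp
next
  case (Disj a b)
  show ?case using Disj.IH(1)[OF Disj.prems(1-5), of \<pi> s t] Disj.IH(2)[OF Disj.prems(1-5), of \<pi> s t] Disj.prems(6,7) by simp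
next
  case (Impl a b)
  show ?case using Impl.IH(1)[OF Impl.prems(1-5), of \<pi> s t] Impl.IH(2)[OF Impl.prems(1-5), of \<pi> s t] Impl.prems(6,7) by simp
next
  case (Forall x a)
  obtain l where l: "k = Suc l" using Forall.prems(6) by (cases k) auto
  have *: "sat G (s(x := v)) a \<longleftrightarrow> sat H (t(x := w)) a"
    if "v \<in> pverts G" "w \<in> pverts H" "ef_type l G (vs @ [v]) = ef_type l H (ws @ [w])" for v w
    by (rule Forall.IH[OF that(3), of "Suc r" "\<pi>(x := r)"])
      (use that Forall.prems l in \<open>auto simp: nth_append less_SucI\<close>)
  show ?case
    using ef_type_extend[OF Forall.prems(1)[unfolded l] fin] *
      ef_type_extend[OF Forall.prems(1)[unfolded l, symmetric] fin(2,1)]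
    unfolding sat.simps by metis
next
  case (Exists x a)
  obtain l where l: "k = Suc l" using Exists.prems(6) by (cases k) auto
  have *: "sat G (s(x := v)) a \<longleftrightarrow> sat H (t(x := w)) a"
    if "v \<in> pverts G" "w \<in> pverts H" "ef_type l G (vs @ [v]) = ef_type l H (ws @ [w])" for v w
    by (rule Exists.IH[OF that(3), of "Suc r" "\<pi>(x := r)"])
      (use that Exists.prems l in \<open>auto simp: nth_append less_SucI\<close>)
  show ?case
    using ef_type_extend[OF Exists.prems(1)[unfolded l] fin] *
      ef_type_extend[OF Exists.prems(1)[unfolded l, symmetric] fin(2,1)]
    unfolding sat.simps by metis
qed

lemma models_of_ef_type:
  assumes "pair_graph G" "pair_graph H" "ef_type k G [] = ef_type k H []" "is_sentence a" "qdepth a \<le> k"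
  shows "models G a \<longleftrightarrow> models H a"
proof -
  have "finite (pverts G)" "finite (pverts H)"
    using assms(1,2) by (auto simp: pair_graph_def pair_digraph_def pair_fin_digraph.pair_finite_verts)
  then have "sat G s a \<longleftrightarrow> sat H s a" for s
    using sat_of_ef_type[of G H k "[]" "[]" 0 a id s s] assms(3-5) by (simp add: is_sentence_def)
  then show ?thesis unfolding models_def by blast
qed

text \<open>One rank costs two levels of the tower: one for passing to sets of types, one for the
  longer tuple.\<close>

lemma ef_bound_le_tower: "ef_bound k r \<le> tower (2 * k + r + 3)"
proof (induction k arbitrary: r)
  case 0
  have "r < 2 ^ r" by (rule less_exp)
  then have "2 * (r * r) \<le> 2 * (2 ^ r * 2 ^ r)" by (intro mult_le_mono) auto
  also have "\<dots> = 2 ^ (2 * r + 1)" by (simp add: mult_2 power_add)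
  also have "2 * r + 1 \<le> 2 ^ Suc r" using \<open>r < 2 ^ r\<close> unfolding power_Suc by linarith
  then have "(2::nat) ^ (2 * r + 1) \<le> 2 ^ (2 ^ Suc r)" by (rule power_increasing) simp
  also have "\<dots> \<le> 2 ^ (2 ^ tower r)"
    using less_tower[of r] by (intro power_increasing) auto
  finally have "2 * (r * r) \<le> 2 ^ (2 ^ tower r)" .
  then show ?case unfolding ef_bound.simps
    by (simp add: eval_nat_numeral del: power_Suc)
next
  case (Suc k)
  have "ef_bound (Suc k) r \<le> 2 ^ tower (2 * k + Suc r + 3)"
    using Suc[of "Suc r"] unfolding ef_bound.simps by (rule power_increasing) simp
  then show ?case by (simp add: eval_nat_numeral)
qed

section \<open>Counting the labelled graphs defined at small depth\<close>

lemma finite_vertex_pairs: "finite (vertex_pairs n)"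
  by (rule finite_subset[of _ "Pow {1..n}"]) (auto simp: vertex_pairs_def)

lemma card_vertex_pairs: "card (vertex_pairs n) = n choose 2"
  using n_subsets[of "{1..n}" 2] by (simp add: vertex_pairs_def)

text \<open>Two graphs of equal type, one of which is defined at depth at most \<open>k\<close>, are
  isomorphic. So an edge function in \<open>D\<close> is recovered from its type and an isomorphism
  to the representative of that type, of which there are at most \<open>n ^ n\<close>; and no single
  edge function is likelier than the empty one.\<close>

lemma prob_fo_defines_le:
  assumes p: "0 \<le> p" "p \<le> 1 / 2"
  shows "measure_pmf.prob (random_graph n p) {G. \<exists>a. fo_defines a G \<and> qdepth a \<le> k}
    \<le> ef_bound k 0 * real n ^ n * (1 - p) ^ (n choose 2)"
proof -
  \<comment> \<open>Values outside the vertex pairs are fixed at the default \<open>False\<close>,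
    so that an edge function is recovered from its graph.\<close>
  define D where "D = {f. (\<forall>e. e \<notin> vertex_pairs n \<longrightarrow> \<not> f e) \<and>
    (\<exists>a. fo_defines a (graph_of_edges n f) \<and> qdepth a \<le> k)}"
  define \<tau> where "\<tau> f = ef_type k (graph_of_edges n f) []" for f
  define rep where "rep t = (SOME f. f \<in> D \<and> \<tau> f = t)" for t
  have rep: "rep (\<tau> f) \<in> D \<and> \<tau> (rep (\<tau> f)) = \<tau> f" if "f \<in> D" for f
    unfolding rep_def by (rule someI[of _ f]) (use that in simp)
  \<comment> \<open>Extensional functions are used so that the candidates number exactly
    \<open>n ^ n\<close>.\<close>
  define isom where "isom f \<phi> \<longleftrightarrow> \<phi> \<in> {1..n} \<rightarrow>\<^sub>E {1..n} \<and> (\<forall>u\<in>{1..n}. \<forall>v\<in>{1..n}.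
    (u, v) \<in> parcs (graph_of_edges n f) \<longleftrightarrow> (\<phi> u, \<phi> v) \<in> parcs (graph_of_edges n (rep (\<tau> f))))" for f \<phi>
  have "\<exists>\<phi>. isom f \<phi>" if f: "f \<in> D" for f
  proof -
    let ?G = "graph_of_edges n f" and ?H = "graph_of_edges n (rep (\<tau> f))"
    obtain a where a: "fo_defines a ?H" "qdepth a \<le> k" using rep[OF f] unfolding D_def by blast
    have "models ?G a"
      using models_of_ef_type[OF pair_graph_graph_of_edges pair_graph_graph_of_edges, of k n f n "rep (\<tau> f)" a]
        rep[OF f] a unfolding \<tau>_def fo_defines_def by auto
    then have "digraph_iso (with_proj ?G) (with_proj ?H)"
      using a(1) pair_graph_graph_of_edges unfolding fo_defines_def by blast
    then show ?thesis
    proof (rule digraph_iso_with_projD)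
      fix \<phi> assume \<phi>: "bij_betw \<phi> (pverts ?G) (pverts ?H)"
        "\<And>x y. x \<in> pverts ?G \<Longrightarrow> y \<in> pverts ?G \<Longrightarrow> (x, y) \<in> parcs ?G \<longleftrightarrow> (\<phi> x, \<phi> y) \<in> parcs ?H"
      have V: "pverts (graph_of_edges n g) = {1..n}" for g by (simp add: graph_of_edges_def)
      have "isom f (restrict \<phi> {1..n})"
        unfolding isom_def using \<phi> unfolding V by (auto simp: bij_betw_def)
      then show ?thesis by blast
    qed
  qed
  then obtain \<phi> where \<phi>: "\<And>f. f \<in> D \<Longrightarrow> isom f (\<phi> f)" by metis
  have inj: "inj_on (\<lambda>f. (\<tau> f, \<phi> f)) D"
  proof (rule inj_onI)
    fix f g assume fg: "f \<in> D" "g \<in> D" "(\<tau> f, \<phi> f) = (\<tau> g, \<phi> g)"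
    have arcs: "(u, v) \<in> parcs (graph_of_edges n f) \<longleftrightarrow> (u, v) \<in> parcs (graph_of_edges n g)"
      if "u \<in> {1..n}" "v \<in> {1..n}" for u v
      using \<phi>[OF fg(1)] \<phi>[OF fg(2)] fg(3) that unfolding isom_def by auto
    show "f = g"
    proof
      fix e
      show "f e = g e"
      proof (cases "e \<in> vertex_pairs n")
        case True
        then obtain u v where "e = {u, v}" "u \<in> {1..n}" "v \<in> {1..n}"
          by (auto simp: vertex_pairs_def card_2_iff)
        with arcs[of u v] True show ?thesis by (auto simp: graph_of_edges_def)
      qed (use fg in \<open>auto simp: D_def\<close>)
    qed
  qed
  have im: "(\<lambda>f. (\<tau> f, \<phi> f)) ` D \<subseteq> {..<ef_bound k 0} \<times> ({1..n} \<rightarrow>\<^sub>E {1..n})"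
    using \<phi> ef_type_less[of k _ "[]"] by (auto simp: \<tau>_def isom_def)
  have fin: "finite ({..<ef_bound k 0} \<times> ({1..n} \<rightarrow>\<^sub>E {1..n}))" by (intro finite_cartesian_product finite_PiE) auto
  have "card D \<le> card ({..<ef_bound k 0} \<times> ({1..n} \<rightarrow>\<^sub>E {1..n}))"
    by (rule card_inj_on_le[OF inj im fin])
  then have card: "card D \<le> ef_bound k 0 * n ^ n" by (simp add: card_cartesian_product card_PiE)
  have finD: "finite D" by (rule inj_on_finite[OF inj im fin])
  let ?M = "Pi_pmf (vertex_pairs n) False (\<lambda>_. bernoulli_pmf p)"
  have pmf: "pmf ?M f \<le> (1 - p) ^ (n choose 2)" if "f \<in> D" for f
  proof -
    have "pmf ?M f = (\<Prod>e\<in>vertex_pairs n. pmf (bernoulli_pmf p) (f e))"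
      using that by (intro pmf_Pi' finite_vertex_pairs) (auto simp: D_def)
    also have "\<dots> \<le> (\<Prod>e\<in>vertex_pairs n. 1 - p)"
    proof (intro prod_mono conjI)
      \<comment> \<open>Here \<open>p <= 1 / 2\<close> makes absence the likelier value of every
        pair.\<close>
      fix e show "pmf (bernoulli_pmf p) (f e) \<le> 1 - p" using p by (cases "f e") auto
    qed simp
    finally show ?thesis by (simp add: card_vertex_pairs)
  qed
  have "measure_pmf.prob (random_graph n p) {G. \<exists>a. fo_defines a G \<and> qdepth a \<le> k} = measure_pmf.prob ?M
     {f. \<exists>a. fo_defines a (graph_of_edges n f) \<and> qdepth a \<le> k}"
    unfolding random_graph_def by (simp add: vimage_def)
  also have "\<dots> = measure_pmf.prob ?M D"
  proof (intro measure_pmf.finite_measure_eq_AE AE_pmfI)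
    fix f assume "f \<in> set_pmf ?M"
    then have "f \<in> {f. \<forall>x. x \<notin> vertex_pairs n \<longrightarrow> f x = False}"
      using set_Pi_pmf_subset[OF finite_vertex_pairs] by (rule subsetD[rotated])
    then show "f \<in> {f. \<exists>a. fo_defines a (graph_of_edges n f) \<and> qdepth a \<le> k} \<longleftrightarrow> f \<in> D"
      unfolding D_def by simp
  qed simp_all
  also have "\<dots> = (\<Sum>f\<in>D. pmf ?M f)" by (rule measure_measure_pmf_finite[OF finD])
  also have "\<dots> \<le> card D * (1 - p) ^ (n choose 2)"
    using sum_bounded_above[of D "pmf ?M" "(1 - p) ^ (n choose 2)"] pmf by simp
  also have "\<dots> \<le> (ef_bound k 0 * real n ^ n) * (1 - p) ^ (n choose 2)"
  proof (rule mult_right_mono)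
    show "real (card D) \<le> ef_bound k 0 * real n ^ n"
      using of_nat_mono[OF card, where 'a = real] by simp
  qed (use p in simp)
  finally show ?thesis .
qed

lemma prob_small_depth_tendsto_0:
  "(\<lambda>n. measure_pmf.prob (random_graph n (real n powr (- (1 / 4))))
     {G. \<exists>a. fo_defines a G \<and> qdepth a \<le> log_star (real n) div 4}) \<longlonglongrightarrow> 0"
proof (rule tendsto_sandwich[OF _ _ tendsto_const])
  let ?p = "\<lambda>n. real n powr (- (1 / 4))"
  \<comment> \<open>From \<open>tower 7\<close> on, \<open>log_star n\<close> exceeds 7. Then
    \<open>2 * (L div 4) + 3\<close>, the height of the tower that bounds the number of types, is
    below \<open>L\<close>, and the types number at most \<open>n\<close>.\<close>
  define c where "c = tower 7"
  show "\<forall>\<^sub>F n in sequentially. measure_pmf.prob (random_graph n (?p n))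
      {G. \<exists>a. fo_defines a G \<and> qdepth a \<le> log_star (real n) div 4}
      \<le> exp ((real n + 1) * ln n - ?p n * (real n * (real n - 1) / 2))"
    using eventually_ge_at_top[of c] eventually_ge_at_top[of 16]
  proof eventually_elim
    case (elim n)
    define L where "L = log_star (real n)"
    have "7 < L"
    proof (rule ccontr)
      assume "\<not> 7 < L"
      then have "tower L \<le> c" unfolding c_def by (intro tower_mono) simp
      then show False using less_tower_log_star[of n] elim(1) unfolding L_def by linarith
    qed
    then have "2 * (L div 4) + 0 + 3 < L" by linarith
    from tower_le_of_less_log_star[OF this[unfolded L_def]]
    have n: "ef_bound (L div 4) 0 \<le> n"
      using ef_bound_le_tower[of "L div 4" 0] unfolding L_def by simp
    have "?p n \<le> 16 powr (- (1 / 4))"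
      using elim by (intro powr_mono2') auto
    also have "(16::real) powr (- (1 / 4)) = 1 / 2"
    proof -
      have "(16::real) powr (- (1 / 4)) = (2 powr 4) powr (- (1 / 4))" by simp
      also have "\<dots> = 2 powr (-1)" unfolding powr_powr by simp
      finally show ?thesis by (simp add: powr_minus_divide)
    qed
    finally have p: "?p n \<le> 1 / 2" .
    have "measure_pmf.prob (random_graph n (?p n)) {G. \<exists>a. fo_defines a G \<and> qdepth a \<le> L div 4}
      \<le> ef_bound (L div 4) 0 * real n ^ n * (1 - ?p n) ^ (n choose 2)"
      by (rule prob_fo_defines_le) (use p in simp_all)
    also have "\<dots> \<le> real n * real n ^ n * exp (- ?p n) ^ (n choose 2)"
      using n p exp_ge_add_one_self[of "- ?p n"] by (intro mult_mono power_mono) auto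
    also have "real n * real n ^ n = exp ((real n + 1) * ln n)"
    proof -
      have "exp ((real n + 1) * ln n) = exp (real (Suc n) * ln n)" by (simp add: add.commute)
      also have "\<dots> = real n ^ Suc n" using elim by (subst exp_of_nat_mult) simp
      finally show ?thesis by simp
    qed
    also have "exp (- ?p n) ^ (n choose 2) = exp (- (?p n * (real n * (real n - 1) / 2)))"
    proof -
      have "real (n choose 2) = real n * (real n - 1) / 2"
      proof -
        have "real (n - 1) = real n - 1" using elim by (subst of_nat_diff) auto
        then show ?thesis by (simp add: choose_two real_of_nat_div)
      qed
      then show ?thesis unfolding exp_of_nat_mult[symmetric] by simp
    qed
    also have "exp ((real n + 1) * ln n) * exp (- (?p n * (real n * (real n - 1) / 2))) =
      exp ((real n + 1) * ln n - ?p n * (real n * (real n - 1) / 2))"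
      unfolding exp_add[symmetric] by simp
    finally show ?case unfolding L_def .
  qed
  \<comment> \<open>The negative term is of order \<open>n powr (7 / 4)\<close> and outweighs
    \<open>n * ln n\<close>.\<close>
  show "(\<lambda>n. exp ((real n + 1) * ln n - ?p n * (real n * (real n - 1) / 2))) \<longlonglongrightarrow> 0"
    by real_asymp
qed simp

section \<open>Product distributions\<close>

definition depends_on :: "'a set \<Rightarrow> (('a \<Rightarrow> 'b) \<Rightarrow> bool) \<Rightarrow> bool" where
  "depends_on J P \<longleftrightarrow> (\<forall>f g. (\<forall>x\<in>J. f x = g x) \<longrightarrow> P f = P g)"

lemma depends_onI: "(\<And>f g. (\<And>x. x \<in> J \<Longrightarrow> f x = g x) \<Longrightarrow> P f = P g) \<Longrightarrow> depends_on J P"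
  unfolding depends_on_def by blast

lemma depends_onD: "depends_on J P \<Longrightarrow> (\<And>x. x \<in> J \<Longrightarrow> f x = g x) \<Longrightarrow> P f = P g"
  unfolding depends_on_def by blast

text \<open>This lets a second conditioning, on more coordinates, be performed inside a first
  one.\<close>

lemma override_on_override_on:
  "J' \<subseteq> J \<Longrightarrow> override_on g (override_on g' f J') J = override_on (override_on g g' J) f J'"
  by (auto simp: override_on_def fun_eq_iff)

locale product_pmf =
  fixes E :: "'a set" and d :: 'b and q :: "'a \<Rightarrow> 'b pmf"
  assumes finite_E: "finite E"
begin

abbreviation "M \<equiv> Pi_pmf E d q"
abbreviation "pr P \<equiv> measure_pmf.prob M {f. P f}"

text \<open>A substitute for conditional distributions: the coordinates outside \<open>J\<close> are
  kept from \<open>g\<close>, those in \<open>J\<close> are drawn afresh. \<open>J\<close> need not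
  lie in \<open>E\<close>, because both functions have the default value outside
  \<open>E\<close>.\<close>

lemma resample: "map_pmf (\<lambda>(g, f). override_on g f J) (pair_pmf M M) = M"
proof -
  have outside: "f x = d" if "f \<in> set_pmf M" "x \<notin> E" for f x
    using subsetD[OF set_Pi_pmf_subset[OF finite_E] that(1)] that(2) by simp
  let ?A = "E \<inter> J" and ?C = "E - J"
  let ?m = "\<lambda>(f, g) x. if x \<in> ?A then f x else g x"
  let ?r = "\<lambda>A f x. if x \<in> A then f x else d"
  have "M = Pi_pmf (?A \<union> ?C) d q" by (simp add: Int_Diff_Un)
  also have "\<dots> = map_pmf ?m (pair_pmf (Pi_pmf ?A d q) (Pi_pmf ?C d q))"
    using finite_E by (intro Pi_pmf_union) auto
  also have "\<dots> = map_pmf ?m (pair_pmf (map_pmf (?r ?A) M) (map_pmf (?r ?C) M))"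
    using Pi_pmf_subset[OF finite_E, of ?A d q] Pi_pmf_subset[OF finite_E, of ?C d q] by simp
  also have "\<dots> = map_pmf (\<lambda>(f, g) x. if x \<in> ?A then f x else if x \<in> ?C then g x else d) (pair_pmf M M)"
    unfolding map_pair[symmetric] map_pmf_comp by (intro map_pmf_cong) auto
  also have "\<dots> = map_pmf (\<lambda>(f, g). override_on g f J) (pair_pmf M M)"
    using outside[symmetric] by (intro map_pmf_cong refl) (auto simp: override_on_def fun_eq_iff)
  also have "\<dots> = map_pmf (\<lambda>(g, f). override_on g f J) (pair_pmf M M)"
    by (subst pair_commute_pmf) (simp add: map_pmf_comp case_prod_unfold)
  finally show ?thesis ..
qed

lemma emeasure_resample:
  "emeasure M {f. B f} = (\<integral>\<^sup>+g. emeasure M {f. B (override_on g f J)} \<partial>M)"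
proof -
  have "emeasure M {f. B f} = emeasure (map_pmf (\<lambda>(g, f). override_on g f J) (pair_pmf M M)) {f. B f}"
    by (simp only: resample)
  also have "\<dots> = (\<integral>\<^sup>+g. emeasure M {f. B (override_on g f J)} \<partial>M)"
    by (simp add: pair_pmf_def map_bind_pmf emeasure_bind_pmf bind_return_pmf' map_pmf_def[symmetric]
        vimage_def del: emeasure_map_pmf) (simp add: vimage_def)
  finally show ?thesis .
qed

lemma conditional_bound:
  assumes "\<And>g. pr (\<lambda>f. B (override_on g f J)) \<le> \<epsilon>"
  shows "pr B \<le> \<epsilon>"
proof -
  have e: "0 \<le> \<epsilon>" using assms measure_nonneg order_trans by blast
  have "emeasure M {f. B f} \<le> (\<integral>\<^sup>+g. ennreal \<epsilon> \<partial>M)"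
    unfolding emeasure_resample[of B J]
    by (intro nn_integral_mono) (simp add: measure_pmf.emeasure_eq_measure assms ennreal_leI)
  also have "\<dots> = ennreal \<epsilon>" by simp
  finally show ?thesis using e by (simp add: measure_pmf.emeasure_eq_measure)
qed

lemma prob_indep:
  assumes "depends_on J P" "depends_on J' Q" "J \<inter> J' = {}"
  shows "pr (\<lambda>f. P f \<and> Q f) = pr P * pr Q"
proof -
  have P: "P (override_on g f J) = P f" for f g
    by (rule depends_onD[OF assms(1)]) simp
  have Q: "Q (override_on g f J) = Q g" for f g
    by (rule depends_onD[OF assms(2)]) (use assms(3) in \<open>auto simp: override_on_def\<close>)
  have "emeasure M {f. P f \<and> Q f} = (\<integral>\<^sup>+g. emeasure M {f. P f} * indicator {g. Q g} g \<partial>M)"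
    unfolding emeasure_resample[of "\<lambda>f. P f \<and> Q f" J] P Q
    by (intro nn_integral_cong) (simp add: indicator_def)
  also have "\<dots> = emeasure M {f. P f} * emeasure M {f. Q f}"
    by (simp add: nn_integral_cmult_indicator)
  finally show ?thesis
    by (simp add: measure_pmf.emeasure_eq_measure ennreal_mult[symmetric])
qed

lemma prob_indep_all:
  assumes "finite K" "\<And>k. k \<in> K \<Longrightarrow> depends_on (J k) (P k)" "disjoint_family_on J K"
  shows "pr (\<lambda>f. \<forall>k\<in>K. P k f) = (\<Prod>k\<in>K. pr (P k))"
  using assms
proof (induction K rule: finite_induct)
  case empty
  then show ?case by simp
next
  case (insert k K)
  have "pr (\<lambda>f. P k f \<and> (\<forall>k\<in>K. P k f)) = pr (P k) * pr (\<lambda>f. \<forall>k\<in>K. P k f)"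
  proof (rule prob_indep)
    show "depends_on (J k) (P k)" using insert.prems by simp
    show "depends_on (\<Union>k\<in>K. J k) (\<lambda>f. \<forall>k\<in>K. P k f)"
    proof (rule depends_onI)
      fix f g :: "'a \<Rightarrow> 'b" assume *: "\<And>x. x \<in> (\<Union>k\<in>K. J k) \<Longrightarrow> f x = g x"
      have "P l f = P l g" if "l \<in> K" for l
        by (rule depends_onD[of "J l"]) (use insert.prems * that in auto)
      then show "(\<forall>k\<in>K. P k f) = (\<forall>k\<in>K. P k g)" by blast
    qed
    show "J k \<inter> (\<Union>k\<in>K. J k) = {}"
      using insert.prems(2) insert.hyps(2) by (auto simp: disjoint_family_on_def)
  qed
  moreover have "disjoint_family_on J K"
    using insert.prems(2) by (auto simp: disjoint_family_on_def)
  ultimately show ?case using insert by simp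
qed

lemma prob_mono: "(\<And>f. P f \<Longrightarrow> Q f) \<Longrightarrow> pr P \<le> pr Q"
  by (intro measure_pmf.finite_measure_mono) auto

lemma prob_not: "pr (\<lambda>f. \<not> P f) = 1 - pr P"
  using measure_pmf.prob_neg[of M P] by (simp add: space_measure_pmf)

lemma prob_union: "finite K \<Longrightarrow> pr (\<lambda>f. \<exists>k\<in>K. P k f) \<le> (\<Sum>k\<in>K. pr (P k))"
proof -
  assume K: "finite K"
  have "{f. \<exists>k\<in>K. P k f} = (\<Union>k\<in>K. {f. P k f})" by auto
  then show ?thesis using measure_pmf.finite_measure_subadditive_finite[OF K, of "\<lambda>k. {f. P k f}" M] by simp
qed

lemma prob_union_bound:
  fixes \<epsilon> :: real
  assumes "finite K" "\<And>k. k \<in> K \<Longrightarrow> pr (P k) \<le> \<epsilon>"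
  shows "pr (\<lambda>f. \<exists>k\<in>K. P k f) \<le> card K * \<epsilon>"
  using order_trans[OF prob_union[OF assms(1)] sum_bounded_above[OF assms(2)]] by simp

lemma prob_disj: "pr (\<lambda>f. P f \<or> Q f) \<le> pr P + pr Q"
proof -
  have "{f. P f \<or> Q f} = {f. P f} \<union> {f. Q f}" by auto
  then show ?thesis using measure_Un_le[of "{f. P f}" M "{f. Q f}"] by simp
qed

lemma prob_selection:
  fixes r :: real
  assumes F: "finite F" "S \<subseteq> F" and dep: "\<And>w. w \<in> F \<Longrightarrow> depends_on (J w) (B w)"
    and disj: "disjoint_family_on J F" and r: "\<And>w. w \<in> F \<Longrightarrow> pr (B w) = r"
  shows "pr (\<lambda>f. {w \<in> F. B w f} = S) = r ^ card S * (1 - r) ^ (card F - card S)"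
proof -
  have "pr (\<lambda>f. {w \<in> F. B w f} = S) = pr (\<lambda>f. \<forall>w\<in>F. B w f \<longleftrightarrow> w \<in> S)"
    by (rule arg_cong[of _ _ "\<lambda>X. measure_pmf.prob M X"]) (use F(2) in auto)
  also have "\<dots> = (\<Prod>w\<in>F. pr (\<lambda>f. B w f \<longleftrightarrow> w \<in> S))"
    by (rule prob_indep_all[OF F(1) _ disj]) (use dep in \<open>auto simp: depends_on_def\<close>)
  also have "\<dots> = (\<Prod>w\<in>F. if w \<in> S then r else 1 - r)"
    by (intro prod.cong refl) (auto simp: prob_not r)
  also have "\<dots> = r ^ card S * (1 - r) ^ card (F - S)"
    using F by (simp add: prod.If_cases Int_absorb1 Diff_eq)
  finally show ?thesis using F by (simp add: card_Diff_subset finite_subset)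
qed

lemma prob_card_selection:
  fixes r :: real
  assumes F: "finite F" and dep: "\<And>w. w \<in> F \<Longrightarrow> depends_on (J w) (B w)"
    and disj: "disjoint_family_on J F" and r: "\<And>w. w \<in> F \<Longrightarrow> pr (B w) = r"
  shows "pr (\<lambda>f. card {w \<in> F. B w f} = k) = (card F choose k) * (r ^ k * (1 - r) ^ (card F - k))"
proof -
  let ?K = "{S. S \<subseteq> F \<and> card S = k}"
  have "{f. card {w \<in> F. B w f} = k} = (\<Union>S\<in>?K. {f. {w \<in> F. B w f} = S})" by auto
  moreover have "measure_pmf.prob M (\<Union>S\<in>?K. {f. {w \<in> F. B w f} = S}) = (\<Sum>S\<in>?K. pr (\<lambda>f. {w \<in> F. B w f} = S))"
    by (rule measure_pmf.finite_measure_finite_Union) (use F in \<open>auto simp: disjoint_family_on_def\<close>)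
  moreover have "\<dots> = (\<Sum>S\<in>?K. r ^ k * (1 - r) ^ (card F - k))"
    using prob_selection[OF F _ dep disj r] by (intro sum.cong) auto
  ultimately show ?thesis using n_subsets[OF F] by simp
qed

text \<open>Chebyshev's inequality with variance at most \<open>\<mu>\<close>. The weak bound
  \<open>4 / \<mu>\<close> is enough, since the means will be of order at least
  \<open>n powr (1 / 4)\<close>, while the union bounds run over \<open>n powr (1 / 10)\<close>
  trials and polylogarithmically many subsets.\<close>

lemma prob_card_deviation:
  fixes r \<mu> :: real
  assumes F: "finite F" and dep: "\<And>w. w \<in> F \<Longrightarrow> depends_on (J w) (B w)"
    and disj: "disjoint_family_on J F" and r: "\<And>w. w \<in> F \<Longrightarrow> pr (B w) = r"
    and \<mu>: "\<mu> = card F * r" "0 < \<mu>"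
  shows "pr (\<lambda>f. real (card {w \<in> F. B w f}) < \<mu> / 2 \<or> 2 * \<mu> < card {w \<in> F. B w f}) \<le> 4 / \<mu>"
proof -
  define X where "X f = (\<Sum>w\<in>F. indicat_real {f. B w f} f)" for f
  have X: "X f = card {w \<in> F. B w f}" for f
    unfolding X_def using F by (simp add: indicator_def sum.If_cases Int_def)
  have int: "integrable M (h :: ('a \<Rightarrow> 'b) \<Rightarrow> real)" if "\<And>f. \<bar>h f\<bar> \<le> C" for h C
    by (rule measure_pmf.integrable_const_bound[where B = C]) (use that in auto)
  have intI: "integrable M (indicat_real A)" for A by (rule int[of _ 1]) (simp add: indicator_def)
  have "\<bar>X f\<bar> \<le> card F" for f using F by (auto simp: X intro: card_mono)
  then have intX: "integrable M X" by (rule int)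
  have "\<bar>(X f)\<^sup>2\<bar> \<le> (real (card F))\<^sup>2" for f using F by (auto simp: X intro!: power_mono card_mono)
  then have intX2: "integrable M (\<lambda>f. (X f)\<^sup>2)" by (rule int)
  have EX: "measure_pmf.expectation M X = \<mu>"
    unfolding X_def using r \<mu> by (subst Bochner_Integration.integral_sum) (auto intro: intI)
  have "(X f)\<^sup>2 = (\<Sum>w\<in>F. \<Sum>w'\<in>F. indicat_real {f. B w f \<and> B w' f} f)" for f
    unfolding X_def power2_eq_square sum_product by (intro sum.cong refl) (auto simp: indicator_def)
  then have "measure_pmf.expectation M (\<lambda>f. (X f)\<^sup>2) = (\<Sum>w\<in>F. \<Sum>w'\<in>F. pr (\<lambda>f. B w f \<and> B w' f))"
    by (simp add: intI)
  \<comment> \<open>Off the diagonal independence gives \<open>r * r\<close>; on it \<open>r\<close>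
    is generously bounded by \<open>r + r * r\<close>, which makes the total
    \<open>\<mu> + \<mu> * \<mu>\<close>.\<close>
  also have "\<dots> \<le> (\<Sum>w\<in>F. \<Sum>w'\<in>F. (if w = w' then r else 0) + r * r)"
  proof (intro sum_mono)
    fix w w' assume w: "w \<in> F" "w' \<in> F"
    show "pr (\<lambda>f. B w f \<and> B w' f) \<le> (if w = w' then r else 0) + r * r"
    proof (cases "w = w'")
      case False
      then have "J w \<inter> J w' = {}" using disj w by (auto simp: disjoint_family_on_def)
      then have "pr (\<lambda>f. B w f \<and> B w' f) = pr (B w) * pr (B w')"
        using dep w by (intro prob_indep) auto
      then show ?thesis using False r w by simp
    qed (use r w in auto)
  qed
  also have "\<dots> = \<mu> + \<mu>\<^sup>2"
    using F by (simp add: sum.distrib \<mu>(1) power2_eq_square algebra_simps)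
  finally have var: "measure_pmf.variance M X \<le> \<mu>"
    using measure_pmf.variance_eq[OF intX intX2] EX by simp
  have "pr (\<lambda>f. X f < \<mu> / 2 \<or> 2 * \<mu> < X f) \<le> measure_pmf.prob M {f \<in> space M. \<mu> / 2 \<le> \<bar>X f - measure_pmf.expectation M X\<bar>}"
    unfolding EX using \<mu>(2) by (intro measure_pmf.finite_measure_mono) (auto simp: abs_if)
  also have "\<dots> \<le> measure_pmf.variance M X / (\<mu> / 2)\<^sup>2"
    by (rule measure_pmf.Chebyshev_inequality) (use intX2 \<mu>(2) in auto)
  also have "\<dots> \<le> \<mu> / (\<mu> / 2)\<^sup>2" using var by (intro divide_right_mono) auto
  also have "\<dots> = 4 / \<mu>" using \<mu>(2) by (simp add: power2_eq_square)
  finally show ?thesis by (simp add: X)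
qed

end

section \<open>Independent coins of equal bias\<close>

locale bernoulli_product = product_pmf E False "\<lambda>_. bernoulli_pmf p" for E :: "'a set" and p :: real +
  assumes p: "0 \<le> p" "p \<le> 1"
begin

lemma prob_coordinate: "e \<in> E \<Longrightarrow> pr (\<lambda>f. f e) = p"
proof -
  assume e: "e \<in> E"
  have "pr (\<lambda>f. f e) = measure_pmf.prob (map_pmf (\<lambda>f. f e) M) {True}"
    by (simp add: vimage_def)
  also have "\<dots> = p"
    using e p by (subst Pi_pmf_component) (auto simp: finite_E measure_pmf_single)
  finally show ?thesis .
qed

lemma prob_pattern:
  assumes "F \<subseteq> E"
  shows "pr (\<lambda>f. \<forall>e\<in>F. f e \<longleftrightarrow> e \<in> T) = p ^ card (F \<inter> T) * (1 - p) ^ card (F - T)"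
proof -
  have F: "finite F" using assms finite_E finite_subset by blast
  have "pr (\<lambda>f. \<forall>e\<in>F. f e \<longleftrightarrow> e \<in> T) = (\<Prod>e\<in>F. pr (\<lambda>f. f e \<longleftrightarrow> e \<in> T))"
    by (rule prob_indep_all[OF F, of "\<lambda>e. {e}"]) (auto simp: depends_on_def disjoint_family_on_def)
  also have "\<dots> = (\<Prod>e\<in>F. if e \<in> T then p else 1 - p)"
    using assms by (intro prod.cong refl) (auto simp: prob_not prob_coordinate)
  also have "\<dots> = p ^ card (F \<inter> T) * (1 - p) ^ card (F - T)"
    using F by (simp add: prod.If_cases Diff_eq)
  finally show ?thesis .
qed

lemma prob_all: "F \<subseteq> E \<Longrightarrow> pr (\<lambda>f. \<forall>e\<in>F. f e) = p ^ card F"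
  using prob_pattern[of F F] by simp

end

section \<open>Good samples\<close>

lemma vertex_pairs_iff: "{u, v} \<in> vertex_pairs n \<longleftrightarrow> u \<noteq> v \<and> u \<in> {1..n} \<and> v \<in> {1..n}"
  by (cases "u = v") (simp_all add: vertex_pairs_def)

lemma graph_of_edges_simps:
  "pverts (graph_of_edges n f) = {1..n}"
  "(u, v) \<in> parcs (graph_of_edges n f) \<longleftrightarrow> u \<noteq> v \<and> u \<in> {1..n} \<and> v \<in> {1..n} \<and> f {u, v}"
  by (simp_all add: graph_of_edges_def vertex_pairs_iff del: atLeastAtMost_iff)

text \<open>
  A small pool of vertices supplies \<open>m\<close> independent trials for the parameters. Trial \<open>i\<close> uses the
  vertices \<open>pool i 0, \<dots>, pool i 3\<close> to select a core and \<open>pool i 4, pool i 5\<close> to draw a graph on it.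
\<close>
definition pool :: "nat \<Rightarrow> nat \<Rightarrow> nat" where
  "pool i c = 6 * i + c + 1"

definition pool_set :: "nat \<Rightarrow> nat set" where
  "pool_set m = {1..6 * m}"

definition rest :: "nat \<Rightarrow> nat \<Rightarrow> nat set" where
  "rest n m = {6 * m + 1..n}"

definition selected :: "nat \<Rightarrow> nat \<Rightarrow> nat \<Rightarrow> (nat set \<Rightarrow> bool) \<Rightarrow> nat set" where
  "selected n m i f = {w \<in> rest n m. \<forall>c<4. f {pool i c, w}}"

definition core_trace :: "(nat set \<Rightarrow> bool) \<Rightarrow> nat set \<Rightarrow> nat \<Rightarrow> nat set" where
  "core_trace f A w = {a \<in> A. f {w, a}}"

definition cell :: "nat \<Rightarrow> nat \<Rightarrow> (nat set \<Rightarrow> bool) \<Rightarrow> nat set \<Rightarrow> nat set \<Rightarrow> nat set" where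
  "cell n m f A T = {w \<in> rest n m - A. core_trace f A w = T}"

text \<open>The vertex itself is removed because \<open>f {v, v}\<close> is a value at a singleton,
  not an edge.\<close>

definition hit :: "nat \<Rightarrow> nat \<Rightarrow> (nat set \<Rightarrow> bool) \<Rightarrow> nat set \<Rightarrow> nat set \<Rightarrow> nat \<Rightarrow> bool" where
  "hit n m f A T v \<longleftrightarrow> (\<exists>w\<in>cell n m f A T - {v}. f {v, w})"

text \<open>The choice depends on the set alone: once the core is exposed, the graph prescribed on
  it is fixed as well.\<close>

definition enum :: "nat set \<Rightarrow> nat \<Rightarrow> nat" where
  "enum A = (SOME \<iota>. bij_betw \<iota> {..<card A} A)"

definition lucky :: "nat \<Rightarrow> nat \<Rightarrow> nat set \<Rightarrow> nat \<Rightarrow> (nat set \<Rightarrow> bool) \<Rightarrow> bool" where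
  "lucky n m A j f \<longleftrightarrow> (\<forall>T. T \<subseteq> A \<and> card T = 2 \<longrightarrow>
     ((\<exists>w\<in>cell n m f A T. f {pool j 4, w} \<and> f {pool j 5, w}) \<longleftrightarrow>
      (\<exists>k l. k < card A \<and> l < card A \<and> T = {enum A k, enum A l} \<and> level_graph k l)))"

lemma bij_betw_enum:
  assumes "finite A" shows "bij_betw (enum A) {..<card A} A"
proof -
  have "\<exists>\<iota>. bij_betw \<iota> {..<card A} A"
    using ex_bij_betw_nat_finite[OF assms] unfolding atLeast0LessThan .
  then show ?thesis unfolding enum_def by (rule someI_ex)
qed

lemma level_graph_sym: "level_graph i j \<longleftrightarrow> level_graph j i"
  by (auto simp: level_graph_def)

lemma pool_in: "i < m \<Longrightarrow> c < 6 \<Longrightarrow> pool i c \<in> pool_set m"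
  by (auto simp: pool_def pool_set_def)

lemma pool_eq_iff: "c < 6 \<Longrightarrow> c' < 6 \<Longrightarrow> pool i c = pool i' c' \<longleftrightarrow> i = i' \<and> c = c'"
  by (auto simp: pool_def) presburger+

lemma pool_rest_disjoint: "pool_set m \<inter> rest n m = {}"
  by (auto simp: pool_set_def rest_def)

lemma pool_rest_Un: "6 * m \<le> n \<Longrightarrow> pool_set m \<union> rest n m = {1..n}"
  by (auto simp: pool_set_def rest_def)

text \<open>The definitions quantify over all vertices, whereas the random analysis sees only
  witnesses in \<open>Q\<close>; \<open>indep\<close> and \<open>few\<close> close the gap. Without
  edges inside the pool no pool vertex lies in the core or witnesses \<open>core_rel\<close>. A pool
  vertex with fewer than three core neighbours witnesses no triple, and the four selecting vertices
  are joined to the whole core, which has at least four elements. The 15 is 2 from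
  \<open>definable_core_elements\<close> plus 13 from \<open>fo_defines_of_core\<close>.\<close>

lemma depth_of_good_sample:
  fixes f :: "nat set \<Rightarrow> bool" and n m :: nat
  defines "P \<equiv> pool_set m" and "Q \<equiv> rest n m"
  assumes m: "6 * m \<le> n" and indep: "\<And>u v. u \<in> P \<Longrightarrow> v \<in> P \<Longrightarrow> u \<noteq> v \<Longrightarrow> \<not> f {u, v}"
    and i: "i < m" and A: "A = selected n m i f" "4 \<le> card A"
    and few: "\<And>w. w \<in> P \<Longrightarrow> (\<And>c. c < 4 \<Longrightarrow> w \<noteq> pool i c) \<Longrightarrow> card (core_trace f A w) < 3"
    and j: "j < m" "lucky n m A j f"
    and sep: "\<And>v v'. v \<in> Q - A \<Longrightarrow> v' \<in> {1..n} - A \<Longrightarrow> v \<noteq> v' \<Longrightarrow>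
      \<exists>T\<subseteq>A. card T = 3 \<and> hit n m f A T v \<noteq> hit n m f A T v'"
    and sepP: "\<And>v v'. v \<in> P \<Longrightarrow> v' \<in> P \<Longrightarrow> v \<noteq> v' \<Longrightarrow> \<exists>w\<in>Q. f {v, w} \<noteq> f {v', w}"
  shows "\<exists>a. fo_defines a (graph_of_edges n f) \<and> qdepth a \<le> log_star (real n) + 15"
proof -
  let ?G = "graph_of_edges n f"
  have PQ: "P \<inter> Q = {}" "P \<union> Q = {1..n}"
    unfolding P_def Q_def using pool_rest_disjoint pool_rest_Un[OF m] by auto
  have AQ: "A \<subseteq> Q" unfolding A selected_def Q_def by blast
  have finA: "finite A" using AQ by (rule finite_subset) (simp add: Q_def rest_def)
  have bij: "bij_betw (enum A) {..<card A} A" by (rule bij_betw_enum[OF finA])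
  have enum_in: "enum A k \<in> A" if "k < card A" for k using bij that by (auto simp: bij_betw_def)
  have enum_inj: "enum A k = enum A l \<longleftrightarrow> k = l" if "k < card A" "l < card A" for k l
    using bij that by (auto simp: bij_betw_def dest: inj_onD)
  \<comment> \<open>Trial \<open>i\<close> names the core, a possibly different trial
    \<open>j\<close> names the graph on it, and the last two parameters are the vertices of level
    0.\<close>
  define par where "par k = (if k < 4 then pool i k else if k < 6 then pool j k else enum A (k - 6))" for k
  have pool: "pool i' c \<in> P" if "i' < m" "c < 6" for i' c unfolding P_def using pool_in that .
  interpret pair_graph ?G by (rule pair_graph_graph_of_edges)
  interpret graph_params ?G par
  proof
    fix k :: nat assume "k < 8"
    then show "par k \<in> pverts ?G"
    proof -
      have "k - 6 < card A" using \<open>k < 8\<close> A(2) by linarith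
      then have "enum A (k - 6) \<in> P \<union> Q" using enum_in AQ by blast
      moreover have "pool i k \<in> P" "pool j k \<in> P" if "k < 6" using pool i j that by auto
      ultimately show ?thesis unfolding PQ(2) par_def graph_of_edges_simps(1) using PQ(2) by auto
    qed
  qed
  have V: "V = {1..n}" by (simp add: graph_of_edges_simps)
  have arc: "(u, v) \<in> parcs ?G \<longleftrightarrow> u \<noteq> v \<and> u \<in> V \<and> v \<in> V \<and> f {u, v}" for u v
    unfolding graph_of_edges_simps V ..
  have core: "core = A"
  proof (intro equalityI subsetI)
    fix v assume "v \<in> core"
    then have v: "v \<in> V" "\<And>c. c < 4 \<Longrightarrow> v \<noteq> pool i c \<and> f {v, pool i c}"
      unfolding core_def arc by (auto simp: par_def)
    have "v \<notin> P"
      using indep[of v "pool i 0"] pool[OF i, of 0] v(2)[of 0] by auto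
    then have "v \<in> rest n m" using v(1) PQ V unfolding Q_def by blast
    then show "v \<in> A" unfolding A selected_def using v(2) by (auto simp: insert_commute)
  next
    fix v assume v: "v \<in> A"
    then have "v \<in> V" "v \<notin> P" using AQ PQ V by auto
    moreover have "pool i c \<in> V" "f {v, pool i c}" if "c < 4" for c
      using v pool[OF i, of c] that PQ V unfolding A selected_def by (auto simp: insert_commute)
    ultimately show "v \<in> core"
      unfolding core_def arc using pool[OF i] by (auto simp: par_def)
  qed
  have nbrs: "core_nbrs w = core_trace f A w" if "w \<in> V - A" for w
    unfolding core_nbrs_def core core_trace_def arc using that AQ PQ V by auto
  have rel: "core_rel (enum A k) (enum A l) \<longleftrightarrow> level_graph k l"
    if kl: "k < card A" "l < card A" "k \<noteq> l" for k l
  proof -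
    let ?T = "{enum A k, enum A l}"
    have T: "?T \<subseteq> A" "card ?T = 2" using kl enum_in enum_inj by auto
    have "core_rel (enum A k) (enum A l) \<longleftrightarrow>
      (\<exists>w\<in>V - A. (w, pool j 4) \<in> parcs ?G \<and> (w, pool j 5) \<in> parcs ?G \<and> core_trace f A w = ?T)"
      unfolding core_rel_def core using nbrs by (auto simp: par_def)
    also have "\<dots> \<longleftrightarrow> (\<exists>w\<in>cell n m f A ?T. f {pool j 4, w} \<and> f {pool j 5, w})"
    proof (intro iffI; elim bexE conjE)
      fix w assume w: "w \<in> V - A" "(w, pool j 4) \<in> parcs ?G" "(w, pool j 5) \<in> parcs ?G" "core_trace f A w = ?T"
      have "w \<notin> P" using indep[of w "pool j 4"] pool[OF j(1), of 4] w(2) unfolding arc by auto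
      then have "w \<in> cell n m f A ?T" using w V PQ by (auto simp: cell_def Q_def)
      then show "\<exists>w\<in>cell n m f A ?T. f {pool j 4, w} \<and> f {pool j 5, w}"
        using w(2,3) unfolding arc by (auto simp: insert_commute)
    next
      fix w assume w: "w \<in> cell n m f A ?T" "f {pool j 4, w}" "f {pool j 5, w}"
      then have "w \<in> V - A" "w \<notin> P" "core_trace f A w = ?T" using V PQ by (auto simp: cell_def Q_def)
      moreover have "pool j 4 \<in> P" "pool j 5 \<in> P" using pool j by auto
      ultimately show "\<exists>w\<in>V - A. (w, pool j 4) \<in> parcs ?G \<and> (w, pool j 5) \<in> parcs ?G \<and> core_trace f A w = ?T"
        unfolding arc using w V PQ by (intro bexI[of _ w]) (auto simp: insert_commute)
    qed
    also have "\<dots> \<longleftrightarrow> (\<exists>k' l'. k' < card A \<and> l' < card A \<and> ?T = {enum A k', enum A l'} \<and> level_graph k' l')"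
      using j(2) T unfolding lucky_def by blast
    also have "\<dots> \<longleftrightarrow> level_graph k l"
      using kl enum_inj level_graph_sym by (auto simp: doubleton_eq_iff)
    finally show ?thesis .
  qed
  \<comment> \<open>The crude bound \<open>card A <= n\<close> already gives at most
    \<open>log_star n\<close> levels above the base, which is all that is needed.\<close>
  have "card A \<le> card {1..n}" using AQ PQ by (intro card_mono) auto
  then have s: "card A \<le> level_start (Suc (log_star (real n)))"
    using less_tower_log_star[of n] tower_less_level_start[of "log_star (real n)"] by simp
  have elements: "definable (log_star (real n) + 2) {v}" if "v \<in> core" for v
    by (rule definable_core_elements[OF _ _ s _ _ _ that, of "enum A"])
      (use bij rel A(2) in \<open>auto simp: core par_def\<close>)
  have type: "T \<in> core_type v \<longleftrightarrow> hit n m f A T v" if T: "T \<subseteq> A" "card T = 3" and v: "v \<in> V" for T v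
  proof
    assume "T \<in> core_type v"
    then obtain w where w: "w \<in> V - A" "core_trace f A w = T" "(v, w) \<in> parcs ?G"
      unfolding core_type_def core using nbrs by auto
    have "w \<notin> P"
    proof
      assume "w \<in> P"
      then obtain c where "c < 4" "w = pool i c" using few[of w] T w by fastforce
      then have "core_trace f A w = A" unfolding A selected_def core_trace_def by auto
      then show False using w T A(2) by simp
    qed
    then have "w \<in> cell n m f A T" using w V PQ by (auto simp: cell_def Q_def)
    then show "hit n m f A T v" using w(3) unfolding hit_def arc by auto
  next
    assume "hit n m f A T v"
    then obtain w where w: "w \<in> cell n m f A T" "w \<noteq> v" "f {v, w}" unfolding hit_def by blast
    then have "w \<in> V - A" "core_trace f A w = T" using V PQ by (auto simp: cell_def Q_def)
    then show "T \<in> core_type v" unfolding core_type_def core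
      using T w v nbrs by (auto simp: arc)
  qed
  have "\<exists>a. fo_defines a ?G \<and> qdepth a \<le> log_star (real n) + 2 + 13"
  proof (rule fo_defines_of_core[where P = P, OF elements])
    fix v v' assume v: "v \<in> V - P - core" "v' \<in> V - core" and eq: "core_type v = core_type v'"
    show "v = v'"
    proof (rule ccontr)
      assume "v \<noteq> v'"
      moreover have "v \<in> Q - A" "v' \<in> {1..n} - A" using v V PQ core by blast+
      ultimately obtain T where "T \<subseteq> A" "card T = 3" "hit n m f A T v \<noteq> hit n m f A T v'"
        using sep by blast
      with type[OF this(1,2), of v] type[OF this(1,2), of v'] eq v show False by simp
    qed
  next
    show "P \<subseteq> V" using V PQ by blast
  next
    fix v v' assume v: "v \<in> P" "v' \<in> P"
      and eq: "\<And>w. w \<in> V - P \<Longrightarrow> (v, w) \<in> parcs ?G \<longleftrightarrow> (v', w) \<in> parcs ?G"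
    show "v = v'"
    proof (rule ccontr)
      assume "v \<noteq> v'"
      with sepP v obtain w where w: "w \<in> Q" "f {v, w} \<noteq> f {v', w}" by blast
      then have "w \<in> V - P" using V PQ by blast
      moreover have "v \<in> V" "v' \<in> V" "w \<noteq> v" "w \<noteq> v'" using v w(1) V PQ by blast+
      ultimately show False using eq[of w] w(2) unfolding arc by blast
    qed
  qed
  then show ?thesis by (simp add: add.commute)
qed

section \<open>Probability of good samples\<close>

definition balanced :: "nat \<Rightarrow> nat \<Rightarrow> nat set \<Rightarrow> nat \<Rightarrow> real \<Rightarrow> (nat set \<Rightarrow> bool) \<Rightarrow> bool" where
  "balanced n m A t \<mu> f \<longleftrightarrow> (\<forall>T\<subseteq>A. card T = t \<longrightarrow>
     \<mu> / 2 \<le> real (card (cell n m f A T)) \<and> real (card (cell n m f A T)) \<le> 2 * \<mu>)"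

definition separates :: "nat \<Rightarrow> nat \<Rightarrow> nat set \<Rightarrow> nat \<Rightarrow> nat \<Rightarrow> (nat set \<Rightarrow> bool) \<Rightarrow> bool" where
  "separates n m A v v' f \<longleftrightarrow> (\<exists>T\<subseteq>A. card T = 3 \<and> hit n m f A T v \<noteq> hit n m f A T v')"

lemma finite_rest: "finite (rest n m)" by (simp add: rest_def)

lemma card_rest: "card (rest n m) = n - 6 * m" by (simp add: rest_def)

lemma edge_eq_iff:
  "u \<in> pool_set m \<Longrightarrow> u' \<in> pool_set m \<Longrightarrow> w \<in> rest n m \<Longrightarrow> w' \<in> rest n m \<Longrightarrow>
    {u, w} = {u', w'} \<longleftrightarrow> u = u' \<and> w = w'"
  using pool_rest_disjoint[of m n] by (auto simp: doubleton_eq_iff)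

lemma cell_cong:
  "(\<And>w a. w \<in> rest n m - A \<Longrightarrow> a \<in> A \<Longrightarrow> f {w, a} = g {w, a}) \<Longrightarrow> cell n m f A T = cell n m g A T"
  unfolding cell_def core_trace_def by blast

lemma cell_disjoint: "w \<in> cell n m f A T \<Longrightarrow> w \<in> cell n m f A T' \<Longrightarrow> T = T'"
  by (simp add: cell_def)

lemma finite_cell: "finite (cell n m f A T)"
  by (rule finite_subset[OF _ finite_rest[of n m]]) (auto simp: cell_def)

lemma card_subsets_le:
  assumes "finite A" shows "card {T. T \<subseteq> A \<and> card T = t} \<le> card A ^ t"
  unfolding n_subsets[OF assms] using binomial_le_pow[of t "card A"]
  by (cases "t \<le> card A") (auto simp: binomial_eq_0)

locale random_trials = bernoulli_product "vertex_pairs n" p for n :: nat and p :: real +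
  fixes m :: nat
  assumes m: "6 * m \<le> n" and p01: "0 < p" "p \<le> 1 / 2"
begin

abbreviation "P \<equiv> pool_set m"
abbreviation "Q \<equiv> rest n m"
abbreviation "N \<equiv> n - 6 * m"

lemma P_vertices: "u \<in> P \<Longrightarrow> u \<in> {1..n}" and Q_vertices: "u \<in> Q \<Longrightarrow> u \<in> {1..n}"
  using m by (auto simp: pool_set_def rest_def)

lemma edge_in: "u \<in> {1..n} \<Longrightarrow> v \<in> {1..n} \<Longrightarrow> u \<noteq> v \<Longrightarrow> {u, v} \<in> vertex_pairs n"
  by (simp only: vertex_pairs_iff) simp

lemma PQ_edge: "u \<in> P \<Longrightarrow> w \<in> Q \<Longrightarrow> {u, w} \<in> vertex_pairs n"
  using pool_rest_disjoint[of m n] by (intro edge_in P_vertices Q_vertices) auto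

lemma prob_pool_edge: "pr (\<lambda>f. \<exists>u\<in>P. \<exists>v\<in>P. u \<noteq> v \<and> f {u, v}) \<le> (6 * m)\<^sup>2 * p"
proof -
  have 1: "pr (\<lambda>f. u \<noteq> v \<and> f {u, v}) \<le> p" if "u \<in> P" "v \<in> P" for u v
    using prob_coordinate[OF edge_in, of u v] P_vertices that p01 by (cases "u = v") auto
  have "pr (\<lambda>f. \<exists>e\<in>P \<times> P. fst e \<noteq> snd e \<and> f {fst e, snd e}) \<le> card (P \<times> P) * p"
    by (rule prob_union_bound) (use 1 in \<open>auto simp: pool_set_def\<close>)
  also have "card (P \<times> P) = (6 * m)\<^sup>2" by (simp add: card_cartesian_product pool_set_def power2_eq_square)
  finally show ?thesis by (simp add: Bex_def)
qed

text \<open>Different trials and different outside vertices use disjoint sets of four edges. The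
  sizes of the selected sets are therefore independent binomial variables with parameters
  \<open>N\<close> and \<open>p ^ 4\<close>, and the failures multiply.\<close>

lemma prob_no_core:
  "pr (\<lambda>f. \<forall>i<m. card (selected n m i f) \<noteq> s) = (1 - (N choose s) * ((p ^ 4) ^ s * (1 - p ^ 4) ^ (N - s))) ^ m"
proof -
  define B where "B i w f \<longleftrightarrow> (\<forall>c<4. f {pool i c, w})" for i w and f :: "nat set \<Rightarrow> bool"
  define J where "J i w = (\<lambda>c. {pool i c, w}) ` {..<4}" for i w
  have dep: "depends_on (J i w) (B i w)" for i w
    by (rule depends_onI) (auto simp: B_def J_def)
  have inP: "pool i c \<in> P" if "i < m" "c < 4" for i c using pool_in[of i m c] that by simp
  have inj: "inj_on (\<lambda>c. {pool i c, w}) {..<4}" if "i < m" "w \<in> Q" for i w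
    using edge_eq_iff[OF inP[OF that(1)] inP[OF that(1)] that(2) that(2)] pool_eq_iff[of _ _ i i]
    by (auto intro!: inj_onI)
  have "pr (B i w) = p ^ 4" if "i < m" "w \<in> Q" for i w
  proof -
    have "B i w = (\<lambda>f. \<forall>e\<in>J i w. f e)" by (auto simp: B_def J_def fun_eq_iff)
    then have "pr (B i w) = pr (\<lambda>f. \<forall>e\<in>J i w. f e)" by simp
    also have "\<dots> = p ^ card (J i w)"
      by (rule prob_all) (use PQ_edge inP that in \<open>auto simp: J_def\<close>)
    also have "card (J i w) = 4" unfolding J_def using inj[OF that] by (simp add: card_image)
    finally show ?thesis .
  qed
  note r = this
  have disj: "J i w \<inter> J i' w' = {}" if "i < m" "i' < m" "w \<in> Q" "w' \<in> Q" "i \<noteq> i' \<or> w \<noteq> w'" for i i' w w'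
    using edge_eq_iff[OF inP[OF that(1)] inP[OF that(2)] that(3) that(4)] pool_eq_iff[of _ _ i i'] that
    by (auto simp: J_def)
  have "pr (\<lambda>f. card (selected n m i f) = s) = (N choose s) * ((p ^ 4) ^ s * (1 - p ^ 4) ^ (N - s))" if i: "i < m" for i
  proof -
    have "pr (\<lambda>f. card {w \<in> Q. B i w f} = s) = (card Q choose s) * ((p ^ 4) ^ s * (1 - p ^ 4) ^ (card Q - s))"
      by (rule prob_card_selection[OF finite_rest, where J = "J i"])
        (use dep r i disj in \<open>auto simp: disjoint_family_on_def\<close>)
    then show ?thesis by (simp add: B_def selected_def card_rest)
  qed
  note one = this
  have "pr (\<lambda>f. \<forall>i\<in>{..<m}. card (selected n m i f) \<noteq> s) = (\<Prod>i<m. pr (\<lambda>f. card (selected n m i f) \<noteq> s))"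
  proof (rule prob_indep_all[where J = "\<lambda>i. \<Union>w\<in>Q. J i w"])
    fix i assume "i \<in> {..<m}"
    show "depends_on (\<Union>w\<in>Q. J i w) (\<lambda>f. card (selected n m i f) \<noteq> s)"
    proof (rule depends_onI)
      fix f g :: "nat set \<Rightarrow> bool" assume "\<And>e. e \<in> (\<Union>w\<in>Q. J i w) \<Longrightarrow> f e = g e"
      then have "selected n m i f = selected n m i g" by (auto simp: selected_def J_def)
      then show "(card (selected n m i f) \<noteq> s) = (card (selected n m i g) \<noteq> s)" by simp
    qed
  next
    show "disjoint_family_on (\<lambda>i. \<Union>w\<in>Q. J i w) {..<m}"
      unfolding disjoint_family_on_def
    proof (intro ballI impI)
      fix i i' assume "i \<in> {..<m}" "i' \<in> {..<m}" "i \<noteq> i'"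
      then show "(\<Union>w\<in>Q. J i w) \<inter> (\<Union>w\<in>Q. J i' w) = {}" using disj[of i i'] by blast
    qed
  qed simp
  also have "\<dots> = (1 - (N choose s) * ((p ^ 4) ^ s * (1 - p ^ 4) ^ (N - s))) ^ m"
    by (simp add: prob_not one)
  finally show ?thesis by (simp add: Ball_def)
qed

lemma prob_few:
  assumes A: "A \<subseteq> Q"
  shows "pr (\<lambda>f. \<exists>w\<in>P. 3 \<le> card (core_trace f A w)) \<le> 6 * m * (card A ^ 3 * p ^ 3)"
proof -
  have finA: "finite A" using A finite_rest finite_subset by blast
  have one: "pr (\<lambda>f. 3 \<le> card (core_trace f A w)) \<le> card A ^ 3 * p ^ 3" if w: "w \<in> P" for w
  proof -
    let ?K = "{T. T \<subseteq> A \<and> card T = 3}"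
    have "pr (\<lambda>f. \<forall>a\<in>T. f {w, a}) \<le> p ^ 3" if T: "T \<in> ?K" for T
    proof -
      have "inj_on (\<lambda>a. {w, a}) T" by (auto intro!: inj_onI simp: doubleton_eq_iff)
      then have c: "card ((\<lambda>a. {w, a}) ` T) = 3" using T by (simp add: card_image)
      have "pr (\<lambda>f. \<forall>a\<in>T. f {w, a}) = pr (\<lambda>f. \<forall>e\<in>(\<lambda>a. {w, a}) ` T. f e)" by simp
      also have "\<dots> = p ^ card ((\<lambda>a. {w, a}) ` T)"
        by (rule prob_all) (use PQ_edge w T A in auto)
      finally show ?thesis unfolding c by simp
    qed
    then have "pr (\<lambda>f. \<exists>T\<in>?K. \<forall>a\<in>T. f {w, a}) \<le> card ?K * p ^ 3"
      using finA by (intro prob_union_bound) auto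
    also have "\<dots> \<le> card A ^ 3 * p ^ 3"
      using card_subsets_le[OF finA, of 3] p01 by (intro mult_right_mono) auto
    finally have "pr (\<lambda>f. \<exists>T\<in>?K. \<forall>a\<in>T. f {w, a}) \<le> card A ^ 3 * p ^ 3" .
    moreover have "pr (\<lambda>f. 3 \<le> card (core_trace f A w)) \<le> pr (\<lambda>f. \<exists>T\<in>?K. \<forall>a\<in>T. f {w, a})"
    proof (rule prob_mono)
      fix f :: "nat set \<Rightarrow> bool" assume "3 \<le> card (core_trace f A w)"
      then obtain T where "T \<subseteq> core_trace f A w" "card T = 3" by (metis obtain_subset_with_card_n)
      then show "\<exists>T\<in>?K. \<forall>a\<in>T. f {w, a}" by (intro bexI[of _ T]) (auto simp: core_trace_def)
    qed
    ultimately show ?thesis by linarith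
  qed
  have "pr (\<lambda>f. \<exists>w\<in>P. 3 \<le> card (core_trace f A w)) \<le> card P * (card A ^ 3 * p ^ 3)"
    using one by (intro prob_union_bound) (auto simp: pool_set_def)
  then show ?thesis by (simp add: pool_set_def)
qed

definition mean :: "nat \<Rightarrow> nat \<Rightarrow> real" where
  "mean s t = (N - s) * (p ^ t * (1 - p) ^ (s - t))"

lemma prob_unbalanced:
  assumes A: "A \<subseteq> Q" "card A < N"
  shows "pr (\<lambda>f. \<not> balanced n m A t (mean (card A) t) f) \<le> card A ^ t * (4 / mean (card A) t)"
proof -
  have finA: "finite A" using A finite_rest finite_subset by blast
  let ?K = "{T. T \<subseteq> A \<and> card T = t}" and ?\<mu> = "mean (card A) t"
  have pos: "0 < ?\<mu>" unfolding mean_def using A p01 by simp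
  define Bad where "Bad T f \<longleftrightarrow> real (card {w \<in> Q - A. core_trace f A w = T}) < ?\<mu> / 2 \<or> 2 * ?\<mu> < real (card {w \<in> Q - A. core_trace f A w = T})"
    for T and f :: "nat set \<Rightarrow> bool"
  have one: "pr (Bad T) \<le> 4 / ?\<mu>" if T: "T \<subseteq> A" "card T = t" for T
    unfolding Bad_def
  proof (rule prob_card_deviation[where J = "\<lambda>w. (\<lambda>a. {w, a}) ` A"])
    show "finite (Q - A)" by (simp add: finite_rest)
    show "depends_on ((\<lambda>a. {w, a}) ` A) (\<lambda>f. core_trace f A w = T)" for w
      by (rule depends_onI) (auto simp: core_trace_def)
    show "disjoint_family_on (\<lambda>w. (\<lambda>a. {w, a}) ` A) (Q - A)"
      by (auto simp: disjoint_family_on_def doubleton_eq_iff)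
    fix w assume w: "w \<in> Q - A"
    have inj: "inj_on (\<lambda>a. {w, a}) X" for X by (auto intro!: inj_onI simp: doubleton_eq_iff)
    have "pr (\<lambda>f. core_trace f A w = T) = pr (\<lambda>f. \<forall>e\<in>(\<lambda>a. {w, a}) ` A. f e \<longleftrightarrow> e \<in> (\<lambda>a. {w, a}) ` T)"
      using T w by (intro arg_cong[of _ _ "\<lambda>X. measure_pmf.prob M X"]) (auto simp: core_trace_def doubleton_eq_iff)
    also have "\<dots> = p ^ card ((\<lambda>a. {w, a}) ` A \<inter> (\<lambda>a. {w, a}) ` T) * (1 - p) ^ card ((\<lambda>a. {w, a}) ` A - (\<lambda>a. {w, a}) ` T)"
      using w A by (intro prob_pattern) (auto intro!: edge_in Q_vertices)
    also have "(\<lambda>a. {w, a}) ` A \<inter> (\<lambda>a. {w, a}) ` T = (\<lambda>a. {w, a}) ` T" using T by blast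
    also have "(\<lambda>a. {w, a}) ` A - (\<lambda>a. {w, a}) ` T = (\<lambda>a. {w, a}) ` (A - T)"
      using T inj[of A] by (auto simp: doubleton_eq_iff)
    finally show "pr (\<lambda>f. core_trace f A w = T) = p ^ t * (1 - p) ^ (card A - t)"
      using T finA by (simp add: card_image[OF inj] card_Diff_subset finite_subset)
  next
    show "?\<mu> = card (Q - A) * (p ^ t * (1 - p) ^ (card A - t))"
      using A finA by (simp add: mean_def card_Diff_subset card_rest)
  qed (rule pos)
  have "pr (\<lambda>f. \<not> balanced n m A t ?\<mu> f) \<le> pr (\<lambda>f. \<exists>T\<in>?K. Bad T f)"
    by (rule prob_mono) (auto simp: balanced_def Bad_def cell_def not_le)
  also have "\<dots> \<le> card ?K * (4 / ?\<mu>)"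
    using one finA by (intro prob_union_bound) auto
  also have "\<dots> \<le> card A ^ t * (4 / ?\<mu>)"
    using card_subsets_le[OF finA, of t] pos by (intro mult_right_mono) auto
  finally show ?thesis .
qed

lemma prob_exists_iff:
  fixes r :: real
  assumes C: "finite C" "\<And>w. w \<in> C \<Longrightarrow> depends_on (J w) (B w)" "disjoint_family_on J C"
    and r: "\<And>w. w \<in> C \<Longrightarrow> pr (B w) = r"
  shows "pr (\<lambda>f. (\<exists>w\<in>C. B w f) \<longleftrightarrow> b) = (if b then 1 - (1 - r) ^ card C else (1 - r) ^ card C)"
proof -
  have "pr (\<lambda>f. {w \<in> C. B w f} = {}) = (1 - r) ^ card C"
    using prob_selection[OF C(1) empty_subsetI C(2,3) r] by simp
  moreover have "{w \<in> C. B w f} = {} \<longleftrightarrow> \<not> (\<exists>w\<in>C. B w f)" for f by blast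
  ultimately have "pr (\<lambda>f. \<not> (\<exists>w\<in>C. B w f)) = (1 - r) ^ card C" by simp
  then show ?thesis using prob_not[of "\<lambda>f. \<exists>w\<in>C. B w f"] by (cases b) simp_all
qed

text \<open>Only the edges from \<open>pool j 4\<close> and \<open>pool j 5\<close> to
  \<open>Q\<close> are resampled, for all \<open>j\<close> at once. The cells depend on edges within
  \<open>Q\<close>, so they are constant. Being disjoint, they let the pairs be decided
  independently within a trial, each as prescribed with probability at least
  \<open>\<delta>\<close>, whether an edge or a non-edge is wanted. There are at most
  \<open>(card A) ^ 2\<close> pairs, and the trials are independent of each other.\<close>

lemma prob_unlucky:
  assumes A: "A \<subseteq> Q" and \<delta>: "0 \<le> \<delta>" "\<delta> \<le> 1"
    and \<mu>: "\<And>k. \<mu> / 2 \<le> real k \<Longrightarrow> real k \<le> 2 * \<mu> \<Longrightarrow> \<delta> \<le> (1 - p\<^sup>2) ^ k \<and> \<delta> \<le> 1 - (1 - p\<^sup>2) ^ k"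
  shows "pr (\<lambda>f. balanced n m A 2 \<mu> f \<and> (\<forall>j<m. \<not> lucky n m A j f)) \<le> (1 - \<delta> ^ (card A)\<^sup>2) ^ m"
proof (rule conditional_bound[where J = "\<Union>j\<in>{..<m}. \<Union>w\<in>Q. {{pool j 4, w}, {pool j 5, w}}"])
  fix g :: "nat set \<Rightarrow> bool"
  have finA: "finite A" using A finite_rest finite_subset by blast
  let ?J = "\<lambda>j. \<Union>w\<in>Q. {{pool j 4, w}, {pool j 5, w}}"
  let ?h = "\<lambda>f. override_on g f (\<Union>j\<in>{..<m}. ?J j)"
  have inP: "pool j 4 \<in> P" "pool j 5 \<in> P" if "j < m" for j using pool_in that by auto
  have edge_disj: "{{pool j 4, w}, {pool j 5, w}} \<inter> {{pool j' 4, w'}, {pool j' 5, w'}} = {}"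
    if "j < m" "j' < m" "w \<in> Q" "w' \<in> Q" "j \<noteq> j' \<or> w \<noteq> w'" for j j' w w'
    using edge_eq_iff[OF _ _ that(3,4)] inP[OF that(1)] inP[OF that(2)] that(5)
      pool_eq_iff[of 4 5 j j'] pool_eq_iff[of 5 4 j j'] pool_eq_iff[of 4 4 j j'] pool_eq_iff[of 5 5 j j']
    by auto
  have cell: "cell n m (?h f) A T = cell n m g A T" for f T
  proof (rule cell_cong)
    fix w a assume "w \<in> Q - A" "a \<in> A"
    then have "{w, a} \<noteq> {u, w'}" if "u \<in> P" for u w'
      using A that pool_rest_disjoint[of m n] by (auto simp: doubleton_eq_iff)
    then have "{w, a} \<notin> (\<Union>j\<in>{..<m}. ?J j)" using inP by blast
    then show "?h f {w, a} = g {w, a}" by simp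
  qed
  let ?K = "{T. T \<subseteq> A \<and> card T = 2}"
  define b where "b T \<longleftrightarrow> (\<exists>k l. k < card A \<and> l < card A \<and> T = {enum A k, enum A l} \<and> level_graph k l)" for T
  define B where "B j w f \<longleftrightarrow> f {pool j 4, w} \<and> f {pool j 5, w}" for j w and f :: "nat set \<Rightarrow> bool"
  define L where "L j f \<longleftrightarrow> (\<forall>T\<in>?K. (\<exists>w\<in>cell n m g A T. B j w f) \<longleftrightarrow> b T)" for j f
  have cellQ: "cell n m g A T \<subseteq> Q" for T by (auto simp: cell_def)
  have L: "lucky n m A j (?h f) \<longleftrightarrow> L j f" if "j < m" for j f
  proof -
    have "?h f {pool j 4, w} = f {pool j 4, w}" "?h f {pool j 5, w} = f {pool j 5, w}" if "w \<in> Q" for w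
      using that \<open>j < m\<close> by (auto simp: override_on_def)
    then show ?thesis unfolding lucky_def L_def b_def B_def cell using cellQ by (simp add: subset_iff cong: bex_cong)
  qed
  show "pr (\<lambda>f. balanced n m A 2 \<mu> (?h f) \<and> (\<forall>j<m. \<not> lucky n m A j (?h f))) \<le> (1 - \<delta> ^ (card A)\<^sup>2) ^ m"
  proof (cases "balanced n m A 2 \<mu> g")
    case False
    then have "\<not> balanced n m A 2 \<mu> (?h f)" for f by (simp add: balanced_def cell)
    then show ?thesis using \<delta> by (simp add: power_le_one)
  next
    case True
    have dep: "depends_on {{pool j 4, w}, {pool j 5, w}} (B j w)" for j w
      by (rule depends_onI) (simp add: B_def)
    have one: "\<delta> \<le> pr (\<lambda>f. (\<exists>w\<in>cell n m g A T. B j w f) \<longleftrightarrow> b T)" if "j < m" "T \<in> ?K" for j T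
    proof -
      have "pr (B j w) = p\<^sup>2" if w: "w \<in> cell n m g A T" for w
      proof -
        have e: "{{pool j 4, w}, {pool j 5, w}} \<subseteq> vertex_pairs n"
          using PQ_edge inP[OF \<open>j < m\<close>] w cellQ by auto
        have "{pool j 4, w} \<noteq> {pool j 5, w}"
          by (simp add: doubleton_eq_iff pool_eq_iff) (auto simp: pool_def)
        then have "card {{pool j 4, w}, {pool j 5, w}} = 2" by simp
        with prob_all[OF e] show ?thesis by (simp add: B_def)
      qed
      then have "pr (\<lambda>f. (\<exists>w\<in>cell n m g A T. B j w f) \<longleftrightarrow> b T) =
         (if b T then 1 - (1 - p\<^sup>2) ^ card (cell n m g A T) else (1 - p\<^sup>2) ^ card (cell n m g A T))"
      proof (intro prob_exists_iff[OF finite_cell dep])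
        show "disjoint_family_on (\<lambda>w. {{pool j 4, w}, {pool j 5, w}}) (cell n m g A T)"
          unfolding disjoint_family_on_def
        proof (intro ballI impI)
          fix w w' assume "w \<in> cell n m g A T" "w' \<in> cell n m g A T" "w \<noteq> w'"
          then show "{{pool j 4, w}, {pool j 5, w}} \<inter> {{pool j 4, w'}, {pool j 5, w'}} = {}"
            using edge_disj[OF \<open>j < m\<close> \<open>j < m\<close>] cellQ by blast
        qed
      qed
      moreover have "\<mu> / 2 \<le> card (cell n m g A T)" "card (cell n m g A T) \<le> 2 * \<mu>"
        using True that unfolding balanced_def by auto
      ultimately show ?thesis using \<mu>[of "card (cell n m g A T)"] by (cases "b T") auto
    qed
    have prL: "\<delta> ^ (card A)\<^sup>2 \<le> pr (L j)" if j: "j < m" for j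
    proof -
      have "pr (L j) = (\<Prod>T\<in>?K. pr (\<lambda>f. (\<exists>w\<in>cell n m g A T. B j w f) \<longleftrightarrow> b T))"
        unfolding L_def
      proof (rule prob_indep_all[where J = "\<lambda>T. \<Union>w\<in>cell n m g A T. {{pool j 4, w}, {pool j 5, w}}"])
        show "finite ?K" using finA by simp
        fix T assume "T \<in> ?K"
        show "depends_on (\<Union>w\<in>cell n m g A T. {{pool j 4, w}, {pool j 5, w}}) (\<lambda>f. (\<exists>w\<in>cell n m g A T. B j w f) \<longleftrightarrow> b T)"
          by (rule depends_onI) (auto simp: B_def)
      next
        show "disjoint_family_on (\<lambda>T. \<Union>w\<in>cell n m g A T. {{pool j 4, w}, {pool j 5, w}}) ?K"
          unfolding disjoint_family_on_def
        proof (intro ballI impI)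
          fix T T' :: "nat set" assume "T \<noteq> T'"
          then have ne: "w \<noteq> w'" if "w \<in> cell n m g A T" "w' \<in> cell n m g A T'" for w w'
            using cell_disjoint that by blast
          define X where "X w = {{pool j 4, w}, {pool j 5, w}}" for w
          have "X w \<inter> X w' = {}" if w: "w \<in> cell n m g A T" "w' \<in> cell n m g A T'" for w w'
          proof -
            have "w \<in> Q" "w' \<in> Q" using w cellQ by blast+
            then show ?thesis unfolding X_def using ne[OF w] by (intro edge_disj[OF j j]) simp_all
          qed
          then have "(\<Union>w\<in>cell n m g A T. X w) \<inter> (\<Union>w\<in>cell n m g A T'. X w) = {}" by blast
          then show "(\<Union>w\<in>cell n m g A T. {{pool j 4, w}, {pool j 5, w}}) \<inter> (\<Union>w\<in>cell n m g A T'. {{pool j 4, w}, {pool j 5, w}}) = {}"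
            unfolding X_def .
        qed
      qed
      moreover have "(\<Prod>T\<in>?K. \<delta>) \<le> (\<Prod>T\<in>?K. pr (\<lambda>f. (\<exists>w\<in>cell n m g A T. B j w f) \<longleftrightarrow> b T))"
        using one[OF j] \<delta> by (intro prod_mono) auto
      moreover have "\<delta> ^ (card A)\<^sup>2 \<le> \<delta> ^ card ?K"
        using card_subsets_le[OF finA, of 2] \<delta> by (intro power_decreasing) auto
      ultimately show ?thesis by simp
    qed
    have depL: "depends_on (?J j) (L j)" for j
    proof (rule depends_onI)
      fix f f' :: "nat set \<Rightarrow> bool" assume "\<And>e. e \<in> ?J j \<Longrightarrow> f e = f' e"
      then have "B j w f = B j w f'" if "w \<in> cell n m g A T" for w T
        using that cellQ unfolding B_def by blast
      then show "L j f = L j f'" unfolding L_def by (simp cong: bex_cong)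
    qed
    have "pr (\<lambda>f. balanced n m A 2 \<mu> (?h f) \<and> (\<forall>j<m. \<not> lucky n m A j (?h f))) \<le> pr (\<lambda>f. \<forall>j\<in>{..<m}. \<not> L j f)"
      using L by (intro prob_mono) auto
    also have "\<dots> = (\<Prod>j<m. pr (\<lambda>f. \<not> L j f))"
    proof (rule prob_indep_all[where J = ?J])
      show "depends_on (?J j) (\<lambda>f. \<not> L j f)" for j using depL[of j] by (simp add: depends_on_def)
      show "disjoint_family_on ?J {..<m}"
        unfolding disjoint_family_on_def
      proof (intro ballI impI)
        fix j j' assume "j \<in> {..<m}" "j' \<in> {..<m}" "j \<noteq> j'"
        then show "?J j \<inter> ?J j' = {}" using edge_disj[of j j'] by blast
      qed
    qed simp
    also have "\<dots> \<le> (\<Prod>j<m. 1 - \<delta> ^ (card A)\<^sup>2)"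
      using prL by (intro prod_mono) (auto simp: prob_not)
    finally show ?thesis by simp
  qed
qed

lemma prob_not_separated:
  assumes A: "A \<subseteq> Q" and v: "v \<in> Q - A" "v' \<in> {1..n} - A" "v \<noteq> v'"
    and \<gamma>: "0 \<le> \<gamma>" "\<gamma> \<le> 1"
    and \<mu>: "\<And>k. \<mu> / 2 - 1 \<le> real k \<Longrightarrow> real k \<le> 2 * \<mu> \<Longrightarrow> \<gamma> \<le> (1 - p) ^ k \<and> \<gamma> \<le> 1 - (1 - p) ^ k"
  shows "pr (\<lambda>f. balanced n m A 3 \<mu> (override_on g f ((\<lambda>w. {v, w}) ` (Q - A - {v, v'}))) \<and>
      \<not> separates n m A v v' (override_on g f ((\<lambda>w. {v, w}) ` (Q - A - {v, v'}))))
    \<le> (1 - \<gamma>) ^ ((card A choose 3) - 1)"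
proof -
  have finA: "finite A" using A finite_rest finite_subset by blast
  let ?J = "(\<lambda>w. {v, w}) ` (Q - A - {v, v'})"
  let ?h = "\<lambda>f. override_on g f ?J"
  have cell: "cell n m (?h f) A T = cell n m g A T" for f T
  proof (rule cell_cong)
    fix w a assume "w \<in> Q - A" "a \<in> A"
    then have "{w, a} \<notin> ?J" using v by (auto simp: doubleton_eq_iff)
    then show "?h f {w, a} = g {w, a}" by simp
  qed
  show ?thesis
  proof (cases "balanced n m A 3 \<mu> g")
    case False
    then have "\<not> balanced n m A 3 \<mu> (?h f)" for f by (simp add: balanced_def cell)
    then show ?thesis using \<gamma> by simp
  next
    case True
    \<comment> \<open>The cell of the trace of \<open>v'\<close> contains \<open>v'\<close> itself, and the edge from \<open>v\<close> to \<open>v'\<close> is not resampled.\<close>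
    define K where "K = {T. T \<subseteq> A \<and> card T = 3} - {core_trace g A v'}"
    have finK: "finite K" using finA by (simp add: K_def)
    define C where "C T = cell n m g A T - {v}" for T
    have C: "C T \<subseteq> Q - A - {v, v'}" if "T \<in> K" for T
      using that by (auto simp: C_def K_def cell_def)
    have finC: "finite (C T)" for T using finite_cell by (simp add: C_def)
    have one: "pr (\<lambda>f. (\<exists>w\<in>C T. f {v, w}) \<longleftrightarrow> hit n m g A T v') \<le> 1 - \<gamma>" if T: "T \<in> K" for T
    proof -
      have "pr (\<lambda>f. (\<exists>w\<in>C T. f {v, w}) \<longleftrightarrow> hit n m g A T v') =
         (if hit n m g A T v' then 1 - (1 - p) ^ card (C T) else (1 - p) ^ card (C T))"
      proof (rule prob_exists_iff[OF finC, where J = "\<lambda>w. {{v, w}}"])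
        show "depends_on {{v, w}} (\<lambda>f. f {v, w})" for w by (rule depends_onI) simp
        show "disjoint_family_on (\<lambda>w. {{v, w}}) (C T)" by (auto simp: disjoint_family_on_def doubleton_eq_iff)
        show "pr (\<lambda>f. f {v, w}) = p" if "w \<in> C T" for w
          using C[OF T] that v(1) by (intro prob_coordinate edge_in Q_vertices) auto
      qed
      moreover have "\<mu> / 2 \<le> card (cell n m g A T)" "card (cell n m g A T) \<le> 2 * \<mu>"
        using True T unfolding balanced_def K_def by auto
      moreover have "card (cell n m g A T) \<le> card (C T) + 1" "card (C T) \<le> card (cell n m g A T)"
        unfolding C_def using finite_cell by (auto simp: card_Diff_singleton_if)
      ultimately show ?thesis using \<mu>[of "card (C T)"] by (cases "hit n m g A T v'") auto
    qed
    have event: "\<forall>T\<in>K. (\<exists>w\<in>C T. f {v, w}) \<longleftrightarrow> hit n m g A T v'"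
      if ns: "\<not> separates n m A v v' (?h f)" for f
    proof
      fix T assume T: "T \<in> K"
      have "hit n m (?h f) A T v \<longleftrightarrow> hit n m (?h f) A T v'"
        using ns T unfolding separates_def K_def by blast
      moreover have "?h f {v, w} = f {v, w}" if "w \<in> C T" for w
        using C[OF T] that by (intro override_on_apply_in) auto
      then have "hit n m (?h f) A T v \<longleftrightarrow> (\<exists>w\<in>C T. f {v, w})"
        unfolding hit_def cell C_def[symmetric] by simp
      moreover have "?h f {v', w} = g {v', w}" for w
        using v(3) by (intro override_on_apply_notin) (auto simp: doubleton_eq_iff)
      then have "hit n m (?h f) A T v' \<longleftrightarrow> hit n m g A T v'"
        unfolding hit_def cell by simp
      ultimately show "(\<exists>w\<in>C T. f {v, w}) \<longleftrightarrow> hit n m g A T v'" by simp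
    qed
    have "pr (\<lambda>f. balanced n m A 3 \<mu> (?h f) \<and> \<not> separates n m A v v' (?h f)) \<le>
       pr (\<lambda>f. \<forall>T\<in>K. (\<exists>w\<in>C T. f {v, w}) \<longleftrightarrow> hit n m g A T v')"
      using event by (intro prob_mono) blast
    also have "\<dots> = (\<Prod>T\<in>K. pr (\<lambda>f. (\<exists>w\<in>C T. f {v, w}) \<longleftrightarrow> hit n m g A T v'))"
    proof (rule prob_indep_all[OF finK, where J = "\<lambda>T. (\<lambda>w. {v, w}) ` C T"])
      show "depends_on ((\<lambda>w. {v, w}) ` C T) (\<lambda>f. (\<exists>w\<in>C T. f {v, w}) \<longleftrightarrow> hit n m g A T v')" for T :: "nat set"
        by (rule depends_onI) auto
      show "disjoint_family_on (\<lambda>T. (\<lambda>w. {v, w}) ` C T) K"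
        unfolding disjoint_family_on_def
      proof (intro ballI impI)
        fix T T' :: "nat set" assume "T \<noteq> T'"
        then have "C T \<inter> C T' = {}" unfolding C_def using cell_disjoint by blast
        then show "(\<lambda>w. {v, w}) ` C T \<inter> (\<lambda>w. {v, w}) ` C T' = {}"
          by (auto simp: doubleton_eq_iff)
      qed
    qed
    also have "\<dots> \<le> (\<Prod>T\<in>K. 1 - \<gamma>)" using one by (intro prod_mono) auto
    also have "\<dots> = (1 - \<gamma>) ^ card K" by simp
    also have "\<dots> \<le> (1 - \<gamma>) ^ ((card A choose 3) - 1)"
    proof (rule power_decreasing)
      have "card {T. T \<subseteq> A \<and> card T = 3} = card A choose 3" by (rule n_subsets[OF finA])
      then show "(card A choose 3) - 1 \<le> card K"
        unfolding K_def by (simp add: card_Diff_singleton_if)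
    qed (use \<gamma> in auto)
    finally show ?thesis .
  qed
qed

text \<open>With the neighbourhood of \<open>v\<close> frozen, the edges from \<open>u\<close> to
  \<open>Q\<close> have to repeat one given pattern. As \<open>p <= 1 - p\<close>, no pattern is
  likelier than the empty one.\<close>

lemma prob_pool_twins:
  "pr (\<lambda>f. \<exists>u\<in>P. \<exists>v\<in>P. u \<noteq> v \<and> (\<forall>w\<in>Q. f {u, w} = f {v, w})) \<le> (6 * m)\<^sup>2 * (1 - p) ^ N"
proof -
  have 1: "pr (\<lambda>f. u \<noteq> v \<and> (\<forall>w\<in>Q. f {u, w} = f {v, w})) \<le> (1 - p) ^ N" if uv: "u \<in> P" "v \<in> P" for u v
  proof (rule conditional_bound[where J = "(\<lambda>w. {u, w}) ` Q"])
    fix g :: "nat set \<Rightarrow> bool"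
    let ?J = "(\<lambda>w. {u, w}) ` Q"
    let ?h = "\<lambda>f. override_on g f ?J"
    show "pr (\<lambda>f. u \<noteq> v \<and> (\<forall>w\<in>Q. ?h f {u, w} = ?h f {v, w})) \<le> (1 - p) ^ N"
    proof (cases "u = v")
      case False
      have "{v, w} \<notin> ?J" if "w \<in> Q" for w
        using edge_eq_iff[OF uv(1,2) _ that] False by auto
      then have "pr (\<lambda>f. u \<noteq> v \<and> (\<forall>w\<in>Q. ?h f {u, w} = ?h f {v, w})) =
        pr (\<lambda>f. \<forall>e\<in>?J. f e \<longleftrightarrow> e \<in> (\<lambda>w. {u, w}) ` {w \<in> Q. g {v, w}})"
      proof -
        have "{u, w} \<in> (\<lambda>w. {u, w}) ` {w \<in> Q. g {v, w}} \<longleftrightarrow> g {v, w}" if "w \<in> Q" for w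
          using that by (auto simp: doubleton_eq_iff)
        moreover have "?h f {u, w} = f {u, w}" "?h f {v, w} = g {v, w}" if "w \<in> Q" for f w
          using that \<open>\<And>w. w \<in> Q \<Longrightarrow> {v, w} \<notin> ?J\<close> by auto
        ultimately show ?thesis using False by simp
      qed
      also have "\<dots> = p ^ card (?J \<inter> (\<lambda>w. {u, w}) ` {w \<in> Q. g {v, w}}) * (1 - p) ^ card (?J - (\<lambda>w. {u, w}) ` {w \<in> Q. g {v, w}})"
        by (rule prob_pattern) (use PQ_edge uv in auto)
      also have "\<dots> \<le> (1 - p) ^ card (?J \<inter> (\<lambda>w. {u, w}) ` {w \<in> Q. g {v, w}}) * (1 - p) ^ card (?J - (\<lambda>w. {u, w}) ` {w \<in> Q. g {v, w}})"
        using p01 by (intro mult_right_mono power_mono) auto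
      also have "\<dots> = (1 - p) ^ card ?J"
        unfolding power_add[symmetric] using card_Int_Diff[of ?J "(\<lambda>w. {u, w}) ` {w \<in> Q. g {v, w}}"] finite_rest by simp
      also have "card ?J = N"
        by (subst card_image) (auto intro!: inj_onI simp: doubleton_eq_iff card_rest)
      finally show ?thesis .
    qed (use p01 in simp)
  qed
  have "pr (\<lambda>f. \<exists>e\<in>P \<times> P. fst e \<noteq> snd e \<and> (\<forall>w\<in>Q. f {fst e, w} = f {snd e, w})) \<le> card (P \<times> P) * (1 - p) ^ N"
    by (rule prob_union_bound) (use 1 in \<open>auto simp: pool_set_def\<close>)
  also have "card (P \<times> P) = (6 * m)\<^sup>2" by (simp add: card_cartesian_product pool_set_def power2_eq_square)
  finally show ?thesis by (simp add: Bex_def)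
qed

section \<open>Union bound over all trials\<close>

definition bad_trial :: "nat \<Rightarrow> nat \<Rightarrow> (nat set \<Rightarrow> bool) \<Rightarrow> bool" where
  "bad_trial s i f \<longleftrightarrow> (\<exists>A. A = selected n m i f \<and> card A = s \<and>
     ((\<exists>w\<in>P. (\<forall>c<4. w \<noteq> pool i c) \<and> 3 \<le> card (core_trace f A w)) \<or>
      (\<forall>j<m. \<not> lucky n m A j f) \<or>
      (\<exists>v\<in>Q - A. \<exists>v'\<in>{1..n} - A. v \<noteq> v' \<and> \<not> separates n m A v v' f)))"

text \<open>Only the edges between the four selecting vertices of trial \<open>i\<close> and
  \<open>Q\<close> are frozen. They determine the core, and all other edges remain fresh, so each
  failure is estimated for a constant set \<open>A\<close>. The estimates for luck and separation
  presuppose balanced cells, whence the two terms with \<open>mean\<close>. A core of the wrong size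
  does not count as bad; it is left to \<open>prob_no_core\<close>.\<close>

lemma prob_bad_trial:
  assumes i: "i < m" and s: "s < N" and \<delta>: "0 \<le> \<delta>" "\<delta> \<le> 1" and \<gamma>: "0 \<le> \<gamma>" "\<gamma> \<le> 1"
    and \<mu>2: "\<And>k. mean s 2 / 2 \<le> real k \<Longrightarrow> real k \<le> 2 * mean s 2 \<Longrightarrow>
      \<delta> \<le> (1 - p\<^sup>2) ^ k \<and> \<delta> \<le> 1 - (1 - p\<^sup>2) ^ k"
    and \<mu>3: "\<And>k. mean s 3 / 2 - 1 \<le> real k \<Longrightarrow> real k \<le> 2 * mean s 3 \<Longrightarrow>
      \<gamma> \<le> (1 - p) ^ k \<and> \<gamma> \<le> 1 - (1 - p) ^ k"
  shows "pr (bad_trial s i) \<le> 6 * m * (s ^ 3 * p ^ 3) + s ^ 2 * (4 / mean s 2) + s ^ 3 * (4 / mean s 3)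
    + (1 - \<delta> ^ s\<^sup>2) ^ m + real n ^ 2 * (1 - \<gamma>) ^ ((s choose 3) - 1)" (is "_ \<le> ?R")
proof (rule conditional_bound[where J = "- (\<Union>w\<in>Q. (\<lambda>c. {pool i c, w}) ` {..<4})"])
  fix g :: "nat set \<Rightarrow> bool"
  define X where "X = (\<Union>w\<in>Q. (\<lambda>c. {pool i c, w}) ` {..<4})"
  define h where "h f = override_on g f (- X)" for f
  have pos: "0 < mean s t" for t unfolding mean_def using s p01 by simp
  have R: "0 \<le> ?R" using pos[of 2] pos[of 3] \<delta> \<gamma> p01 by (simp add: power_le_one)
  have inP: "pool i c \<in> P" if "c < 4" for c using pool_in[OF i, of c] that by simp
  define A where "A = selected n m i g"
  have sel: "selected n m i (h f) = A" for f
  proof -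
    have "h f {pool i c, w} = g {pool i c, w}" if "w \<in> Q" "c < 4" for c w
      unfolding h_def X_def using that by (intro override_on_apply_notin) auto
    then show ?thesis by (auto simp: selected_def A_def)
  qed
  have AQ: "A \<subseteq> Q" by (auto simp: A_def selected_def)
  have "pr (\<lambda>f. bad_trial s i (h f)) \<le> ?R"
  proof (cases "card A = s")
    case False
    then have "\<not> bad_trial s i (h f)" for f unfolding bad_trial_def sel by simp
    then show ?thesis using R by simp
  next
    case True
    have "pool i c \<notin> Q" if "c < 4" for c using inP[OF that] pool_rest_disjoint[of m n] by blast
    then have QQ: "{u, w} \<notin> X" if "u \<in> Q" "w \<in> Q" for u w
      using that by (auto simp: X_def doubleton_eq_iff)
    have h_QQ: "h f {u, w} = f {u, w}" if "u \<in> Q" "w \<in> Q" for f u w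
      using QQ[OF that] by (simp add: h_def)
    have h_PQ: "h f {u, w} = f {u, w}" if "u \<in> P" "w \<in> Q" "\<forall>c<4. u \<noteq> pool i c" for f u w
    proof -
      have "{u, w} \<notin> X" unfolding X_def using edge_eq_iff[OF that(1) inP that(2)] that(3) by auto
      then show ?thesis by (simp add: h_def)
    qed
    have cell: "cell n m (h f) A T = cell n m f A T" for f T
      by (rule cell_cong) (use AQ h_QQ in blast)
    have balanced: "balanced n m A t \<mu> (h f) \<longleftrightarrow> balanced n m A t \<mu> f" for t \<mu> f
      by (simp add: balanced_def cell)
    have lucky: "lucky n m A j (h f) \<longleftrightarrow> lucky n m A j f" if "j < m" for j f
    proof -
      have "h f {pool j c, w} = f {pool j c, w}" if "w \<in> Q" "c \<in> {4, 5}" for c w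
        using that pool_in[OF \<open>j < m\<close>, of c] by (intro h_PQ) (auto simp: pool_eq_iff)
      then have "h f {pool j 4, w} = f {pool j 4, w}" "h f {pool j 5, w} = f {pool j 5, w}"
        if "w \<in> cell n m f A T" for w T
        using that by (auto simp: cell_def)
      then show ?thesis unfolding lucky_def cell by (simp cong: bex_cong)
    qed
    define E1 where "E1 f \<longleftrightarrow> (\<exists>w\<in>P. 3 \<le> card (core_trace f A w))" for f
    define E2 where "E2 f \<longleftrightarrow> \<not> balanced n m A 2 (mean s 2) f" for f
    define E3 where "E3 f \<longleftrightarrow> \<not> balanced n m A 3 (mean s 3) f" for f
    define E4 where "E4 f \<longleftrightarrow> balanced n m A 2 (mean s 2) f \<and> (\<forall>j<m. \<not> lucky n m A j f)" for f
    \<comment> \<open>\<open>h f\<close> is kept here, while the other events are stated for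
      \<open>f\<close>: \<open>v'\<close> may be one of the four selecting vertices, and then its
      hits depend on frozen edges.\<close>
    define E5' where "E5' v v' f \<longleftrightarrow> balanced n m A 3 (mean s 3) (h f) \<and> v \<noteq> v' \<and> \<not> separates n m A v v' (h f)" for v v' f
    define E5 where "E5 f \<longleftrightarrow> (\<exists>v\<in>(Q - A) \<times> ({1..n} - A). E5' (fst v) (snd v) f)" for f
    have "pr (\<lambda>f. bad_trial s i (h f)) \<le> pr (\<lambda>f. E1 f \<or> E2 f \<or> E3 f \<or> E4 f \<or> E5 f)"
    proof (rule prob_mono)
      fix f assume bad: "bad_trial s i (h f)"
      have tr: "core_trace (h f) A w = core_trace f A w" if "w \<in> P" "\<forall>c<4. w \<noteq> pool i c" for w
        unfolding core_trace_def using h_PQ[OF that(1) _ that(2)] AQ by auto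
      consider "\<exists>w\<in>P. (\<forall>c<4. w \<noteq> pool i c) \<and> 3 \<le> card (core_trace (h f) A w)" | "\<forall>j<m. \<not> lucky n m A j (h f)"
        | "\<exists>v\<in>Q - A. \<exists>v'\<in>{1..n} - A. v \<noteq> v' \<and> \<not> separates n m A v v' (h f)"
        using bad unfolding bad_trial_def sel by blast
      then show "E1 f \<or> E2 f \<or> E3 f \<or> E4 f \<or> E5 f"
      proof cases
        case 1
        then show ?thesis using tr unfolding E1_def by metis
      next
        case 2
        then show ?thesis using lucky unfolding E2_def E4_def by blast
      next
        case 3
        then show ?thesis using balanced unfolding E3_def E5_def E5'_def by force
      qed
    qed
    also have "\<dots> \<le> pr E1 + (pr E2 + (pr E3 + (pr E4 + pr E5)))"
      using prob_disj[of E1 "\<lambda>f. E2 f \<or> E3 f \<or> E4 f \<or> E5 f"] prob_disj[of E2 "\<lambda>f. E3 f \<or> E4 f \<or> E5 f"]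
        prob_disj[of E3 "\<lambda>f. E4 f \<or> E5 f"] prob_disj[of E4 E5] by linarith
    also have "pr E1 \<le> 6 * m * (s ^ 3 * p ^ 3)" unfolding E1_def using prob_few[OF AQ] True by simp
    also have "pr E2 \<le> s ^ 2 * (4 / mean s 2)" unfolding E2_def using prob_unbalanced[OF AQ, of 2] True s by simp
    also have "pr E3 \<le> s ^ 3 * (4 / mean s 3)" unfolding E3_def using prob_unbalanced[OF AQ, of 3] True s by simp
    also have "pr E4 \<le> (1 - \<delta> ^ s\<^sup>2) ^ m" unfolding E4_def using prob_unlucky[OF AQ \<delta> \<mu>2] True by simp
    also have "pr E5 \<le> real n ^ 2 * (1 - \<gamma>) ^ ((s choose 3) - 1)"
    proof -
      have one: "pr (E5' v v') \<le> (1 - \<gamma>) ^ ((s choose 3) - 1)" if v: "v \<in> Q - A" "v' \<in> {1..n} - A" for v v'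
      proof (cases "v = v'")
        case True
        then show ?thesis using \<gamma> by (simp add: E5'_def)
      next
        case False
        show ?thesis
        proof (rule conditional_bound[where J = "(\<lambda>w. {v, w}) ` (Q - A - {v, v'})"])
          fix g' :: "nat set \<Rightarrow> bool"
          have sub: "(\<lambda>w. {v, w}) ` (Q - A - {v, v'}) \<subseteq> - X" using QQ v(1) by blast
          show "pr (\<lambda>f. E5' v v' (override_on g' f ((\<lambda>w. {v, w}) ` (Q - A - {v, v'})))) \<le> (1 - \<gamma>) ^ ((s choose 3) - 1)"
            unfolding E5'_def h_def override_on_override_on[OF sub]
            using prob_not_separated[OF AQ v False \<gamma> \<mu>3] False True by (simp add: \<open>card A = s\<close>)
        qed
      qed
      let ?K = "(Q - A) \<times> ({1..n} - A)"
      have "pr E5 \<le> card ?K * (1 - \<gamma>) ^ ((s choose 3) - 1)"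
        unfolding E5_def by (rule prob_union_bound) (use one finite_rest in auto)
      also have "card ?K \<le> card ({1..n} \<times> {1..n})"
        by (rule card_mono) (use Q_vertices in auto)
      then have "real (card ?K) \<le> real n ^ 2" by (simp add: power2_eq_square flip: of_nat_mult)
      then have "card ?K * (1 - \<gamma>) ^ ((s choose 3) - 1) \<le> real n ^ 2 * (1 - \<gamma>) ^ ((s choose 3) - 1)"
        using \<gamma> by (intro mult_right_mono) auto
      finally show ?thesis .
    qed
    finally show ?thesis by (simp add: add.assoc)
  qed
  then show "pr (\<lambda>f. bad_trial s i (override_on g f (- (\<Union>w\<in>Q. (\<lambda>c. {pool i c, w}) ` {..<4})))) \<le> ?R"
    unfolding h_def X_def .
qed

text \<open>Which trial yields a core of size \<open>s\<close> is not known in advance, so the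
  failures are summed over all of them; this is the factor \<open>m\<close>.\<close>

lemma prob_large_depth:
  assumes s: "4 \<le> s" "s < N" and \<delta>: "0 \<le> \<delta>" "\<delta> \<le> 1" and \<gamma>: "0 \<le> \<gamma>" "\<gamma> \<le> 1"
    and \<mu>2: "\<And>k. mean s 2 / 2 \<le> real k \<Longrightarrow> real k \<le> 2 * mean s 2 \<Longrightarrow>
      \<delta> \<le> (1 - p\<^sup>2) ^ k \<and> \<delta> \<le> 1 - (1 - p\<^sup>2) ^ k"
    and \<mu>3: "\<And>k. mean s 3 / 2 - 1 \<le> real k \<Longrightarrow> real k \<le> 2 * mean s 3 \<Longrightarrow>
      \<gamma> \<le> (1 - p) ^ k \<and> \<gamma> \<le> 1 - (1 - p) ^ k"
  shows "measure_pmf.prob (random_graph n p) {G. \<not> (\<exists>a. fo_defines a G \<and> qdepth a \<le> log_star (real n) + 15)} \<le>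
    (6 * m)\<^sup>2 * p + (1 - (N choose s) * ((p ^ 4) ^ s * (1 - p ^ 4) ^ (N - s))) ^ m
    + m * (6 * m * (s ^ 3 * p ^ 3) + s ^ 2 * (4 / mean s 2) + s ^ 3 * (4 / mean s 3)
      + (1 - \<delta> ^ s\<^sup>2) ^ m + real n ^ 2 * (1 - \<gamma>) ^ ((s choose 3) - 1)) + (6 * m)\<^sup>2 * (1 - p) ^ N"
proof -
  define E1 where "E1 f \<longleftrightarrow> (\<exists>u\<in>P. \<exists>v\<in>P. u \<noteq> v \<and> f {u, v})" for f
  define E2 where "E2 f \<longleftrightarrow> (\<forall>i<m. card (selected n m i f) \<noteq> s)" for f
  define E3 where "E3 f \<longleftrightarrow> (\<exists>i\<in>{..<m}. bad_trial s i f)" for f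
  define E4 where "E4 f \<longleftrightarrow> (\<exists>u\<in>P. \<exists>v\<in>P. u \<noteq> v \<and> (\<forall>w\<in>Q. f {u, w} = f {v, w}))" for f :: "nat set \<Rightarrow> bool"
  have "measure_pmf.prob (random_graph n p) {G. \<not> (\<exists>a. fo_defines a G \<and> qdepth a \<le> log_star (real n) + 15)} =
    pr (\<lambda>f. \<not> (\<exists>a. fo_defines a (graph_of_edges n f) \<and> qdepth a \<le> log_star (real n) + 15))"
    unfolding random_graph_def by (simp add: vimage_def)
  also have "\<dots> \<le> pr (\<lambda>f. E1 f \<or> E2 f \<or> E3 f \<or> E4 f)"
  proof (rule prob_mono, rule ccontr)
    fix f assume bad: "\<not> (\<exists>a. fo_defines a (graph_of_edges n f) \<and> qdepth a \<le> log_star (real n) + 15)"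
      and good: "\<not> (E1 f \<or> E2 f \<or> E3 f \<or> E4 f)"
    obtain i where i: "i < m" "card (selected n m i f) = s" using good unfolding E2_def by blast
    define A where "A = selected n m i f"
    have nb: "\<not> bad_trial s i f" using good i unfolding E3_def by blast
    then obtain j where "j < m" "lucky n m A j f" using i unfolding bad_trial_def A_def by blast
    moreover have "\<And>u v. u \<in> P \<Longrightarrow> v \<in> P \<Longrightarrow> u \<noteq> v \<Longrightarrow> \<not> f {u, v}" using good unfolding E1_def by blast
    moreover have "card (core_trace f A w) < 3" if "w \<in> P" "\<And>c. c < 4 \<Longrightarrow> w \<noteq> pool i c" for w
      using nb i that unfolding bad_trial_def A_def by (meson not_le)
    moreover have "\<exists>T\<subseteq>A. card T = 3 \<and> hit n m f A T v \<noteq> hit n m f A T v'"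
      if "v \<in> Q - A" "v' \<in> {1..n} - A" "v \<noteq> v'" for v v'
      using nb i that unfolding bad_trial_def A_def separates_def by blast
    moreover have "\<exists>w\<in>Q. f {v, w} \<noteq> f {v', w}" if "v \<in> P" "v' \<in> P" "v \<noteq> v'" for v v'
      using good that unfolding E4_def by blast
    ultimately have "\<exists>a. fo_defines a (graph_of_edges n f) \<and> qdepth a \<le> log_star (real n) + 15"
      using i s(1) by (intro depth_of_good_sample[OF m _ i(1) A_def]) (auto simp: A_def)
    with bad show False by contradiction
  qed
  also have "\<dots> \<le> pr E1 + (pr E2 + (pr E3 + pr E4))"
    using prob_disj[of E1 "\<lambda>f. E2 f \<or> E3 f \<or> E4 f"] prob_disj[of E2 "\<lambda>f. E3 f \<or> E4 f"]
      prob_disj[of E3 E4] by linarith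
  also have "pr E1 \<le> (6 * m)\<^sup>2 * p" unfolding E1_def by (rule prob_pool_edge)
  also have "pr E2 = (1 - (N choose s) * ((p ^ 4) ^ s * (1 - p ^ 4) ^ (N - s))) ^ m"
    unfolding E2_def by (rule prob_no_core)
  also have "pr E4 \<le> (6 * m)\<^sup>2 * (1 - p) ^ N" unfolding E4_def by (rule prob_pool_twins)
  also have "pr E3 \<le> card {..<m} * (6 * m * (s ^ 3 * p ^ 3) + s ^ 2 * (4 / mean s 2) + s ^ 3 * (4 / mean s 3)
      + (1 - \<delta> ^ s\<^sup>2) ^ m + real n ^ 2 * (1 - \<gamma>) ^ ((s choose 3) - 1))"
    unfolding E3_def by (rule prob_union_bound) (use prob_bad_trial[OF _ s(2) \<delta> \<gamma> \<mu>2 \<mu>3] in auto)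
  finally show ?thesis by (simp add: add.assoc)
qed

end

section \<open>Asymptotics\<close>

lemma one_minus_ge_exp:
  assumes "0 \<le> u" "u \<le> 1 / 2" shows "exp (- (2 * u)) \<le> 1 - (u::real)"
proof -
  have "u * u \<le> u * (1 / 2)" using assms by (intro mult_left_mono) auto
  then have "- (2 * u) \<le> ln (1 - u)"
    using ln_one_minus_pos_lower_bound[OF assms] by (simp add: power2_eq_square)
  then have "exp (- (2 * u)) \<le> exp (ln (1 - u))" by simp
  then show ?thesis using assms by simp
qed

lemma one_minus_power_le: "0 \<le> u \<Longrightarrow> u \<le> 1 \<Longrightarrow> (1 - u) ^ k \<le> exp (- (u * real k))"
proof -
  assume u: "0 \<le> u" "u \<le> 1"
  have "(1 - u) ^ k \<le> exp (- u) ^ k" using u exp_ge_add_one_self[of "- u"] by (intro power_mono) auto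
  also have "\<dots> = exp (- (u * real k))" by (simp add: exp_of_nat_mult[symmetric] mult.commute)
  finally show ?thesis .
qed

lemma one_minus_power_ge: "0 \<le> u \<Longrightarrow> u \<le> 1 / 2 \<Longrightarrow> exp (- (2 * u * real k)) \<le> (1 - u) ^ k"
proof -
  assume u: "0 \<le> u" "u \<le> 1 / 2"
  have "exp (- (2 * u * real k)) = exp (- (2 * u)) ^ k" by (simp add: exp_of_nat_mult[symmetric] mult.commute)
  also have "\<dots> \<le> (1 - u) ^ k" by (intro power_mono one_minus_ge_exp u) simp
  finally show ?thesis .
qed

text \<open>Used with \<open>y\<close> equal to \<open>1 / p ^ 2\<close> for pairs and
  \<open>1 / p\<close> for triples. The means are at least \<open>y / 4\<close>, so a balanced cell
  has at least \<open>y / 8\<close> elements, and losing one still leaves \<open>y / 16\<close>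
  because \<open>y >= 16\<close>. The upper bound on \<open>k\<close> keeps the power above
  \<open>exp (-4)\<close>, which exceeds 1/100; the lower bound keeps it below
  \<open>exp (- 1 / 16)\<close>.\<close>

lemma power_away_from_0_1:
  assumes y: "16 \<le> y" and k: "y / 16 \<le> real k" "real k \<le> 2 * y"
  shows "1 / 100 \<le> (1 - 1 / y) ^ k \<and> 1 / 100 \<le> 1 - (1 - 1 / y) ^ k"
proof
  have "exp 1 ^ 4 \<le> (3::real) ^ 4" using exp_le by (intro power_mono) auto
  then have e4: "exp 4 \<le> (100::real)" by (simp add: exp_of_nat_mult[symmetric])
  have "1 / 100 \<le> exp (- 4 :: real)" using e4 by (simp add: exp_minus field_simps)
  also have "\<dots> \<le> exp (- (2 * (1 / y) * real k))" using y k by (simp add: field_simps)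
  also have "\<dots> \<le> (1 - 1 / y) ^ k" using y by (intro one_minus_power_ge) (auto simp: field_simps)
  finally show "1 / 100 \<le> (1 - 1 / y) ^ k" .
  have "(1 - 1 / y) ^ k \<le> exp (- (1 / y * real k))" using y by (intro one_minus_power_le) auto
  also have "\<dots> \<le> exp (- (1 / 16))" using y k by (simp add: field_simps)
  also have "\<dots> \<le> 1 - 1 / (100::real)"
    using exp_ge_add_one_self[of "1 / 16 :: real"] by (simp add: exp_minus field_simps)
  finally show "1 / 100 \<le> 1 - (1 - 1 / y) ^ k" by simp
qed

text \<open>
  The number of trials exceeds the inverse of the probability of success, which is
  \<open>exp (- O((ln n) powr (4 / 5)))\<close>, while a core of this size has about \<open>(ln n) powr (6 / 5)\<close> triples.
\<close>
definition trials :: "nat \<Rightarrow> nat" where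
  "trials n = nat \<lfloor>real n powr (1 / 10)\<rfloor>"

definition core_size :: "nat \<Rightarrow> nat" where
  "core_size n = nat \<lfloor>ln (real n) powr (2 / 5)\<rfloor>"

lemma prob_large_depth_tendsto_0:
  "(\<lambda>n. measure_pmf.prob (random_graph n (real n powr (- (1 / 4))))
     {G. \<not> (\<exists>a. fo_defines a G \<and> qdepth a \<le> log_star (real n) + 15)}) \<longlonglongrightarrow> 0"
proof (rule tendsto_sandwich[OF _ _ tendsto_const])
  define S where "S x = ln x powr (2 / 5)" for x :: real
  \<comment> \<open>The union bound with the integers \<open>m\<close> and \<open>s\<close> replaced
    by real estimates, so that only growth rates remain to be compared.\<close>
  define U where "U x = 36 * x powr (1 / 5) * x powr (- (1 / 4))
    + exp (- ((x powr (1 / 10) - 1) * exp (- (S x * ln (2 * S x)) - 2)))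
    + x powr (1 / 10) * (6 * x powr (1 / 10) * (S x ^ 3 * x powr (- (3 / 4)))
      + S x ^ 2 * (16 / x powr (1 / 2)) + S x ^ 3 * (16 / x powr (1 / 4))
      + exp (- ((x powr (1 / 10) - 1) * exp (- (S x ^ 2 * ln 100))))
      + x ^ 2 * exp (- (1 / 100 * (((S x - 1) / 3) ^ 3 - 1))))
    + 36 * x powr (1 / 5) * exp (- (x powr (- (1 / 4)) * (x - 6 * x powr (1 / 10))))" for x :: real
  show "(\<lambda>n. U (real n)) \<longlonglongrightarrow> 0"
    unfolding U_def S_def by real_asymp
  have "\<forall>\<^sub>F n in sequentially. 12 * real n powr (1 / 10) + 2 * S n \<le> real n"
    "\<forall>\<^sub>F n in sequentially. S n \<ge> 5" "\<forall>\<^sub>F n in sequentially. real n powr (1 / 10) \<ge> 1"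
    "\<forall>\<^sub>F n in sequentially. S n * real n powr (- (1 / 4)) \<le> 1 / 2"
    "\<forall>\<^sub>F n in sequentially. 65536 \<le> real n"
    unfolding S_def by real_asymp+
  then show "\<forall>\<^sub>F n in sequentially. measure_pmf.prob (random_graph n (real n powr (- (1 / 4))))
     {G. \<not> (\<exists>a. fo_defines a G \<and> qdepth a \<le> log_star (real n) + 15)} \<le> U (real n)"
  proof eventually_elim
    case (elim n)
    define x where "x = real n"
    define p where "p = x powr (- (1 / 4))"
    define m where "m = trials n"
    define s where "s = core_size n"
    define y where "y = x powr (1 / 2)"
    define z where "z = x powr (1 / 4)"
    note el = elim[folded x_def]
    have x: "65536 \<le> x" using el by simp
    have pz: "p = 1 / z" unfolding p_def z_def by (simp add: powr_minus_divide)
    \<comment> \<open>The threshold \<open>65536 = 16 ^ 4\<close> serves this bound, which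
      \<open>power_away_from_0_1\<close> requires.\<close>
    have z: "16 \<le> z"
    proof -
      have "(16 powr 4) powr (1 / 4) \<le> z" unfolding z_def using x by (intro powr_mono2) auto
      then show ?thesis unfolding powr_powr by simp
    qed
    have yz: "y = z ^ 2" "x = z ^ 4"
      unfolding y_def z_def using x by (simp_all add: powr_powr flip: powr_numeral)
    have y: "16 \<le> y" unfolding yz using z power_mono[of 16 z 2] by simp
    have p: "0 < p" "p \<le> 1 / 2" unfolding pz using z by (auto simp: field_simps)
    have m_le: "real m \<le> x powr (1 / 10)" and m_ge: "x powr (1 / 10) - 1 \<le> real m"
      unfolding m_def trials_def x_def[symmetric] using el(3) by linarith+
    have s_le: "real s \<le> S x" and s_ge: "S x - 1 \<le> real s"
      unfolding s_def core_size_def x_def[symmetric] S_def[symmetric] using el(2) by linarith+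
    have s4: "4 \<le> s" using s_ge el(2) by linarith
    have m6: "6 * m \<le> n"
    proof -
      have "real (6 * m) \<le> real n" using m_le el(1,2) unfolding x_def[symmetric] by simp
      then show ?thesis by linarith
    qed
    define N where "N = n - 6 * m"
    have N: "real N = x - 6 * real m" unfolding N_def x_def using m6 by simp
    have N_half: "x / 2 + real s \<le> real N" unfolding N using m_le s_le el(1,2) by linarith
    have sN: "s < N" using N_half x by linarith
    have finE: "finite (vertex_pairs n)" by (rule finite_vertex_pairs)
    interpret random_trials n p m
      by unfold_locales (use finE p m6 in auto)
    \<comment> \<open>The factor 4 splits into 2 for \<open>N - s >= x / 2\<close> and 2 for
      \<open>(1 - p) ^ (s - t) >= 1 / 2\<close>; the latter holds as
      \<open>s * p <= 1 / 2\<close>.\<close>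
    have mean: "x * p ^ t / 4 \<le> mean s t \<and> mean s t \<le> x * p ^ t" for t
    proof -
      have Ns: "x / 2 \<le> real (N - s)" "real (N - s) \<le> x" using N_half sN N by linarith+
      have "1 - real s * p \<le> (1 - p) ^ s" using Bernoulli_inequality[of "- p" s] p by simp
      moreover have "real s * p \<le> 1 / 2"
        using mult_right_mono[OF s_le, of p] p el(4) unfolding p_def by linarith
      moreover have "(1 - p) ^ s \<le> (1 - p) ^ (s - t)" using p by (intro power_decreasing) auto
      ultimately have q: "1 / 2 \<le> (1 - p) ^ (s - t)" "(1 - p) ^ (s - t) \<le> 1"
        using p by (auto intro: power_le_one)
      have "(x / 2) * (p ^ t * (1 / 2)) \<le> mean s t"
        unfolding mean_def N_def[symmetric] using Ns q p x by (intro mult_mono) auto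
      moreover have "mean s t \<le> x * (p ^ t * 1)"
        unfolding mean_def N_def[symmetric] using Ns q p x by (intro mult_mono) auto
      ultimately show ?thesis by simp
    qed
    have p2: "p\<^sup>2 = 1 / y" and p3: "x * p ^ 3 = z" and p2': "x * p ^ 2 = y" and p4: "p ^ 4 = 1 / x"
      unfolding pz yz using z by (auto simp: field_simps power_numeral_reduce)
    have mean2: "y / 4 \<le> mean s 2" "mean s 2 \<le> y" using mean[of 2] unfolding p2' by auto
    have mean3: "z / 4 \<le> mean s 3" "mean s 3 \<le> z" using mean[of 3] unfolding p3 by auto
    have bound: "measure_pmf.prob (random_graph n p) {G. \<not> (\<exists>a. fo_defines a G \<and> qdepth a \<le> log_star (real n) + 15)} \<le>
      (6 * m)\<^sup>2 * p + (1 - (N choose s) * ((p ^ 4) ^ s * (1 - p ^ 4) ^ (N - s))) ^ m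
      + m * (6 * m * (real s ^ 3 * p ^ 3) + real s ^ 2 * (4 / mean s 2) + real s ^ 3 * (4 / mean s 3)
      + (1 - (1 / 100) ^ s\<^sup>2) ^ m + real n ^ 2 * (1 - 1 / 100) ^ ((s choose 3) - 1)) + (6 * m)\<^sup>2 * (1 - p) ^ N"
      unfolding N_def
    proof (rule prob_large_depth[OF s4])
      fix k :: nat
      show "1 / 100 \<le> (1 - p\<^sup>2) ^ k \<and> 1 / 100 \<le> 1 - (1 - p\<^sup>2) ^ k"
        if "mean s 2 / 2 \<le> real k" "real k \<le> 2 * mean s 2"
        unfolding p2 by (rule power_away_from_0_1[OF y]) (use that mean2 y in linarith)+
      show "1 / 100 \<le> (1 - p) ^ k \<and> 1 / 100 \<le> 1 - (1 - p) ^ k"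
        if "mean s 3 / 2 - 1 \<le> real k" "real k \<le> 2 * mean s 3"
        unfolding pz by (rule power_away_from_0_1[OF z]) (use that mean3 z in linarith)+
    qed (use sN N_def in auto)
    have m2: "(real m)\<^sup>2 \<le> x powr (1 / 5)"
    proof -
      have "(real m)\<^sup>2 \<le> (x powr (1 / 10))\<^sup>2" using m_le by (intro power_mono) auto
      then show ?thesis using x by (simp add: powr_powr flip: powr_numeral)
    qed
    have S: "0 \<le> S x" using el(2) by simp
    have sk: "real s ^ k \<le> S x ^ k" for k using s_le by (intro power_mono) auto
    have "(6 * real m)\<^sup>2 * p \<le> 36 * x powr (1 / 5) * x powr (- (1 / 4))"
      unfolding p_def[symmetric] using m2 p by (intro mult_right_mono) (auto simp: power_mult_distrib)
    moreover have "(1 - (N choose s) * ((p ^ 4) ^ s * (1 - p ^ 4) ^ (N - s))) ^ m \<le>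
      exp (- ((x powr (1 / 10) - 1) * exp (- (S x * ln (2 * S x)) - 2)))"
    proof -
      let ?\<eta> = "(N choose s) * ((p ^ 4) ^ s * (1 - p ^ 4) ^ (N - s))"
      \<comment> \<open>By \<open>(N choose s) >= (N / s) ^ s\<close> and \<open>N >= x / 2\<close>,
        the ways of selecting \<open>s\<close> vertices have total weight at least
        \<open>(1 / (2 * s)) ^ s\<close>. The other vertices all stay unselected with probability at
        least \<open>exp (-2)\<close>, since \<open>p ^ 4 = 1 / x\<close>.\<close>
      have "exp (- (S x * ln (2 * S x)) - 2) \<le> ?\<eta>"
      proof -
        have "exp (- (S x * ln (2 * S x))) \<le> exp (- (real s * ln (2 * S x)))"
          using s_le el(2) by (simp add: mult_right_mono)
        also have "\<dots> = (1 / (2 * S x)) ^ s"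
          using el(2) by (simp add: exp_minus exp_of_nat_mult power_one_over inverse_eq_divide)
        also have "\<dots> \<le> (real N / real s * (1 / x)) ^ s"
        proof (rule power_mono)
          have "1 / (2 * S x) \<le> 1 / (2 * real s)" using s_le s4 by (intro divide_left_mono) auto
          also have "\<dots> = (x / 2) / real s * (1 / x)" using x by simp
          also have "\<dots> \<le> real N / real s * (1 / x)"
            using N_half x by (intro mult_right_mono divide_right_mono) auto
          finally show "1 / (2 * S x) \<le> real N / real s * (1 / x)" .
        qed (use el(2) in auto)
        also have "\<dots> = (real N / real s) ^ s * (p ^ 4) ^ s" by (simp only: p4 power_mult_distrib)
        also have "\<dots> \<le> (N choose s) * (p ^ 4) ^ s"
          using binomial_ge_n_over_k_pow_k[of s N, where 'a = real] sN p by (intro mult_right_mono) auto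
        finally have 1: "exp (- (S x * ln (2 * S x))) \<le> (N choose s) * (p ^ 4) ^ s" .
        have "exp (- 2) \<le> exp (- (2 * (1 / x) * real (N - s)))" using N sN x by (simp add: field_simps)
        also have "\<dots> \<le> (1 - 1 / x) ^ (N - s)" using x by (intro one_minus_power_ge) auto
        finally have 2: "exp (- 2) \<le> (1 - p ^ 4) ^ (N - s)" unfolding p4 .
        have "exp (- (S x * ln (2 * S x)) - 2) = exp (- (S x * ln (2 * S x))) * exp (- 2)"
          by (simp flip: exp_add)
        also have "\<dots> \<le> ((N choose s) * (p ^ 4) ^ s) * (1 - p ^ 4) ^ (N - s)"
          using 1 2 p by (intro mult_mono) auto
        finally show ?thesis by (simp add: mult.assoc)
      qed
      note \<eta> = this
      \<comment> \<open>It is a single term in the binomial expansion of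
        \<open>(p ^ 4 + (1 - p ^ 4)) ^ N\<close>.\<close>
      have "?\<eta> \<le> 1"
      proof -
        have "(N choose s) * ((p ^ 4) ^ s * (1 - p ^ 4) ^ (N - s)) \<le> (\<Sum>k\<le>N. (N choose k) * (p ^ 4) ^ k * (1 - p ^ 4) ^ (N - k))"
          using sN x by (intro order_trans[OF _ member_le_sum[of s]]) (auto simp: p4 mult.assoc)
        also have "\<dots> = (p ^ 4 + (1 - p ^ 4)) ^ N" by (rule binomial_ring[symmetric])
        finally show ?thesis by simp
      qed
      then have "(1 - ?\<eta>) ^ m \<le> exp (- (?\<eta> * real m))"
        using \<eta> by (intro one_minus_power_le) (auto intro: order_trans[OF exp_ge_zero])
      also have "\<dots> \<le> exp (- ((x powr (1 / 10) - 1) * exp (- (S x * ln (2 * S x)) - 2)))"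
        using mult_mono[OF m_ge \<eta>] by (simp add: mult.commute)
      finally show ?thesis .
    qed
    moreover have "m * (6 * m * (real s ^ 3 * p ^ 3) + real s ^ 2 * (4 / mean s 2) + real s ^ 3 * (4 / mean s 3)
      + (1 - (1 / 100) ^ s\<^sup>2) ^ m + real n ^ 2 * (1 - 1 / 100) ^ ((s choose 3) - 1)) \<le>
      x powr (1 / 10) * (6 * x powr (1 / 10) * (S x ^ 3 * x powr (- (3 / 4)))
      + S x ^ 2 * (16 / x powr (1 / 2)) + S x ^ 3 * (16 / x powr (1 / 4))
      + exp (- ((x powr (1 / 10) - 1) * exp (- (S x ^ 2 * ln 100))))
      + x ^ 2 * exp (- (1 / 100 * (((S x - 1) / 3) ^ 3 - 1))))"
    proof (rule mult_mono[OF m_le], intro add_mono)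
      have "p ^ 3 = x powr (- (3 / 4))" unfolding p_def using x by (simp add: powr_powr flip: powr_numeral)
      then show "real (6 * m) * (real s ^ 3 * p ^ 3) \<le> 6 * x powr (1 / 10) * (S x ^ 3 * x powr (- (3 / 4)))"
        using m_le sk[of 3] p S by (intro mult_mono) auto
      show "real s ^ 2 * (4 / mean s 2) \<le> S x ^ 2 * (16 / x powr (1 / 2))"
        unfolding y_def[symmetric] using mean2 y sk[of 2] by (intro mult_mono) (auto simp: field_simps)
      show "real s ^ 3 * (4 / mean s 3) \<le> S x ^ 3 * (16 / x powr (1 / 4))"
        unfolding z_def[symmetric] using mean3 z sk[of 3] S by (intro mult_mono) (auto simp: field_simps)
      have d: "exp (- (S x ^ 2 * ln 100)) \<le> (1 / 100) ^ s\<^sup>2"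
      proof -
        have "exp (- (S x ^ 2 * ln 100)) \<le> exp (- (real (s\<^sup>2) * ln 100))"
          using sk[of 2] by (simp add: mult_right_mono)
        also have "\<dots> = (1 / 100) ^ s\<^sup>2"
          by (simp only: exp_minus exp_of_nat_mult exp_ln power_one_over inverse_eq_divide zero_less_numeral)
        finally show ?thesis .
      qed
      have "(1 - (1 / 100) ^ s\<^sup>2) ^ m \<le> exp (- ((1 / 100) ^ s\<^sup>2 * real m))"
        by (intro one_minus_power_le) (auto intro: power_le_one)
      also have "\<dots> \<le> exp (- ((x powr (1 / 10) - 1) * exp (- (S x ^ 2 * ln 100))))"
        using mult_mono[OF m_ge d] by (simp add: mult.commute)
      finally show "(1 - (1 / 100) ^ s\<^sup>2) ^ m \<le> exp (- ((x powr (1 / 10) - 1) * exp (- (S x ^ 2 * ln 100))))" .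
      \<comment> \<open>The cube of \<open>S x\<close> is \<open>ln x powr (6 / 5)\<close>, of
        larger order than \<open>ln x\<close>; this is what outweighs the factor
        \<open>x ^ 2\<close>.\<close>
      have c: "((S x - 1) / 3) ^ 3 - 1 \<le> real ((s choose 3) - 1)"
      proof -
        have "((S x - 1) / 3) ^ 3 \<le> (real s / 3) ^ 3" using s_ge el(2) by (intro power_mono) auto
        also have "\<dots> \<le> real (s choose 3)" using binomial_ge_n_over_k_pow_k[of 3 s, where 'a = real] s4 by simp
        finally show ?thesis by linarith
      qed
      have "(1 - 1 / 100) ^ ((s choose 3) - 1) \<le> exp (- (1 / 100 * real ((s choose 3) - 1)))"
        by (rule one_minus_power_le) auto
      also have "\<dots> \<le> exp (- (1 / 100 * (((S x - 1) / 3) ^ 3 - 1)))" using c by simp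
      finally show "real n ^ 2 * (1 - 1 / 100) ^ ((s choose 3) - 1) \<le> x ^ 2 * exp (- (1 / 100 * (((S x - 1) / 3) ^ 3 - 1)))"
        unfolding x_def[symmetric] by (intro mult_left_mono) auto
    qed (use mean2 mean3 y z p in \<open>auto intro!: add_nonneg_nonneg mult_nonneg_nonneg simp: power_le_one\<close>)
    moreover have "(6 * real m)\<^sup>2 * (1 - p) ^ N \<le> 36 * x powr (1 / 5) * exp (- (x powr (- (1 / 4)) * (x - 6 * x powr (1 / 10))))"
    proof (rule mult_mono)
      show "(6 * real m)\<^sup>2 \<le> 36 * x powr (1 / 5)" using m2 by (simp add: power_mult_distrib)
      have "(1 - p) ^ N \<le> exp (- (p * real N))" using p by (intro one_minus_power_le) auto
      also have "\<dots> \<le> exp (- (p * (x - 6 * x powr (1 / 10))))"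
        using m_le p by (simp add: N mult_left_mono)
      finally show "(1 - p) ^ N \<le> exp (- (x powr (- (1 / 4)) * (x - 6 * x powr (1 / 10))))" unfolding p_def .
    qed (use p in auto)
    ultimately show ?case using bound unfolding U_def x_def[symmetric] p_def[symmetric] by simp
  qed
qed simp

theorem theorem6p1:
  shows "\<exists>c C :: real. c > 0 \<and> C > 0 \<and>
    (\<lambda>n :: nat. measure_pmf.prob (random_graph n (real n powr (- (1 / 4))))
        {G. c * real (log_star (real n)) \<le> real (fo_depth G) \<and>
            real (fo_depth G) \<le> C * real (log_star (real n))})
      \<longlonglongrightarrow> 1"
proof -
  let ?R = "\<lambda>n::nat. random_graph n (real n powr (- (1 / 4)))"
  define low where "low n = measure_pmf.prob (?R n) {G. \<exists>a. fo_defines a G \<and> qdepth a \<le> log_star (real n) div 4}" for n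
  define high where "high n = measure_pmf.prob (?R n) {G. \<not> (\<exists>a. fo_defines a G \<and> qdepth a \<le> log_star (real n) + 15)}" for n
  define good where "good n = measure_pmf.prob (?R n) {G. 1 / 4 * real (log_star (real n)) \<le> real (fo_depth G) \<and>
            real (fo_depth G) \<le> 16 * real (log_star (real n))}" for n
  have "1 - (low n + high n) \<le> good n" if n: "1 \<le> n" for n
  proof -
    let ?L = "log_star (real n)"
    let ?A = "{G. \<exists>a. fo_defines a G \<and> qdepth a \<le> ?L div 4}"
    let ?B = "{G. \<not> (\<exists>a. fo_defines a G \<and> qdepth a \<le> ?L + 15)}"
    \<comment> \<open>Needed for \<open>L + 15 <= 16 * L\<close>, the source of the constant
      16.\<close>
    have L: "1 \<le> ?L" using less_tower_log_star[of n] n by (cases ?L) auto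
    have sub: "G \<in> {G. 1 / 4 * real ?L \<le> real (fo_depth G) \<and> real (fo_depth G) \<le> 16 * real ?L}"
      if G: "G \<in> UNIV - (?A \<union> ?B)" for G
    proof -
      obtain a where a: "fo_defines a G" "qdepth a \<le> ?L + 15" using G by blast
      have "fo_depth G \<le> qdepth a" unfolding fo_depth_def using a by (intro Least_le) blast
      \<comment> \<open>The least depth is attained because some defining sentence exists, which
        lying outside \<open>?B\<close> guarantees.\<close>
      have "\<exists>b. fo_defines b G \<and> qdepth b = fo_depth G"
        unfolding fo_depth_def by (rule LeastI_ex) (use a in blast)
      then have "?L div 4 < fo_depth G" using G by force
      then have "?L \<le> 4 * fo_depth G" by linarith
      then have "1 / 4 * real ?L \<le> real (fo_depth G)" by linarith
      moreover have "fo_depth G \<le> 16 * ?L" using \<open>fo_depth G \<le> qdepth a\<close> a(2) L by linarith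
      then have "real (fo_depth G) \<le> 16 * real ?L" by linarith
      ultimately show ?thesis by simp
    qed
    have "1 - (low n + high n) \<le> 1 - measure_pmf.prob (?R n) (?A \<union> ?B)"
      unfolding low_def high_def using measure_Un_le[of ?A "?R n" ?B] by simp
    also have "\<dots> = measure_pmf.prob (?R n) (UNIV - (?A \<union> ?B))"
      using measure_pmf.prob_compl[of "?A \<union> ?B" "?R n"] by simp
    also have "\<dots> \<le> good n" unfolding good_def by (rule measure_pmf.finite_measure_mono) (use sub in blast, simp)
    finally show ?thesis .
  qed
  then have ev: "\<forall>\<^sub>F n in sequentially. 1 - (low n + high n) \<le> good n"
    by (rule eventually_sequentiallyI)
  have "(\<lambda>n. 1 - (low n + high n)) \<longlonglongrightarrow> 1 - (0 + 0)"
    unfolding low_def high_def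
    by (intro tendsto_diff tendsto_add tendsto_const prob_small_depth_tendsto_0 prob_large_depth_tendsto_0)
  then have lim: "(\<lambda>n. 1 - (low n + high n)) \<longlonglongrightarrow> 1" by simp
  have "good \<longlonglongrightarrow> 1"
    by (rule tendsto_sandwich[OF ev _ lim tendsto_const]) (simp add: good_def)
  then show ?thesis unfolding good_def by (intro exI[of _ "1 / 4"] exI[of _ 16]) simp
qed

end
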